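(* Let $0<s<1$, let $\Omega:S^1\to\mathbb{R}$ be smooth, strictly positive, with $\Omega(\theta+\pi)=\Omega(\theta)$ and $\Omega(\theta)=\Omega(-\theta)$, and let $W(\mathbf{x})=|\mathbf{x}|^{-s}\Omega(\theta)+|\mathbf{x}|^2$ on $\mathbb{R}^2$. Assume the positive functions $a(t),b(t)$ solve the ODE system $$a'(t)=2\big(A(a(t),b(t))-1\big)a(t),\qquad b'(t)=2\big(B(a(t),b(t))-1\big)b(t),$$ where $$\begin{pmatrix}A(a,b)\\ B(a,b)\end{pmatrix}=\tau_s(R_1/R_2)^{2+s}\int_{-\pi}^{\pi}(a^2\cos^2\varphi+b^2\sin^2\varphi)^{-(2+s)/2}\begin{pmatrix}\cos^2\varphi\\ \sin^2\varphi\end{pmatrix}\tilde\Omega(\varphi)\,\mathrm{d}\varphi .$$ Then $\rho(t,\cdot)=\rho_{a(t),b(t)}$ solves the Wasserstein-2 gradient flow equation $$\partial_t\rho+\nabla\cdot(\rho\mathbf{u})=0,\qquad \mathbf{u}=-\nabla W*\rho .$$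
   Context: $S^1=[-\pi,\pi)$ is the set of angles (mod $2\pi$); $\theta$ is the angle of $\mathbf{x}\in\mathbb{R}^2\setminus\{0\}$, i.e. $\mathbf{x}/|\mathbf{x}|=(\cos\theta,\sin\theta)$. The Fourier transform is $\mathcal{F}[f](\xi)=\int_{\mathbb{R}^2}f(\mathbf{x})e^{-2\pi i\mathbf{x}\cdot\xi}\,\mathrm{d}\mathbf{x}$ (extended to tempered distributions). Writing $\xi=|\xi|(\cos\varphi,\sin\varphi)$, $\tilde\Omega$ is defined by $\mathcal{F}[|\mathbf{x}|^{-s}\Omega(\theta)](\xi)=|\xi|^{-2+s}\tilde\Omega(\varphi)$; explicitly, $$\tilde\Omega(\varphi)=\tau_{2-s}\int_{-\pi}^{\pi}|\cos(\varphi-\theta)|^{-2+s}\Big(\Omega(\theta)-\Omega(\varphi+\tfrac{\pi}{2})\Big)\mathrm{d}\theta+c_s\,\Omega(\varphi+\tfrac{\pi}{2}),$$ with $\tau_r=(2\pi)^{-r}\Gamma(r)\cos\frac{r\pi}{2}$ for $0<r<2$ and $c_s=\pi^{s-1}\frac{\Gamma((2-s)/2)}{\Gamma(s/2)}$. Constants: $R_1=\Big(\frac{2\cos\frac{s\pi}{2}}{s(s+1)\pi}\beta\big(\frac12,\frac{3+s}{2}\big)\Big)^{-\frac{1}{s+2}}$ ($\beta$ is the Beta function), $R_2=\Big(\frac{8\sin\frac{s\pi}{2}}{s^2(2+s)\pi}\Big)^{-\frac{1}{s+2}}$, $C_2=\frac{4\sin\frac{s\pi}{2}}{s^2\pi^2}$.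 Let $\rho_2(\mathbf{x})=C_2(R_2^2-|\mathbf{x}|^2)_+^{s/2}$ and, for $a,b>0$, $\rho_{a,b}(\mathbf{x})=\frac{1}{ab}\rho_2\big(\frac{x_1}{a},\frac{x_2}{b}\big)$. *)

theory Defs
  imports "HOL-Analysis.Analysis"
begin

text \<open>\<^term>\<open>iter_deriv f vs\<close> is the iterated directional derivative of \<^term>\<open>f\<close> along the
  vectors in \<^term>\<open>vs\<close>; on \<^typ>\<open>real\<close>, smoothness below is the usual notion of being
  infinitely differentiable.\<close>

primrec iter_deriv :: "('a::euclidean_space \<Rightarrow> real) \<Rightarrow> 'a list \<Rightarrow> 'a \<Rightarrow> real" where
  "iter_deriv f [] = f"
| "iter_deriv f (v # vs) = (\<lambda>x. frechet_derivative (iter_deriv f vs) (at x) v)"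

definition smooth :: "('a::euclidean_space \<Rightarrow> real) \<Rightarrow> bool" where
  "smooth f \<longleftrightarrow> (\<forall>vs x. iter_deriv f vs differentiable (at x))"

definition grad :: "('a::euclidean_space \<Rightarrow> real) \<Rightarrow> 'a \<Rightarrow> 'a" where
  "grad f x = (THE D. GDERIV f x :> D)"

definition convol :: "('a::euclidean_space \<Rightarrow> 'a) \<Rightarrow> ('a \<Rightarrow> real) \<Rightarrow> 'a \<Rightarrow> 'a" where
  "convol F \<rho> x = (LINT y|lborel. \<rho> y *\<^sub>R F (x - y))"

definition velocity :: "('a::euclidean_space \<Rightarrow> real) \<Rightarrow> ('a \<Rightarrow> real) \<Rightarrow> 'a \<Rightarrow> 'a" where
  "velocity W \<rho> x = - convol (grad W) \<rho> x"

definition test_function_on :: "'a::euclidean_space set \<Rightarrow> ('a \<Rightarrow> real) \<Rightarrow> bool" where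
  "test_function_on U \<phi> \<longleftrightarrow>
     smooth \<phi> \<and> compact (closure {z. \<phi> z \<noteq> 0}) \<and> closure {z. \<phi> z \<noteq> 0} \<subseteq> U"

definition prob_density :: "('a::euclidean_space \<Rightarrow> real) \<Rightarrow> bool" where
  "prob_density \<rho> \<longleftrightarrow>
     (\<forall>x. 0 \<le> \<rho> x) \<and> integrable lborel \<rho> \<and> (LINT x|lborel. \<rho> x) = 1"

definition narrowly_continuous_on :: "real set \<Rightarrow> (real \<Rightarrow> 'a::euclidean_space \<Rightarrow> real) \<Rightarrow> bool" where
  "narrowly_continuous_on I \<rho> \<longleftrightarrow>
     (\<forall>f :: 'a \<Rightarrow> real. continuous_on UNIV f \<and> bounded (range f) \<longrightarrow>
        continuous_on I (\<lambda>t. LINT x|lborel. f x * \<rho> t x))"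

text \<open>Solutions of \<open>\<partial>\<^sub>t \<rho> + \<nabla> \<cdot> (\<rho> u) = 0\<close>, \<open>u = - \<nabla>W * \<rho>\<close>, on a time interval \<open>I\<close>: narrowly
  continuous curves of probability densities that satisfy the equation in the sense of
  distributions on the interior of \<open>I\<close> times space. The second to fourth conditions make the
  integrals defining \<open>u\<close> and the weak formulation absolutely convergent.\<close>

definition W2_gradient_flow ::
    "('a::euclidean_space \<Rightarrow> real) \<Rightarrow> real set \<Rightarrow> (real \<Rightarrow> 'a \<Rightarrow> real) \<Rightarrow> bool" where
  "W2_gradient_flow W I \<rho> \<longleftrightarrow>
     (\<forall>t\<in>I. prob_density (\<rho> t)) \<and> narrowly_continuous_on I \<rho> \<and>
     (\<forall>t\<in>I. \<forall>x. integrable lborel (\<lambda>y. \<rho> t y *\<^sub>R grad W (x - y))) \<and>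
     (\<forall>K. compact K \<and> K \<subseteq> interior I \<times> UNIV \<longrightarrow>
        set_integrable lborel K (\<lambda>(t, x). \<rho> t x)) \<and>
     (\<forall>K. compact K \<and> K \<subseteq> interior I \<times> UNIV \<longrightarrow>
        set_integrable lborel K (\<lambda>(t, x). \<rho> t x *\<^sub>R velocity W (\<rho> t) x)) \<and>
     (\<forall>\<phi> :: real \<times> 'a \<Rightarrow> real. test_function_on (interior I \<times> UNIV) \<phi> \<longrightarrow>
        (LINT (t, x)|lborel.
           \<rho> t x * (deriv (\<lambda>\<tau>. \<phi> (\<tau>, x)) t + velocity W (\<rho> t) x \<bullet> grad (\<lambda>y. \<phi> (t, y)) x)) = 0)"

text \<open>Functions on the circle are functions of a real angle, periodicity being assumed where they
  are introduced. Hence it is immaterial that \<^const>\<open>Arg\<close> takes values in \<open>(-\<pi>, \<pi>]\<close> rather than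
  \<open>[-\<pi>, \<pi>)\<close>. At the origin the singular term has the value \<open>0\<close>.\<close>

definition angle :: "real^2 \<Rightarrow> real" where
  "angle x = Arg (Complex (x $ 1) (x $ 2))"

definition potential :: "real \<Rightarrow> (real \<Rightarrow> real) \<Rightarrow> real^2 \<Rightarrow> real" where
  "potential s \<Omega> x = norm x powr (-s) * \<Omega> (angle x) + (norm x)\<^sup>2"

definition tau :: "real \<Rightarrow> real" where
  "tau r = (2 * pi) powr (-r) * Gamma r * cos (r * pi / 2)"

definition c_const :: "real \<Rightarrow> real" where
  "c_const s = pi powr (s - 1) * Gamma ((2 - s) / 2) / Gamma (s / 2)"

text \<open>The angular part of the Fourier transform (with kernel \<open>exp (- 2 \<pi> i x \<cdot> \<xi>)\<close>) of
  \<open>|x|\<^sup>-\<^sup>s \<Omega>(\<theta>)\<close>, which is \<open>|\<xi>|\<^sup>s\<^sup>-\<^sup>2\<close> times \<open>Omega_tilde s \<Omega>\<close>. The subtraction of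
  \<open>\<Omega>(\<phi> + \<pi>/2)\<close> makes the integral absolutely convergent for smooth \<open>\<pi>\<close>-periodic \<open>\<Omega>\<close>.\<close>

definition Omega_tilde :: "real \<Rightarrow> (real \<Rightarrow> real) \<Rightarrow> real \<Rightarrow> real" where
  "Omega_tilde s \<Omega> \<phi> =
     tau (2 - s) *
       (LINT \<theta>:{-pi..pi}|lborel. \<bar>cos (\<phi> - \<theta>)\<bar> powr (-2 + s) * (\<Omega> \<theta> - \<Omega> (\<phi> + pi / 2)))
     + c_const s * \<Omega> (\<phi> + pi / 2)"

definition R1 :: "real \<Rightarrow> real" where
  "R1 s = (2 * cos (s * pi / 2) / (s * (s + 1) * pi) * Beta (1 / 2) ((3 + s) / 2)) powr (- 1 / (s + 2))"

definition R2 :: "real \<Rightarrow> real" where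
  "R2 s = (8 * sin (s * pi / 2) / (s\<^sup>2 * (2 + s) * pi)) powr (- 1 / (s + 2))"

definition C2 :: "real \<Rightarrow> real" where
  "C2 s = 4 * sin (s * pi / 2) / (s\<^sup>2 * pi\<^sup>2)"

definition rho2 :: "real \<Rightarrow> real^2 \<Rightarrow> real" where
  "rho2 s x = C2 s * max 0 ((R2 s)\<^sup>2 - (norm x)\<^sup>2) powr (s / 2)"

definition rho_ab :: "real \<Rightarrow> real \<Rightarrow> real \<Rightarrow> real^2 \<Rightarrow> real" where
  "rho_ab s a b x = 1 / (a * b) * rho2 s (vector [x $ 1 / a, x $ 2 / b])"

definition A_coeff :: "real \<Rightarrow> (real \<Rightarrow> real) \<Rightarrow> real \<Rightarrow> real \<Rightarrow> real" where
  "A_coeff s \<Omega> a b = tau s * (R1 s / R2 s) powr (2 + s) *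
     (LINT \<phi>:{-pi..pi}|lborel.
        (a\<^sup>2 * (cos \<phi>)\<^sup>2 + b\<^sup>2 * (sin \<phi>)\<^sup>2) powr (- (2 + s) / 2) * (cos \<phi>)\<^sup>2 * Omega_tilde s \<Omega> \<phi>)"

definition B_coeff :: "real \<Rightarrow> (real \<Rightarrow> real) \<Rightarrow> real \<Rightarrow> real \<Rightarrow> real" where
  "B_coeff s \<Omega> a b = tau s * (R1 s / R2 s) powr (2 + s) *
     (LINT \<phi>:{-pi..pi}|lborel.
        (a\<^sup>2 * (cos \<phi>)\<^sup>2 + b\<^sup>2 * (sin \<phi>)\<^sup>2) powr (- (2 + s) / 2) * (sin \<phi>)\<^sup>2 * Omega_tilde s \<Omega> \<phi>)"

end

theory Submission
  imports Defs
begin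

text \<open>The densities \<open>rho_ab s a b\<close> are the images of \<open>rho2 s\<close> under the linear maps
\<open>diag(a, b)\<close>. If the velocity field is linear on the ellipse that carries the density,
\<open>u(x) = (\<alpha> x\<^sub>1, \<beta> x\<^sub>2)\<close>, then this family is transported by \<open>u\<close> as soon as
\<open>a' = \<alpha> a\<close> and \<open>b' = \<beta> b\<close>. The quadratic part of the potential contributes \<open>- 2 x\<close> to the velocity,
so everything rests on one fact: for \<open>x\<close> in the ellipse
\<open>- (\<nabla>(|x|\<^sup>-\<^sup>s \<Omega>) * rho_ab s a b)(x) = (2 A x\<^sub>1, 2 B x\<^sub>2)\<close>.

The left-hand side is computed in physical space. The force kernel is odd and homogeneous of degree
\<open>- s - 1\<close>. On every line through \<open>x\<close> the density is the power \<open>s/2\<close> of the positive part of a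
quadratic polynomial, hence the integral along that line is the classical Riesz integral
\<open>\<integral> max 0 (c + 2 \<beta> t - \<gamma> t\<^sup>2) powr (s/2) |t|\<^sup>-\<^sup>s sgn t dt\<close>. It is a constant multiple of
\<open>\<beta> \<gamma> powr (s/2 - 1)\<close>, where \<open>\<beta>\<close> is linear in \<open>x\<close> and \<open>\<gamma>\<close> depends only on the direction
(lemma \<open>Riesz_quadratic_integral\<close>). What remains is an integral over the directions of the lines, and
the symmetries of \<open>\<Omega>\<close> make its matrix diagonal (lemma \<open>force_integral\<close>).

On the other side, \<open>A\<close> and \<open>B\<close> are integrals of the hypersingular transform \<open>Omega_tilde\<close> of \<open>\<Omega>\<close>
against an explicit function of the angle. One integration by parts replaces the singularity
\<open>|cos|\<^sup>s\<^sup>-\<^sup>2\<close> by the integrable \<open>|sin|\<^sup>s\<^sup>-\<^sup>1\<close> (lemma \<open>Omega_tilde_eq\<close>). The resulting operator is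
symmetric, so it can be moved from \<open>\<Omega>\<close> to the explicit function (lemma \<open>pairing_Omega_tilde\<close>). There
it can be evaluated in closed form, because in projective coordinates the integrand is a polynomial
in one variable times a power of a quadratic polynomial
(lemma \<open>hypersingular_integral_quadratic_form\<close>). This gives \<open>A\<close> and \<open>B\<close> as integrals of \<open>\<Omega>\<close> against
\<open>ellipse_kernel\<close>. A last integration by parts in the angle shows that the directional
integral of the force has the same form (lemma \<open>ellipse_integration_by_parts\<close>), and the reflection
and duplication formulas for the Gamma function identify the constants.

The closed form also shows that \<open>A\<close> and \<open>B\<close> are continuous in \<open>(a, b)\<close>, so that \<open>a\<close> and \<open>b\<close> are
continuously differentiable. In the weak formulation, the substitution \<open>x = (a y\<^sub>1, b y\<^sub>2)\<close>
turns the integrand into \<open>rho2(y)\<close> times the total time derivative of the test function along a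
trajectory, and the integral over time vanishes (lemma \<open>transport_weak_formulation\<close>).\<close>

section \<open>The Riesz integral of a quadratic polynomial\<close>

text \<open>The Beta integral of \<open>(x / (1 - x)) powr p\<close> in the variable \<open>y\<close> with \<open>x = (y\<^sup>2 - 1) / (y\<^sup>2 - k)\<close>,
for which \<open>x / (1 - x) = (y\<^sup>2 - 1) / (1 - k)\<close>. It is the form in which the Beta function enters
the Riesz integral below.\<close>

lemma Beta_substitution:
  fixes p k :: real
  assumes p: "0 < p" "p < 1" and k: "0 \<le> k" "k < 1"
  shows "(\<lambda>y. 2 * y / (y\<^sup>2 - k)\<^sup>2 * (y\<^sup>2 - 1) powr p) absolutely_integrable_on {1<..} \<and>
    integral {1<..} (\<lambda>y. 2 * y / (y\<^sup>2 - k)\<^sup>2 * (y\<^sup>2 - 1) powr p) = (1 - k) powr (p - 1) * Beta (1 + p) (1 - p)"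
proof -
  let ?g = "\<lambda>y::real. (y\<^sup>2 - 1) / (y\<^sup>2 - k)"
  let ?g' = "\<lambda>y::real. 2 * y * (1 - k) / (y\<^sup>2 - k)\<^sup>2"
  let ?f = "\<lambda>x::real. x powr p * (1 - x) powr (- p)"
  have y2: "y\<^sup>2 > 1" if "y > 1" for y :: real using that by (simp add: one_less_power)
  have der: "(?g has_field_derivative ?g' y) (at y within {1<..})" if "y \<in> {1<..}" for y
  proof -
    have "1 < y\<^sup>2" using that by (intro y2) simp
    then have "y\<^sup>2 - k \<noteq> 0" using k by linarith
    then show ?thesis
      by (auto intro!: derivative_eq_intros simp: field_simps power2_eq_square)
  qed
  have inj: "inj_on ?g {1<..}"
  proof (rule inj_onI)
    fix x y :: real assume xy: "x \<in> {1<..}" "y \<in> {1<..}" "?g x = ?g y"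
    have "x\<^sup>2 - k \<noteq> 0" "y\<^sup>2 - k \<noteq> 0" using y2[of x] y2[of y] xy(1,2) k by fastforce+
    with xy(3) have "(x\<^sup>2 - 1) * (y\<^sup>2 - k) = (y\<^sup>2 - 1) * (x\<^sup>2 - k)" by (simp add: field_simps)
    then have "(1 - k) * (x\<^sup>2 - y\<^sup>2) = 0" by (simp add: algebra_simps)
    with k have "x\<^sup>2 = y\<^sup>2" by simp
    with xy show "x = y" by (auto simp: power2_eq_iff)
  qed
  have img: "?g ` {1<..} = {0<..<1}"
  proof safe
    fix y :: real assume "y > 1"
    then have "y\<^sup>2 > 1" using y2 by auto
    then show "?g y \<in> {0<..<1}" using k by (auto simp: field_simps)
  next
    fix x :: real assume x: "x \<in> {0<..<1}"
    define y where "y = sqrt ((1 - k * x) / (1 - x))"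
    have kx: "k * x < x" using x k by simp
    have "(1 - k * x) / (1 - x) > 1" using x kx by (simp add: field_simps)
    then have y: "y > 1" "y\<^sup>2 = (1 - k * x) / (1 - x)"
      unfolding y_def by (auto simp: real_less_rsqrt)
    have "x = ?g y" unfolding y(2) using x k by (simp add: divide_simps) (simp add: algebra_simps)
    with y show "x \<in> ?g ` {1<..}" by auto
  qed
  have "((\<lambda>t. t powr ((1 + p) - 1) * (1 - t) powr ((1 - p) - 1)) has_integral Beta (1 + p) (1 - p)) {0..1}"
    using p by (intro has_integral_Beta_real) auto
  then have B: "(?f has_integral Beta (1 + p) (1 - p)) {0<..<1}"
    by (simp add: has_integral_Icc_iff_Ioo)
  then have "?f absolutely_integrable_on {0<..<1} \<and> integral {0<..<1} ?f = Beta (1 + p) (1 - p)"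
    by (auto intro!: nonnegative_absolutely_integrable_1 simp: has_integral_iff)
  then have *: "(\<lambda>y. \<bar>?g' y\<bar> * ?f (?g y)) absolutely_integrable_on {1<..} \<and>
      integral {1<..} (\<lambda>y. \<bar>?g' y\<bar> * ?f (?g y)) = Beta (1 + p) (1 - p)"
    using has_absolute_integral_change_of_variables_1'[OF _ der inj, of ?f] img by simp
  have eq: "\<bar>?g' y\<bar> * ?f (?g y) = (1 - k) powr (1 - p) * (2 * y / (y\<^sup>2 - k)\<^sup>2 * (y\<^sup>2 - 1) powr p)"
    if "y \<in> {1<..}" for y
  proof -
    have y: "y\<^sup>2 > 1" "y > 1" using y2 that by auto
    have ne: "y\<^sup>2 - k \<noteq> 0" using y k by linarith
    then have e: "1 - ?g y = (1 - k) / (y\<^sup>2 - k)" by (simp add: divide_simps)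
    have "?f (?g y) = (y\<^sup>2 - 1) powr p * (1 - k) powr (- p)"
      unfolding e using y k ne by (simp add: powr_divide powr_minus field_simps)
    moreover have "(1 - k) powr (1 - p) = (1 - k) * (1 - k) powr (- p)"
      using k by (simp add: powr_diff powr_minus field_simps)
    moreover have "\<bar>?g' y\<bar> = ?g' y" using y k by (intro abs_of_nonneg) simp
    ultimately show ?thesis by (simp only:) (simp add: field_simps)
  qed
  define d where "d = (1 - k) powr (1 - p)"
  define G where "G = (\<lambda>y. 2 * y / (y\<^sup>2 - k)\<^sup>2 * (y\<^sup>2 - 1) powr p)"
  have "(\<lambda>y. d * G y) absolutely_integrable_on {1<..} \<and> integral {1<..} (\<lambda>y. d * G y) = Beta (1 + p) (1 - p)"
    using * unfolding d_def G_def
    by (simp only: set_integrable_cong[OF refl refl eq] Henstock_Kurzweil_Integration.integral_cong[OF eq])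
  moreover have d: "d \<noteq> 0" "(1 - k) powr (p - 1) = 1 / d"
    using k unfolding d_def by (auto simp: powr_minus_divide[symmetric])
  ultimately have "G absolutely_integrable_on {1<..}" and B: "Beta (1 + p) (1 - p) = d * integral {1<..} G"
    by simp_all
  then show ?thesis unfolding G_def[symmetric] d(2) B using d(1) by simp
qed

text \<open>The substitution \<open>t = 1 / (\<mu> y - \<nu>)\<close> sends the pole of \<open>t powr (- 2 p)\<close> to infinity and the positive
root of the quadratic polynomial to \<open>1\<close>. Since \<open>1 + \<nu> t = \<mu> y t\<close>, the polynomial becomes
\<open>(\<mu> t)\<^sup>2 (y\<^sup>2 - 1)\<close>, and the powers of \<open>t\<close> cancel.\<close>

lemma half_line_substitution:
  fixes p \<mu> \<nu> :: real
  assumes p: "0 < p" "p < 1/2" and mn: "\<bar>\<nu>\<bar> < \<mu>"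
  defines "f \<equiv> (\<lambda>t. ((1 + \<nu> * t)\<^sup>2 - (\<mu> * t)\<^sup>2) powr p * t powr (- (2 * p)))"
    and "h \<equiv> (\<lambda>y. \<mu> powr (2 * p) * \<mu> * ((y\<^sup>2 - 1) powr p / (\<mu> * y - \<nu>)\<^sup>2))"
  shows "f absolutely_integrable_on {0<..<1 / (\<mu> - \<nu>)}"
    and "h absolutely_integrable_on {1<..}"
    and "integral {0<..<1 / (\<mu> - \<nu>)} f = integral {1<..} h"
proof -
  let ?T = "1 / (\<mu> - \<nu>)"
  let ?g = "\<lambda>y::real. 1 / (\<mu> * y - \<nu>)"
  let ?g' = "\<lambda>y::real. - \<mu> / (\<mu> * y - \<nu>)\<^sup>2"
  have mu: "\<mu> > 0" "\<mu> - \<nu> > 0" using mn by auto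
  have pos: "\<mu> * y - \<nu> > \<mu> - \<nu>" if "y > 1" for y using that mu by simp
  show f_int: "f absolutely_integrable_on {0<..<?T}"
  proof -
    have "(\<lambda>t. t powr (- (2 * p))) integrable_on {0<..<?T}"
      using integrable_on_powr_from_0[of "- (2 * p)" ?T] p mu by (simp add: integrable_on_Icc_iff_Ioo)
    then have 1: "(\<lambda>t. t powr (- (2 * p))) absolutely_integrable_on {0<..<?T}"
      by (rule nonnegative_absolutely_integrable_1) simp
    have 2: "continuous_on {0..?T} (\<lambda>t. ((1 + \<nu> * t)\<^sup>2 - (\<mu> * t)\<^sup>2) powr p)"
    proof (intro continuous_on_powr' continuous_intros ballI)
      fix t assume t: "t \<in> {0..?T}"
      have "t * (\<mu> - \<nu>) \<le> 1" using t mu by (simp add: field_simps)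
      moreover have "t * (\<mu> + \<nu>) \<ge> 0" using t mn by simp
      ultimately have "(1 + \<nu> * t - \<mu> * t) \<ge> 0" "(1 + \<nu> * t + \<mu> * t) \<ge> 0" by (auto simp: algebra_simps)
      then have "(1 + \<nu> * t - \<mu> * t) * (1 + \<nu> * t + \<mu> * t) \<ge> 0" by (rule mult_nonneg_nonneg)
      then show "0 \<le> (1 + \<nu> * t)\<^sup>2 - (\<mu> * t)\<^sup>2 \<and> ((1 + \<nu> * t)\<^sup>2 - (\<mu> * t)\<^sup>2 = 0 \<longrightarrow> 0 < p)"
        using p by (auto simp: algebra_simps power2_eq_square)
    qed
    have "(\<lambda>t. ((1 + \<nu> * t)\<^sup>2 - (\<mu> * t)\<^sup>2) powr p) \<in> borel_measurable (lebesgue_on {0<..<?T})"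
      by (rule continuous_imp_measurable_on_sets_lebesgue[OF continuous_on_subset[OF 2]]) auto
    moreover have "bounded ((\<lambda>t. ((1 + \<nu> * t)\<^sup>2 - (\<mu> * t)\<^sup>2) powr p) ` {0<..<?T})"
      by (rule bounded_subset[OF compact_imp_bounded[OF compact_continuous_image[OF 2]]]) auto
    ultimately have "(\<lambda>t. ((1 + \<nu> * t)\<^sup>2 - (\<mu> * t)\<^sup>2) powr p * t powr (- (2 * p))) absolutely_integrable_on {0<..<?T}"
      by (intro absolutely_integrable_bounded_measurable_product_real 1) auto
    then show ?thesis unfolding f_def .
  qed
  have der: "(?g has_field_derivative ?g' y) (at y within {1<..})" if "y \<in> {1<..}" for y
  proof -
    have "\<mu> * y - \<nu> \<noteq> 0" using pos[of y] mu that by auto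
    then show ?thesis
      by (auto intro!: derivative_eq_intros simp: power2_eq_square)
  qed
  have inj: "inj_on ?g {1<..}" using mu by (auto simp: inj_on_def)
  have img: "?g ` {1<..} = {0<..<?T}"
  proof safe
    fix y :: real assume "y > 1"
    then have "0 < \<mu> - \<nu>" "\<mu> - \<nu> < \<mu> * y - \<nu>" using pos[of y] mu by auto
    then show "?g y \<in> {0<..<?T}" by (simp add: frac_less2)
  next
    fix t assume t: "t \<in> {0<..<?T}"
    have "(1 / t + \<nu>) / \<mu> > 1" using t mu by (simp add: field_simps)
    moreover have "?g ((1 / t + \<nu>) / \<mu>) = t" using t mu by simp
    ultimately show "t \<in> ?g ` {1<..}" by (metis greaterThan_iff image_eqI)
  qed
  have eq: "\<bar>?g' y\<bar> * f (?g y) = h y" if "y \<in> {1<..}" for y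
  proof -
    have y: "y > 1" using that by simp
    define w where "w = \<mu> * y - \<nu>"
    have w: "w > 0" using pos[OF y] mu(2) w_def by linarith
    have y1: "y\<^sup>2 > 1" using y by (simp add: one_less_power)
    have "1 + \<nu> * (1 / w) = \<mu> * y / w" using w by (simp add: field_simps w_def)
    then have e: "(1 + \<nu> * (1 / w))\<^sup>2 - (\<mu> * (1 / w))\<^sup>2 = (\<mu> / w)\<^sup>2 * (y\<^sup>2 - 1)"
      by (simp add: power2_eq_square algebra_simps add_divide_distrib diff_divide_distrib)
    have "f (1 / w) = ((\<mu> / w) powr 2) powr p * (y\<^sup>2 - 1) powr p * (1 / w) powr (- (2 * p))"
      unfolding f_def e using y1 mu w by (simp add: powr_mult)
    also have "\<dots> = \<mu> powr (2 * p) * (y\<^sup>2 - 1) powr p"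
      unfolding powr_powr using mu w by (simp add: powr_divide powr_minus field_simps)
    finally show ?thesis using w mu unfolding h_def w_def[symmetric] by simp
  qed
  have "(\<lambda>y. \<bar>?g' y\<bar> * f (?g y)) absolutely_integrable_on {1<..} \<and>
      integral {1<..} (\<lambda>y. \<bar>?g' y\<bar> * f (?g y)) = integral {0<..<?T} f"
    using has_absolute_integral_change_of_variables_1'[OF _ der inj, of f "integral {0<..<?T} f"] img f_int by simp
  then have "h absolutely_integrable_on {1<..} \<and> integral {1<..} h = integral {0<..<?T} f"
    by (simp only: set_integrable_cong[OF refl refl eq] Henstock_Kurzweil_Integration.integral_cong[OF eq])
  then show "h absolutely_integrable_on {1<..}" and "integral {0<..<?T} f = integral {1<..} h" by auto
qed


lemma lborel_integral_of_absolutely_integrable: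
  fixes f :: "real \<Rightarrow> real"
  assumes "f absolutely_integrable_on S" "S \<in> sets borel" "f \<in> borel_measurable borel"
  shows "integrable lborel (\<lambda>t. indicator S t * f t)"
    and "(LINT t|lborel. indicator S t * f t) = integral S f"
proof -
  have m: "(\<lambda>t. indicator S t * f t) \<in> borel_measurable lborel"
    using assms by simp
  have "set_integrable lebesgue S f" using assms by simp
  then show "integrable lborel (\<lambda>t. indicator S t * f t)"
    unfolding set_integrable_def using integrable_completion[OF m] by simp
  have "(LINT t|lborel. indicator S t * f t) = (LINT t:S|lebesgue. f t)"
    unfolding set_lebesgue_integral_def using integral_completion[OF m] by simp
  also have "\<dots> = integral S f" using assms(1) by (rule set_lebesgue_integral_eq_integral(2))
  finally show "(LINT t|lborel. indicator S t * f t) = integral S f" .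
qed

text \<open>The potential of the density \<open>(c - x\<^sup>2) powr p\<close> under the kernel \<open>|x| powr (1 - 2 p)\<close> is quadratic on
the support, hence its derivative is linear; this is the statement with the centre and the scale of the
parabola left free. The two half-lines are treated by the same substitution, and the difference
\<open>(\<mu> y - \<nu>)\<^sup>-\<^sup>2 - (\<mu> y + \<nu>)\<^sup>-\<^sup>2\<close> of the two Jacobians is a multiple of the integrand of
lemma \<open>Beta_substitution\<close> with \<open>k = (\<nu> / \<mu>)\<^sup>2\<close>.\<close>

lemma Riesz_quadratic_integral:
  fixes p c \<beta> \<gamma> :: real
  assumes p: "0 < p" "p < 1/2" and c: "0 < c" and g: "0 < \<gamma>"
  defines "F \<equiv> (\<lambda>t. max 0 (c + 2 * \<beta> * t - \<gamma> * t\<^sup>2) powr p * (\<bar>t\<bar> powr (- (2 * p)) * sgn t))"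
  shows "integrable lborel F"
    and "(LINT t|lborel. F t) = 2 * Beta (1 + p) (1 - p) * \<beta> * \<gamma> powr (p - 1)"
proof -
  \<comment> \<open>With these parameters the polynomial is \<open>c ((1 + \<nu> t)\<^sup>2 - (\<mu> t)\<^sup>2)\<close>; its roots have opposite signs because \<open>|\<nu>| < \<mu>\<close>.\<close>
  define \<nu> where "\<nu> = \<beta> / c"
  define \<mu> where "\<mu> = sqrt (\<gamma> / c + \<nu>\<^sup>2)"
  have "\<mu> > sqrt (\<nu>\<^sup>2)" unfolding \<mu>_def real_sqrt_less_iff using c g by simp
  then have mn: "\<bar>\<nu>\<bar> < \<mu>" by simp
  have mu2: "\<mu>\<^sup>2 - \<nu>\<^sup>2 = \<gamma> / c" unfolding \<mu>_def using c g by simp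
  have mu: "\<mu> > 0" using mn by simp
  define f where "f n t = ((1 + n * t)\<^sup>2 - (\<mu> * t)\<^sup>2) powr p * t powr (- (2 * p))" for n t :: real
  define h where "h n y = \<mu> powr (2 * p) * \<mu> * ((y\<^sup>2 - 1) powr p / (\<mu> * y - n)\<^sup>2)" for n y :: real
  define S where "S n = {0<..<1 / (\<mu> - n)}" for n :: real
  have half: "f n absolutely_integrable_on S n" "h n absolutely_integrable_on {1<..}"
      "integral (S n) (f n) = integral {1<..} (h n)" if "n = \<nu> \<or> n = - \<nu>" for n
    unfolding f_def[abs_def] h_def[abs_def] S_def
    by (rule half_line_substitution[OF p]; use that mn in auto)+
  have meas: "f n \<in> borel_measurable borel" for n unfolding f_def[abs_def] by measurable
  define A where "A n t = indicator (S n) t * f n t" for n t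
  have A: "integrable lborel (A n)" "(LINT t|lborel. A n t) = integral {1<..} (h n)" if "n = \<nu> \<or> n = - \<nu>" for n
    unfolding A_def[abs_def]
    using lborel_integral_of_absolutely_integrable[OF half(1)[OF that] _ meas] half(3)[OF that]
    by (auto simp: S_def)
  have AF: "c powr p * A n t = max 0 (c + 2 * (n * c) * t - \<gamma> * t\<^sup>2) powr p * t powr (- (2 * p))"
    if t: "t > 0" and n: "n = \<nu> \<or> n = - \<nu>" for n t
  proof -
    have n2: "n\<^sup>2 = \<nu>\<^sup>2" "\<bar>n\<bar> < \<mu>" using n mn by auto
    have *: "c + 2 * (n * c) * t - \<gamma> * t\<^sup>2 = c * ((1 + n * t)\<^sup>2 - (\<mu> * t)\<^sup>2)"
    proof -
      have e: "\<gamma> = c * (\<mu>\<^sup>2 - n\<^sup>2)" using mu2 n2 c by (simp add: field_simps)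
      show ?thesis unfolding e by (simp add: algebra_simps power2_eq_square)
    qed
    have fac: "(1 + n * t)\<^sup>2 - (\<mu> * t)\<^sup>2 = (1 - (\<mu> - n) * t) * (1 + (\<mu> + n) * t)"
      by (simp add: algebra_simps power2_eq_square)
    have pos: "1 + (\<mu> + n) * t > 0" using t n2 by (simp add: add_pos_nonneg)
    have memb: "t \<in> S n \<longleftrightarrow> 1 - (\<mu> - n) * t > 0"
      using t n2 by (auto simp: S_def field_simps)
    show ?thesis
    proof (cases "t \<in> S n")
      case True
      then have "(1 + n * t)\<^sup>2 - (\<mu> * t)\<^sup>2 > 0" unfolding fac using memb pos by simp
      then show ?thesis unfolding * A_def f_def using True c by (simp add: powr_mult max_def)
    next
      case False
      then have "(1 + n * t)\<^sup>2 - (\<mu> * t)\<^sup>2 \<le> 0"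
        unfolding fac using memb pos by (simp add: mult_le_0_iff)
      with c have "c * ((1 + n * t)\<^sup>2 - (\<mu> * t)\<^sup>2) \<le> 0" by (intro mult_nonneg_nonpos) auto
      then have "max 0 (c * ((1 + n * t)\<^sup>2 - (\<mu> * t)\<^sup>2)) = 0" by (rule max_absorb1)
      then show ?thesis unfolding * A_def using False by simp
    qed
  qed
  have F: "F t = c powr p * (A \<nu> t - A (- \<nu>) (- t))" for t
  proof (cases t "0::real" rule: linorder_cases)
    case greater
    then have "A (- \<nu>) (- t) = 0" by (auto simp: A_def S_def)
    then show ?thesis using AF[of t \<nu>] greater c unfolding F_def \<nu>_def by simp
  next
    case less
    then have "A \<nu> t = 0" by (auto simp: A_def S_def)
    then show ?thesis using AF[of "- t" "- \<nu>"] less c unfolding F_def \<nu>_def by simp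
  next
    case equal
    then show ?thesis by (simp add: F_def A_def S_def)
  qed
  have R: "integrable lborel (\<lambda>t. A (- \<nu>) (- t))" "(LINT t|lborel. A (- \<nu>) (- t)) = integral {1<..} (h (- \<nu>))"
    using lborel_integrable_real_affine[OF A(1)[of "- \<nu>"], of "- 1" 0]
      lborel_integral_real_affine[of "- 1" "A (- \<nu>)" 0] A(2)[of "- \<nu>"] by auto
  show "integrable lborel F" unfolding F using A(1) R(1) by simp
  have "(LINT t|lborel. F t) = c powr p * (integral {1<..} (h \<nu>) - integral {1<..} (h (- \<nu>)))"
    unfolding F using A R by simp
  also have "integral {1<..} (h \<nu>) - integral {1<..} (h (- \<nu>)) = integral {1<..} (\<lambda>y. h \<nu> y - h (- \<nu>) y)"
    using half(2) by (intro Henstock_Kurzweil_Integration.integral_diff[symmetric]) (auto dest: set_lebesgue_integral_eq_integral(1))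
  also have "\<dots> = integral {1<..} (\<lambda>y. 2 * \<nu> * \<mu> powr (2 * p) / \<mu>\<^sup>2 * (2 * y / (y\<^sup>2 - \<nu>\<^sup>2 / \<mu>\<^sup>2)\<^sup>2 * (y\<^sup>2 - 1) powr p))"
  proof (rule Henstock_Kurzweil_Integration.integral_cong)
    fix y :: real assume "y \<in> {1<..}"
    then have "\<mu> * y > \<mu>" using mu by simp
    then have ne: "\<mu> * y - \<nu> \<noteq> 0" "\<mu> * y + \<nu> \<noteq> 0" using mn by auto
    have "y\<^sup>2 - \<nu>\<^sup>2 / \<mu>\<^sup>2 = (\<mu> * y - \<nu>) * (\<mu> * y + \<nu>) / \<mu>\<^sup>2"
      using mu by (simp add: field_simps power2_eq_square)
    then have e: "2 * y / (y\<^sup>2 - \<nu>\<^sup>2 / \<mu>\<^sup>2)\<^sup>2 = 2 * y * \<mu>\<^sup>2 * \<mu>\<^sup>2 / ((\<mu> * y - \<nu>)\<^sup>2 * (\<mu> * y + \<nu>)\<^sup>2)"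
      using mu by (simp add: power_mult_distrib power_divide)
    have e2: "1 / (\<mu> * y - \<nu>)\<^sup>2 - 1 / (\<mu> * y + \<nu>)\<^sup>2 = 4 * \<mu> * \<nu> * y / ((\<mu> * y - \<nu>)\<^sup>2 * (\<mu> * y + \<nu>)\<^sup>2)"
    proof -
      have "(\<mu> * y + \<nu>)\<^sup>2 - (\<mu> * y - \<nu>)\<^sup>2 = 4 * \<mu> * \<nu> * y" by (simp add: power2_eq_square algebra_simps)
      then show ?thesis using ne by (simp add: diff_frac_eq)
    qed
    have "h \<nu> y - h (- \<nu>) y = \<mu> powr (2 * p) * \<mu> * (y\<^sup>2 - 1) powr p * (1 / (\<mu> * y - \<nu>)\<^sup>2 - 1 / (\<mu> * y + \<nu>)\<^sup>2)"
      unfolding h_def by (simp add: algebra_simps)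
    then show "h \<nu> y - h (- \<nu>) y = 2 * \<nu> * \<mu> powr (2 * p) / \<mu>\<^sup>2 * (2 * y / (y\<^sup>2 - \<nu>\<^sup>2 / \<mu>\<^sup>2)\<^sup>2 * (y\<^sup>2 - 1) powr p)"
      unfolding e e2 using mu by (simp add: power2_eq_square)
  qed
  also have "\<dots> = 2 * \<nu> * \<mu> powr (2 * p) / \<mu>\<^sup>2 * ((1 - \<nu>\<^sup>2 / \<mu>\<^sup>2) powr (p - 1) * Beta (1 + p) (1 - p))"
  proof -
    have "\<nu>\<^sup>2 < \<mu>\<^sup>2" using mu2 c g by (smt (verit) divide_pos_pos)
    then have "0 \<le> \<nu>\<^sup>2 / \<mu>\<^sup>2" "\<nu>\<^sup>2 / \<mu>\<^sup>2 < 1" using mu by auto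
    from Beta_substitution[OF _ _ this, of p] p show ?thesis by (simp only: integral_mult_right)
  qed
  also have "1 - \<nu>\<^sup>2 / \<mu>\<^sup>2 = \<gamma> / c / \<mu> powr 2"
    unfolding mu2[symmetric] using mu by (simp add: diff_divide_distrib)
  also have "(\<gamma> / c / \<mu> powr 2) powr (p - 1) = \<gamma> powr (p - 1) / c powr (p - 1) / \<mu> powr (2 * p - 2)"
    using c g mu by (simp add: powr_divide powr_mult powr_powr algebra_simps del: powr_numeral)
  also have "\<mu> powr (2 * p - 2) = \<mu> powr (2 * p) / \<mu>\<^sup>2" using mu by (simp add: powr_diff)
  finally show "(LINT t|lborel. F t) = 2 * Beta (1 + p) (1 - p) * \<beta> * \<gamma> powr (p - 1)"
    using mu c by (simp add: powr_diff \<nu>_def field_simps)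
qed

section \<open>Integrals of powers of the sine against quadratic forms\<close>

lemma has_integral_sin_powr:
  fixes q :: real
  assumes q: "- 1 < q"
  shows "((\<lambda>u. sin u powr q) has_integral Beta (1/2) ((q + 1) / 2)) {0..pi}"
proof -
  let ?B = "Beta (1/2) ((q + 1) / 2)"
  let ?f = "\<lambda>x::real. x powr (1/2 - 1) * (1 - x) powr ((q + 1) / 2 - 1)"
  let ?g = "\<lambda>u::real. (cos u)\<^sup>2"
  let ?g' = "\<lambda>u::real. - 2 * (cos u * sin u)"
  let ?S = "{0<..<pi/2}"
  have cs: "cos u > 0" "sin u > 0" if "u \<in> ?S" for u
    using that by (auto intro!: cos_gt_zero sin_gt_zero)
  have der: "(?g has_field_derivative ?g' u) (at u within ?S)" for u
    by (auto intro!: derivative_eq_intros)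
  have inj: "inj_on ?g ?S"
  proof (rule inj_onI)
    fix x y assume xy: "x \<in> ?S" "y \<in> ?S" "(cos x)\<^sup>2 = (cos y)\<^sup>2"
    have "0 \<le> cos x" "0 \<le> cos y" using cs(1)[OF xy(1)] cs(1)[OF xy(2)] by auto
    with xy(3) have "cos x = cos y" by (rule power2_eq_imp_eq)
    with xy(1,2) show "x = y" using cos_inj_pi[of x y] by auto
  qed
  have img: "?g ` ?S = {0<..<1}"
  proof safe
    fix u assume u: "u \<in> ?S"
    have "0 < (sin u)\<^sup>2" "0 < (cos u)\<^sup>2" using cs[OF u] by auto
    then show "(cos u)\<^sup>2 \<in> {0<..<1}" by (simp add: cos_squared_eq)
  next
    fix x :: real assume x: "x \<in> {0<..<1}"
    define u where "u = arccos (sqrt x)"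
    have s: "0 < sqrt x" "sqrt x < 1" using x by auto
    have c: "cos u = sqrt x" unfolding u_def using s by (intro cos_arccos) linarith+
    have "- 1 < sqrt x" using s by linarith
    then have "0 < u" unfolding u_def using s(2) arccos_lt_bounded[of "sqrt x"] by blast
    moreover have "u < pi / 2" unfolding u_def using s arccos_less_arccos[of 0 "sqrt x"] by simp
    moreover have "x = ?g u" using x c by simp
    ultimately show "x \<in> ?g ` ?S" by (intro image_eqI[of _ _ u]) simp_all
  qed
  have eq: "\<bar>?g' u\<bar> * ?f (?g u) = 2 * sin u powr q" if "u \<in> ?S" for u
  proof -
    have s: "1 - (cos u)\<^sup>2 = (sin u)\<^sup>2" by (simp add: sin_squared_eq)
    have "?f (?g u) = (cos u powr 2) powr (1/2 - 1) * (sin u powr 2) powr ((q + 1) / 2 - 1)"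
      unfolding s using cs[OF that] by simp
    also have "\<dots> = cos u powr - 1 * sin u powr (q - 1)"
    proof -
      have "2 * (1/2 - 1) = (- 1 :: real)" "2 * ((q + 1) / 2 - 1) = q - 1" by (simp_all add: field_simps)
      then show ?thesis unfolding powr_powr by (simp only:)
    qed
    finally show ?thesis using cs[OF that]
      by (simp add: abs_mult powr_minus powr_diff field_simps)
  qed
  have "(?f has_integral ?B) {0<..<1}"
    using has_integral_Beta_real[of "1/2" "(q + 1) / 2"] q by (simp add: has_integral_Icc_iff_Ioo)
  then have "?f absolutely_integrable_on {0<..<1} \<and> integral {0<..<1} ?f = ?B"
    by (auto intro!: nonnegative_absolutely_integrable_1 simp: has_integral_iff)
  then have "(\<lambda>u. \<bar>?g' u\<bar> * ?f (?g u)) absolutely_integrable_on ?S \<and>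
      integral ?S (\<lambda>u. \<bar>?g' u\<bar> * ?f (?g u)) = ?B"
    using has_absolute_integral_change_of_variables_1'[OF _ der inj, of ?f ?B] img by simp
  then have "(\<lambda>u. 2 * sin u powr q) absolutely_integrable_on ?S \<and>
      integral ?S (\<lambda>u. 2 * sin u powr q) = ?B"
    by (simp only: set_integrable_cong[OF refl refl eq] Henstock_Kurzweil_Integration.integral_cong[OF eq])
  then have 1: "(\<lambda>u. sin u powr q) absolutely_integrable_on ?S" "integral ?S (\<lambda>u. sin u powr q) = ?B / 2"
    by auto
  have "x \<in> (\<lambda>u. pi - u) ` {pi/2<..<pi}" if "x \<in> ?S" for x
    using that by (intro image_eqI[of _ _ "pi - x"]) auto
  then have img2: "(\<lambda>u. pi - u) ` {pi/2<..<pi} = ?S" by auto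
  have "((\<lambda>u. pi - u) has_field_derivative - 1) (at x within {pi/2<..<pi})" for x
    by (auto intro!: derivative_eq_intros)
  then have "(\<lambda>u. \<bar>- 1\<bar> * sin (pi - u) powr q) absolutely_integrable_on {pi/2<..<pi} \<and>
      integral {pi/2<..<pi} (\<lambda>u. \<bar>- 1\<bar> * sin (pi - u) powr q) = ?B / 2"
    using has_absolute_integral_change_of_variables_1'[of "{pi/2<..<pi}" "\<lambda>u. pi - u" "\<lambda>_. - 1"
        "\<lambda>u. sin u powr q" "?B / 2"] 1 unfolding img2 by (auto simp: inj_on_def)
  then have 2: "(\<lambda>u. sin u powr q) absolutely_integrable_on {pi/2<..<pi}"
      "integral {pi/2<..<pi} (\<lambda>u. sin u powr q) = ?B / 2" by auto
  have "((\<lambda>u. sin u powr q) has_integral ?B / 2) {0..pi/2}" "((\<lambda>u. sin u powr q) has_integral ?B / 2) {pi/2..pi}"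
    using 1 2 unfolding has_integral_Icc_iff_Ioo
    by (auto simp: has_integral_iff dest: set_lebesgue_integral_eq_integral(1))
  then show ?thesis
    using has_integral_combine[of 0 "pi/2" pi "\<lambda>u. sin u powr q" "?B/2" "?B/2"] by simp
qed

lemma absolutely_integrable_sin_powr:
  "- 1 < q \<Longrightarrow> (\<lambda>u. sin u powr q) absolutely_integrable_on {0..pi}"
  using has_integral_sin_powr[of q] by (auto intro!: nonnegative_absolutely_integrable_1)

lemma quadratic_form_decomposition:
  fixes \<gamma> \<beta> \<delta> C S :: real
  assumes "\<gamma> \<noteq> 0"
  shows "\<gamma> * C\<^sup>2 + 2 * \<beta> * C * S + \<delta> * S\<^sup>2 =
    \<gamma> * ((C + \<beta> / \<gamma> * S)\<^sup>2 + (\<gamma> * \<delta> - \<beta>\<^sup>2) / \<gamma>\<^sup>2 * S\<^sup>2)"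
  using assms by (simp add: field_simps power2_eq_square)

lemma quadratic_form_pos:
  fixes \<gamma> \<beta> \<delta> :: real
  assumes "\<gamma> > 0" "\<gamma> * \<delta> - \<beta>\<^sup>2 > 0"
  shows "\<gamma> * (cos u)\<^sup>2 + 2 * \<beta> * cos u * sin u + \<delta> * (sin u)\<^sup>2 > 0"
proof -
  have "(cos u + \<beta> / \<gamma> * sin u)\<^sup>2 + (\<gamma> * \<delta> - \<beta>\<^sup>2) / \<gamma>\<^sup>2 * (sin u)\<^sup>2 > 0"
  proof (cases "sin u = 0")
    case True
    then have "cos u \<noteq> 0" using sin_cos_squared_add[of u] by auto
    then show ?thesis using True by simp
  next
    case False
    then show ?thesis using assms by (intro add_nonneg_pos) auto
  qed
  then show ?thesis using assms by (subst quadratic_form_decomposition) auto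
qed

text \<open>The integrand has total homogeneity \<open>- 2\<close> in the direction \<open>(cos u, sin u)\<close>, which is what makes it a
function on the projective line. The coordinate \<open>z\<close> is the cotangent, centred and scaled so that the
quadratic form becomes a multiple of \<open>1 + z\<^sup>2\<close>. The equivalence is stated for an arbitrary value \<open>I\<close>:
applied to the identity form it evaluates the integral over the line, applied to a general form it
carries the value back.\<close>

lemma cot_substitution:
  fixes p \<gamma> \<beta> \<delta> I :: real
  assumes g: "\<gamma> > 0" and D: "\<gamma> * \<delta> - \<beta>\<^sup>2 > 0"
  shows "(\<lambda>u. \<gamma> powr (- p) * (\<gamma> * \<delta> - \<beta>\<^sup>2) powr (p + 1/2) * (sin u powr (2 * p) *
        (\<gamma> * (cos u)\<^sup>2 + 2 * \<beta> * cos u * sin u + \<delta> * (sin u)\<^sup>2) powr (- (p + 1)))) absolutely_integrable_on {0<..<pi} \<and>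
    integral {0<..<pi} (\<lambda>u. \<gamma> powr (- p) * (\<gamma> * \<delta> - \<beta>\<^sup>2) powr (p + 1/2) * (sin u powr (2 * p) *
        (\<gamma> * (cos u)\<^sup>2 + 2 * \<beta> * cos u * sin u + \<delta> * (sin u)\<^sup>2) powr (- (p + 1)))) = I
    \<longleftrightarrow> (\<lambda>z::real. (1 + z\<^sup>2) powr (- (p + 1))) absolutely_integrable_on UNIV \<and>
      integral UNIV (\<lambda>z. (1 + z\<^sup>2) powr (- (p + 1))) = I"
proof -
  define D where "D = \<gamma> * \<delta> - \<beta>\<^sup>2"
  have D0: "D > 0" using D D_def by simp
  let ?S = "{0<..<pi}"
  let ?f = "\<lambda>z::real. (1 + z\<^sup>2) powr (- (p + 1))"
  let ?g = "\<lambda>u::real. (\<gamma> * cot u + \<beta>) / sqrt D"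
  let ?g' = "\<lambda>u::real. - (\<gamma> / (sqrt D * (sin u)\<^sup>2))"
  have s: "sin u > 0" if "u \<in> ?S" for u using that by (auto intro: sin_gt_zero)
  have der: "(?g has_field_derivative ?g' u) (at u within ?S)" if "u \<in> ?S" for u
    using s[OF that] D0 by (auto intro!: derivative_eq_intros DERIV_cot[THEN DERIV_subset] simp: field_simps)
  have cotq: "cot u = tan (pi/2 - u)" if "u \<in> ?S" for u
    using that by (simp add: cot_def tan_def sin_diff cos_diff)
  have inj: "inj_on ?g ?S"
  proof (rule inj_onI)
    fix x y assume xy: "x \<in> ?S" "y \<in> ?S" "?g x = ?g y"
    then have "tan (pi/2 - x) = tan (pi/2 - y)" using g D0 by (simp add: cotq)
    then have "arctan (tan (pi/2 - x)) = arctan (tan (pi/2 - y))" by simp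
    then show "x = y" using xy(1,2) by (simp add: arctan_tan)
  qed
  have img: "?g ` ?S = UNIV"
  proof safe
    fix z :: real
    define u where "u = pi/2 - arctan ((z * sqrt D - \<beta>) / \<gamma>)"
    have u: "u \<in> ?S" unfolding u_def using arctan[of "(z * sqrt D - \<beta>) / \<gamma>"] by auto
    moreover have "cot u = (z * sqrt D - \<beta>) / \<gamma>" unfolding cotq[OF u] by (simp add: u_def arctan)
    then have "?g u = z" using g D0 by simp
    ultimately show "z \<in> ?g ` ?S" by (intro image_eqI[of _ _ u]) simp_all
  qed auto
  have eq: "\<bar>?g' u\<bar> * ?f (?g u) = \<gamma> powr (- p) * D powr (p + 1/2) * (sin u powr (2 * p) *
        (\<gamma> * (cos u)\<^sup>2 + 2 * \<beta> * cos u * sin u + \<delta> * (sin u)\<^sup>2) powr (- (p + 1)))" if "u \<in> ?S" for u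
  proof -
    define G where "G = \<gamma> * (cos u)\<^sup>2 + 2 * \<beta> * cos u * sin u + \<delta> * (sin u)\<^sup>2"
    have G: "G > 0" unfolding G_def by (rule quadratic_form_pos[OF g D])
    have su: "sin u > 0" by (rule s[OF that])
    have "1 + (?g u)\<^sup>2 = (D + (\<gamma> * cot u + \<beta>)\<^sup>2) / D" using D0 by (simp add: power_divide field_simps)
    also have "D + (\<gamma> * cot u + \<beta>)\<^sup>2 = \<gamma> * G / (sin u)\<^sup>2"
      using su unfolding D_def G_def by (simp add: cot_def field_simps power2_eq_square)
    also have "\<gamma> * G / (sin u)\<^sup>2 / D = \<gamma> * G / (sin u powr 2 * D)" using su by simp
    finally have e1: "?f (?g u) = \<gamma> powr (- (p + 1)) * G powr (- (p + 1)) / (sin u powr (2 * - (p + 1)) * D powr (- (p + 1)))"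
      using g G su D0 by (simp only: powr_divide powr_mult powr_powr less_imp_le mult_nonneg_nonneg powr_ge_zero)
    have e2: "\<bar>?g' u\<bar> = \<gamma> / (D powr (1/2) * sin u powr 2)"
      using g D0 su by (simp add: powr_half_sqrt)
    have e3: "\<gamma> powr (- (p + 1)) = \<gamma> powr (- p) / \<gamma>" using g by (simp add: powr_diff)
    have e4: "sin u powr (2 * - (p + 1)) = 1 / (sin u powr (2 * p) * sin u powr 2)"
      using su by (simp add: powr_minus powr_add[symmetric] field_simps del: powr_numeral)
    have e5: "D powr (- (p + 1)) = 1 / (D powr (p + 1/2) * D powr (1/2))"
      using D0 by (simp add: powr_minus powr_add[symmetric] field_simps)
    show ?thesis unfolding G_def[symmetric] e1 e2 e3 e4 e5 using g D0 su G by (simp add: field_simps)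
  qed
  show ?thesis
    using has_absolute_integral_change_of_variables_1'[OF _ der inj, of ?f I] unfolding img D_def[symmetric]
    by (simp only: set_integrable_cong[OF refl refl eq] Henstock_Kurzweil_Integration.integral_cong[OF eq]) simp
qed

lemma has_integral_sin_powr_quadratic_form:
  fixes p \<gamma> \<beta> \<delta> :: real
  assumes p: "0 < p" and g: "\<gamma> > 0" and D: "\<gamma> * \<delta> - \<beta>\<^sup>2 > 0"
  shows "((\<lambda>u. sin u powr (2 * p) * (\<gamma> * (cos u)\<^sup>2 + 2 * \<beta> * cos u * sin u + \<delta> * (sin u)\<^sup>2) powr (- (p + 1)))
    has_integral \<gamma> powr p * (\<gamma> * \<delta> - \<beta>\<^sup>2) powr (- (p + 1/2)) * Beta (1/2) (p + 1/2)) {0..pi}"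
proof -
  let ?B = "Beta (1/2) (p + 1/2)"
  let ?G = "\<lambda>u. sin u powr (2 * p) * (\<gamma> * (cos u)\<^sup>2 + 2 * \<beta> * cos u * sin u + \<delta> * (sin u)\<^sup>2) powr (- (p + 1))"
  define k where "k = \<gamma> powr (- p) * (\<gamma> * \<delta> - \<beta>\<^sup>2) powr (p + 1/2)"
  have k: "k > 0" "\<gamma> powr p * (\<gamma> * \<delta> - \<beta>\<^sup>2) powr (- (p + 1/2)) = 1 / k"
    unfolding k_def using g D by (auto simp: powr_minus field_simps)
  have "(p + 1/2 :: real) = (2 * p + 1) / 2" by simp
  then have "((\<lambda>u. sin u powr (2 * p)) has_integral ?B) {0<..<pi}"
    using has_integral_sin_powr[of "2 * p"] p by (simp only: has_integral_Icc_iff_Ioo)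
  then have "(\<lambda>u. sin u powr (2 * p)) absolutely_integrable_on {0<..<pi} \<and> integral {0<..<pi} (\<lambda>u. sin u powr (2 * p)) = ?B"
    by (auto intro!: nonnegative_absolutely_integrable_1 simp: has_integral_iff)
  then have "(\<lambda>z::real. (1 + z\<^sup>2) powr (- (p + 1))) absolutely_integrable_on UNIV \<and>
      integral UNIV (\<lambda>z. (1 + z\<^sup>2) powr (- (p + 1))) = ?B"
    using cot_substitution[of 1 1 0 p ?B] by simp
  then have "(\<lambda>u. k * ?G u) absolutely_integrable_on {0<..<pi} \<and> integral {0<..<pi} (\<lambda>u. k * ?G u) = ?B"
    using cot_substitution[OF g D, of p ?B] unfolding k_def by blast
  then have "((\<lambda>u. k * ?G u) has_integral ?B) {0<..<pi}"
    by (auto simp: has_integral_iff simp del: set_integrable_mult_right_iff dest: set_lebesgue_integral_eq_integral(1))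
  then have "((\<lambda>u. 1 / k * (k * ?G u)) has_integral 1 / k * ?B) {0..pi}"
    unfolding has_integral_Icc_iff_Ioo by (rule has_integral_mult_right)
  then show ?thesis using k by simp
qed

text \<open>The algebraic core of the evaluation below. Here \<open>G\<close> is a quadratic form in the unit vector \<open>(C, S)\<close>
with its square completed, \<open>l\<close> a linear form, and a prime marks the derivative along the rotation
\<open>C' = - S\<close>, \<open>S' = C\<close>. The quadratic form \<open>q\<close> is found by integrating in the projective coordinate
\<open>y = Y / S\<close>: its four terms are the primitives of the total derivative, of the two odd terms, and of the
term \<open>(y Q powr (- s/2 - 1))'\<close> that reduces the even moments to a single one.\<close>

lemma exact_derivative_identity:
  fixes s b k e c C S :: real
  assumes s: "s \<noteq> 0" and CS: "C\<^sup>2 + S\<^sup>2 = 1"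
  defines "Y \<equiv> C + b * S" and "Y' \<equiv> - S + b * C"
  defines "G \<equiv> Y\<^sup>2 + k * S\<^sup>2" and "G' \<equiv> 2 * Y * Y' + 2 * k * S * C"
    and "l \<equiv> e * Y + c * S" and "l' \<equiv> e * Y' + c * C"
  defines "q \<equiv> - b * l\<^sup>2 - 2 * k * e * c * S\<^sup>2 + 2 * c * e / s * G + (c\<^sup>2 - k * e\<^sup>2) * Y * S"
    and "q' \<equiv> - 2 * b * l * l' - 4 * k * e * c * S * C + 2 * c * e / s * G' + (c\<^sup>2 - k * e\<^sup>2) * (Y' * S + Y * C)"
  shows "s * S * G * l\<^sup>2 + C * (s / 2 + 1) * G' * l\<^sup>2 - 2 * C * G * l * l' =
     - (- k * e\<^sup>2 + (1 - s) * c\<^sup>2) * S * G - (s * C * G * q - (s / 2 + 1) * S * G' * q + S * G * q')"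
proof -
  \<comment> \<open>The denominator \<open>s\<close> is cleared first, and \<open>C\<^sup>2 + S\<^sup>2\<close> is inserted in the one term of lower degree: the result is an identity of homogeneous polynomials.\<close>
  define q0 where "q0 = - b * l\<^sup>2 - 2 * k * e * c * S\<^sup>2 + (c\<^sup>2 - k * e\<^sup>2) * Y * S"
  define q1 where "q1 = - 2 * b * l * l' - 4 * k * e * c * S * C + (c\<^sup>2 - k * e\<^sup>2) * (Y' * S + Y * C)"
  have "s * C * G * q - (s / 2 + 1) * S * G' * q + S * G * q' =
      s * C * G * q0 - (s / 2 + 1) * S * G' * q0 + S * G * q1 + c * e * G * (2 * C * G - S * G')"
    unfolding q_def q'_def q0_def q1_def using s by (simp add: field_simps)
  moreover have "s * S * G * l\<^sup>2 + C * (s / 2 + 1) * G' * l\<^sup>2 - 2 * C * G * l * l' =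
     - (- k * e\<^sup>2 + (1 - s) * c\<^sup>2) * S * G * (C\<^sup>2 + S\<^sup>2) -
     (s * C * G * q0 - (s / 2 + 1) * S * G' * q0 + S * G * q1 + c * e * G * (2 * C * G - S * G'))"
    unfolding q0_def q1_def G_def G'_def l_def l'_def Y_def Y'_def by (simp add: algebra_simps power2_eq_square)
  ultimately show ?thesis using CS by simp
qed

text \<open>The operator \<open>H \<mapsto> \<integral> sin\<^sup>s\<^sup>-\<^sup>1 (s sin H - cos H')\<close>, which up to a constant factor is the
regularised convolution with \<open>|sin|\<^sup>s\<^sup>-\<^sup>2\<close>, applied to \<open>Q powr (- s/2 - 1)\<close> times the square of a linear form. By the preceding identity
the integrand is minus the derivative of \<open>sin\<^sup>s Q powr (- s/2 - 1) q\<close>, which vanishes at both ends, plus a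
constant times \<open>sin\<^sup>s Q powr (- s/2 - 1)\<close>.\<close>

lemma hypersingular_integral_quadratic_form:
  fixes s \<gamma> \<beta> \<delta> e w :: real and H' :: "real \<Rightarrow> real"
  assumes s: "0 < s" and g: "\<gamma> > 0" and D: "\<gamma> * \<delta> - \<beta>\<^sup>2 > 0"
  defines "H \<equiv> (\<lambda>u. (\<gamma> * (cos u)\<^sup>2 + 2 * \<beta> * cos u * sin u + \<delta> * (sin u)\<^sup>2) powr (- (s / 2 + 1)) *
      (e * cos u + w * sin u)\<^sup>2)"
  assumes H': "\<And>u. (H has_real_derivative H' u) (at u)"
  shows "((\<lambda>u. sin u powr (s - 1) * (s * sin u * H u - cos u * H' u)) has_integral
     ((\<gamma> * \<delta> - \<beta>\<^sup>2) / \<gamma>\<^sup>2 * e\<^sup>2 - (1 - s) * (w - \<beta> / \<gamma> * e)\<^sup>2) *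
     (\<gamma> powr (s / 2) * (\<gamma> * \<delta> - \<beta>\<^sup>2) powr (- (s / 2 + 1/2)) * Beta (1/2) (s / 2 + 1/2))) {0..pi}"
proof -
  define k where "k = (\<gamma> * \<delta> - \<beta>\<^sup>2) / \<gamma>\<^sup>2"
  define b where "b = \<beta> / \<gamma>"
  define c where "c = w - b * e"
  define T where "T = - k * e\<^sup>2 + (1 - s) * c\<^sup>2"
  define Y where "Y u = cos u + b * sin u" for u
  define Y' where "Y' u = - sin u + b * cos u" for u
  define G where "G u = (Y u)\<^sup>2 + k * (sin u)\<^sup>2" for u
  define G' where "G' u = 2 * Y u * Y' u + 2 * k * sin u * cos u" for u
  define l where "l u = e * Y u + c * sin u" for u
  define l' where "l' u = e * Y' u + c * cos u" for u
  define q where "q u = - b * (l u)\<^sup>2 - 2 * k * e * c * (sin u)\<^sup>2 + 2 * c * e / s * G u + (c\<^sup>2 - k * e\<^sup>2) * Y u * sin u" for u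
  define q' where "q' u = - 2 * b * l u * l' u - 4 * k * e * c * sin u * cos u + 2 * c * e / s * G' u
      + (c\<^sup>2 - k * e\<^sup>2) * (Y' u * sin u + Y u * cos u)" for u
  have GG: "\<gamma> * (cos u)\<^sup>2 + 2 * \<beta> * cos u * sin u + \<delta> * (sin u)\<^sup>2 = \<gamma> * G u" for u
    unfolding G_def Y_def b_def k_def using g by (intro quadratic_form_decomposition) simp
  have G0: "G u > 0" for u
    using quadratic_form_pos[OF g D, of u] g unfolding GG by (simp add: zero_less_mult_iff)
  have ll: "e * cos u + w * sin u = l u" for u
    unfolding l_def Y_def c_def by (simp add: algebra_simps)
  have H: "H u = (\<gamma> * G u) powr (- (s / 2 + 1)) * (l u)\<^sup>2" for u
    unfolding H_def GG ll ..
  have dY: "(Y has_real_derivative Y' u) (at u)" for u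
    unfolding Y_def[abs_def] Y'_def by (auto intro!: derivative_eq_intros)
  have dG: "(G has_real_derivative G' u) (at u)" for u
    unfolding G_def[abs_def] G'_def by (auto intro!: derivative_eq_intros dY)
  have dl: "(l has_real_derivative l' u) (at u)" for u
    unfolding l_def[abs_def] l'_def by (auto intro!: derivative_eq_intros dY)
  have dq: "(q has_real_derivative q' u) (at u)" for u
    unfolding q_def[abs_def] q'_def using s by (auto intro!: derivative_eq_intros dY dG dl simp: algebra_simps)
  define m where "m = - (s / 2 + 1)"
  define E where "E u = (\<gamma> * G u) powr m" for u
  have dE: "(E has_real_derivative E u * (m * G' u / G u)) (at u)" for u
    unfolding E_def[abs_def] using g G0[of u]
    by (auto intro!: derivative_eq_intros dG simp: powr_diff field_simps)
  have HE: "H u = E u * (l u)\<^sup>2" for u unfolding H E_def m_def ..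
  have "(H has_real_derivative E u * (m * G' u / G u) * (l u)\<^sup>2 + E u * (2 * l u * l' u)) (at u)" for u
    unfolding HE[abs_def] by (auto intro!: derivative_eq_intros dE dl)
  then have H'E: "H' u = E u * (m * G' u / G u * (l u)\<^sup>2 + 2 * l u * l' u)" for u
    using DERIV_unique[OF H'[of u]] by (simp add: algebra_simps)
  define \<Psi> where "\<Psi> u = sin u powr s * E u * q u" for u
  define \<Psi>' where "\<Psi>' u = sin u powr (s - 1) * E u *
      (s * cos u * q u + sin u * (m * G' u / G u) * q u + sin u * q' u)" for u
  have cont: "continuous_on {0..pi} \<Psi>"
  proof -
    have "continuous_on {0..pi} E" "continuous_on {0..pi} q"
      by (intro DERIV_continuous_on[OF DERIV_subset[OF dE]] DERIV_continuous_on[OF DERIV_subset[OF dq]]; simp)+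
    then show ?thesis unfolding \<Psi>_def[abs_def]
      by (intro continuous_intros continuous_on_powr') (use s sin_ge_zero in auto)
  qed
  have d\<Psi>: "(\<Psi> has_vector_derivative \<Psi>' u) (at u)" if "u \<in> {0<..<pi}" for u
  proof -
    have su: "sin u > 0" using that by (auto intro: sin_gt_zero)
    have ds: "((\<lambda>u. sin u powr s) has_real_derivative s * sin u powr (s - 1) * cos u) (at u)"
      using su by (auto intro!: derivative_eq_intros)
    have ps: "sin u powr s = sin u powr (s - 1) * sin u" using su by (simp add: powr_diff)
    have "(\<Psi> has_real_derivative s * sin u powr (s - 1) * cos u * E u * q u +
        sin u powr s * (E u * (m * G' u / G u)) * q u + sin u powr s * E u * q' u) (at u)"
      unfolding \<Psi>_def[abs_def]
      by (rule DERIV_cong[OF DERIV_mult[OF DERIV_mult[OF ds dE] dq]]) (simp add: algebra_simps)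
    also have "s * sin u powr (s - 1) * cos u * E u * q u +
        sin u powr s * (E u * (m * G' u / G u)) * q u + sin u powr s * E u * q' u = \<Psi>' u"
      unfolding \<Psi>'_def ps by (simp add: algebra_simps)
    finally have "(\<Psi> has_real_derivative \<Psi>' u) (at u)" .
    then show ?thesis by (simp add: has_real_derivative_iff_has_vector_derivative)
  qed
  have "(\<Psi>' has_integral \<Psi> pi - \<Psi> 0) {0..pi}"
    by (intro fundamental_theorem_of_calculus_interior cont d\<Psi>) auto
  then have 1: "(\<Psi>' has_integral 0) {0..pi}" unfolding \<Psi>_def using s by simp
  let ?J = "\<gamma> powr (s / 2) * (\<gamma> * \<delta> - \<beta>\<^sup>2) powr (- (s / 2 + 1/2)) * Beta (1/2) (s / 2 + 1/2)"
  have "((\<lambda>u. sin u powr s * E u) has_integral ?J) {0..pi}"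
    using has_integral_sin_powr_quadratic_form[of "s/2", OF _ g D] s unfolding GG E_def m_def by simp
  then have 2: "((\<lambda>u. - T * (sin u powr s * E u) - \<Psi>' u) has_integral - T * ?J - 0) {0..pi}"
    by (intro has_integral_diff has_integral_mult_right 1)
  have eq: "- T * (sin u powr s * E u) - \<Psi>' u = sin u powr (s - 1) * (s * sin u * H u - cos u * H' u)"
    if "u \<in> {0<..<pi}" for u
  proof -
    have su: "sin u > 0" using that by (auto intro: sin_gt_zero)
    have ps: "sin u powr s = sin u powr (s - 1) * sin u" using su by (simp add: powr_diff)
    define X where "X = s * sin u * (l u)\<^sup>2 - cos u * (m * G' u / G u * (l u)\<^sup>2 + 2 * l u * l' u)"
    define Z where "Z = - T * sin u - (s * cos u * q u + sin u * (m * G' u / G u) * q u + sin u * q' u)"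
    have G0': "G u \<noteq> 0" using G0[of u] by simp
    have X1: "G u * X = s * sin u * G u * (l u)\<^sup>2 + cos u * (s / 2 + 1) * G' u * (l u)\<^sup>2 - 2 * cos u * G u * l u * l' u"
      unfolding X_def m_def using G0' by (simp add: field_simps)
    have Z1: "G u * Z = - T * sin u * G u - (s * cos u * G u * q u - (s / 2 + 1) * sin u * G' u * q u + sin u * G u * q' u)"
      unfolding Z_def m_def using G0' by (simp add: field_simps)
    have "G u * X = G u * Z" unfolding X1 Z1 T_def
      using exact_derivative_identity[of s "cos u" "sin u" b k e c] s
      unfolding G_def G'_def l_def l'_def q_def q'_def Y_def Y'_def by simp
    then have "X = Z" using G0' by simp
    have "- T * (sin u powr s * E u) - \<Psi>' u = sin u powr (s - 1) * E u * Z"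
      unfolding \<Psi>'_def Z_def ps by (simp add: algebra_simps)
    also have "\<dots> = sin u powr (s - 1) * E u * X" using \<open>X = Z\<close> by simp
    also have "\<dots> = sin u powr (s - 1) * (s * sin u * H u - cos u * H' u)"
      unfolding HE H'E X_def by (simp add: algebra_simps)
    finally show ?thesis .
  qed
  have "((\<lambda>u. sin u powr (s - 1) * (s * sin u * H u - cos u * H' u)) has_integral - T * ?J - 0) {0<..<pi}"
    using 2 unfolding has_integral_Icc_iff_Ioo by (rule has_integral_eq[rotated]) (rule eq)
  then show ?thesis unfolding has_integral_Icc_iff_Ioo T_def k_def c_def b_def by (simp add: algebra_simps)
qed

section \<open>The constants\<close>

lemma Gamma_reflection_real:
  fixes x :: real
  assumes "0 < x" "x < 1"
  shows "Gamma x * Gamma (1 - x) = pi / sin (pi * x)"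
proof -
  have "complex_of_real (Gamma x * Gamma (1 - x)) = Gamma (of_real x) * Gamma (1 - of_real x)"
    by (simp add: Gamma_complex_of_real[symmetric])
  also have "\<dots> = of_real pi / sin (of_real pi * of_real x)" by (rule Gamma_reflection_complex)
  also have "\<dots> = of_real (pi / sin (pi * x))"
    by (simp add: sin_of_real[symmetric])
  finally show ?thesis by (simp only: of_real_eq_iff)
qed

lemma Gamma_legendre_duplication_real:
  fixes x :: real
  assumes "0 < x"
  shows "Gamma x * Gamma (x + 1/2) = 2 powr (1 - 2 * x) * sqrt pi * Gamma (2 * x)"
proof -
  have "complex_of_real (Gamma x * Gamma (x + 1/2)) = Gamma (of_real x) * Gamma (of_real x + 1/2)"
    using Gamma_complex_of_real[of "x + 1/2"] by (simp add: Gamma_complex_of_real)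
  also have "\<dots> = exp ((1 - 2 * of_real x) * of_real (ln 2)) * of_real (sqrt pi) * Gamma (2 * of_real x)"
  proof (rule Gamma_legendre_duplication)
    show "complex_of_real x \<notin> \<int>\<^sub>\<le>\<^sub>0" using assms by (auto dest: nonpos_Ints_nonpos simp: of_real_in_nonpos_Ints_iff)
    have "complex_of_real x + 1/2 = of_real (x + 1/2)" by simp
    then show "complex_of_real x + 1/2 \<notin> \<int>\<^sub>\<le>\<^sub>0"
      using assms by (auto dest: nonpos_Ints_nonpos simp: of_real_in_nonpos_Ints_iff simp del: of_real_add)
  qed
  also have "\<dots> = of_real (2 powr (1 - 2 * x) * sqrt pi * Gamma (2 * x))"
    using Gamma_complex_of_real[of "2 * x"] by (simp add: powr_def exp_of_real[symmetric])
  finally show ?thesis by (simp only: of_real_eq_iff)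
qed

lemma Beta_one_plus_one_minus:
  fixes p :: real
  assumes "0 < p" "p < 1"
  shows "Beta (1 + p) (1 - p) = pi * p / sin (pi * p)"
proof -
  have "p \<notin> \<int>\<^sub>\<le>\<^sub>0" using assms by (auto dest: nonpos_Ints_nonpos)
  then have "Gamma (1 + p) = p * Gamma p" using Gamma_plus1[of p] by (simp add: add.commute)
  moreover have "Gamma (2 :: real) = 1" using Gamma_fact[of 1, where 'a = real] by simp
  ultimately show ?thesis
    using Gamma_reflection_real[OF assms] by (simp add: Beta_def mult.assoc)
qed

lemma Beta_half:
  fixes s :: real
  assumes "0 < s"
  shows "Beta (1/2) (s / 2 + 1/2) = sqrt pi * Gamma ((1 + s) / 2) * 2 / (s * Gamma (s / 2))"
proof -
  have "s / 2 \<notin> \<int>\<^sub>\<le>\<^sub>0" using assms by (auto dest: nonpos_Ints_nonpos)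
  then have g: "Gamma (s / 2 + 1) = s / 2 * Gamma (s / 2)" using Gamma_plus1 by blast
  have "1/2 + (s / 2 + 1/2) = s / 2 + 1" "s / 2 + 1/2 = (1 + s) / 2" by (simp_all add: field_simps)
  then show ?thesis unfolding Beta_def
    by (simp only: g Gamma_one_half_real) (use assms in \<open>simp add: field_simps\<close>)
qed

text \<open>The constant \<open>c_const s\<close> equals \<open>tau (2 - s)\<close> times the finite part of \<open>\<integral> |sin|\<^sup>s\<^sup>-\<^sup>2\<close> over a full turn, which
is \<open>2 s / (s - 1)\<close> times the integral of \<open>sin\<^sup>s\<close> over half a turn. This is why the two terms in the
definition of \<open>Omega_tilde\<close> combine.\<close>

lemma c_const_eq_tau:
  assumes s: "0 < s" "s < 1"
  shows "c_const s = 2 * tau (2 - s) / (s - 1) * s * Beta (1/2) (s / 2 + 1/2)"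
proof -
  define g1 where "g1 = Gamma ((1 - s) / 2)"
  define g2 where "g2 = Gamma ((1 + s) / 2)"
  define g3 where "g3 = Gamma (1 - s / 2)"
  define g4 where "g4 = Gamma (s / 2)"
  define c where "c = cos (s * pi / 2)"
  have "cos (s * pi / 2) > 0" using s by (intro cos_gt_zero) (auto simp: field_simps)
  then have c0: "c > 0" unfolding c_def .
  have pos: "g1 > 0" "g2 > 0" "g3 > 0" "g4 > 0"
    unfolding g1_def g2_def g3_def g4_def using s by (auto intro!: Gamma_real_pos)
  have "g1 * g2 = pi / sin (pi * ((1 - s) / 2))"
    using Gamma_reflection_real[of "(1 - s) / 2"] s unfolding g1_def g2_def
    by (simp add: field_simps)
  also have "sin (pi * ((1 - s) / 2)) = c"
    unfolding c_def by (simp add: cos_sin_eq field_simps)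
  finally have g12: "g1 * g2 = pi / c" .
  have n: "(1 - s) / 2 \<notin> \<int>\<^sub>\<le>\<^sub>0" using s by (auto dest: nonpos_Ints_nonpos)
  have hh: "Gamma (1 - s / 2 + 1/2) = (1 - s) / 2 * g1"
  proof -
    have "1 - s / 2 + 1/2 = (1 - s) / 2 + 1" by (simp add: field_simps)
    then show ?thesis using Gamma_plus1[OF n] by (simp add: g1_def)
  qed
  have "g3 * ((1 - s) / 2 * g1) = 2 powr (s - 1) * sqrt pi * Gamma (2 - s)"
    using Gamma_legendre_duplication_real[of "1 - s / 2"] s unfolding hh g3_def by simp
  then have G: "Gamma (2 - s) = g3 * (1 - s) / 2 * g1 / (2 powr (s - 1) * sqrt pi)"
    by (simp add: field_simps)
  have cc: "cos ((2 - s) * pi / 2) = - c"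
  proof -
    have "(2 - s) * pi / 2 = pi - s * pi / 2" by (simp add: field_simps)
    then show ?thesis by (simp only: c_def cos_pi_minus)
  qed
  have p2: "(2 * pi) powr (- (2 - s)) / 2 powr (s - 1) = pi powr (s - 1) / (2 * pi)"
    by (simp add: powr_mult powr_diff powr_add[symmetric] field_simps power2_eq_square)
  have "2 * tau (2 - s) / (s - 1) * s * Beta (1/2) (s / 2 + 1/2) =
     2 * ((2 * pi) powr (- (2 - s)) / 2 powr (s - 1)) * (c * (g1 * g2)) * g3 / g4"
    unfolding tau_def G cc Beta_half[OF s(1)] g2_def[symmetric] g4_def[symmetric]
    using s pos by (simp add: field_simps)
  also have "\<dots> = c_const s"
    unfolding p2 g12 c_const_def g4_def g3_def using c0 pos by (simp add: diff_divide_distrib)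
  finally show ?thesis by simp
qed

lemma tau_R1_R2_constant:
  assumes s: "0 < s" "s < 1"
  shows "tau s * (R1 s / R2 s) powr (2 + s) * (2 * tau (2 - s) / (s - 1)) =
    1 / (s * pi * Beta (1/2) (s / 2 + 1/2))"
proof -
  define B where "B = Beta (1/2) (s / 2 + 1/2)"
  define c where "c = cos (s * pi / 2)"
  define d where "d = sin (s * pi / 2)"
  have "cos (s * pi / 2) > 0" using s by (intro cos_gt_zero) (auto simp: field_simps)
  then have c0: "c > 0" unfolding c_def .
  have "sin (s * pi / 2) > 0" using s by (intro sin_gt_zero) (auto simp: field_simps)
  then have d0: "d > 0" unfolding d_def .
  have B0: "B > 0" unfolding B_def Beta_def using s by (auto intro!: divide_pos_pos mult_pos_pos Gamma_real_pos)
  have "s / 2 + 1/2 \<notin> \<int>\<^sub>\<le>\<^sub>0" using s by (auto dest: nonpos_Ints_nonpos)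
  from Beta_plus1_right[OF this, of "1/2"]
  have "(s / 2 + 1) * Beta (1/2) ((3 + s) / 2) = (s / 2 + 1/2) * B"
    unfolding B_def by (simp add: field_simps)
  then have B3: "Beta (1/2) ((3 + s) / 2) = (s + 1) * B / (s + 2)" using s by (simp add: field_simps)
  have R: "(x powr (- 1 / (s + 2))) powr (2 + s) = 1 / x" if "x > 0" for x :: real
  proof -
    have "- 1 / (s + 2) * (2 + s) = - 1" using s by (simp add: field_simps)
    then show ?thesis unfolding powr_powr by (simp only:) (use that in \<open>simp add: powr_minus_divide\<close>)
  qed
  have "0 \<le> R1 s" "0 \<le> R2 s" by (auto simp: R1_def R2_def)
  then have "(R1 s / R2 s) powr (2 + s) = R1 s powr (2 + s) / R2 s powr (2 + s)"
    by (simp add: powr_divide)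
  also have "R1 s powr (2 + s) = 1 / (2 * c / (s * (s + 1) * pi) * Beta (1/2) ((3 + s) / 2))"
    unfolding R1_def c_def[symmetric] B3 using s c0 B0 by (intro R) simp
  also have "R2 s powr (2 + s) = 1 / (8 * d / (s\<^sup>2 * (2 + s) * pi))"
    unfolding R2_def d_def[symmetric] using s d0 by (intro R) simp
  also have "1 / (2 * c / (s * (s + 1) * pi) * Beta (1/2) ((3 + s) / 2)) / (1 / (8 * d / (s\<^sup>2 * (2 + s) * pi))) =
      4 * d / (s * c * B)"
  proof -
    have "1 / (2 * c / (s * v * pi) * (v * B / w)) / (1 / (8 * d / (s\<^sup>2 * w * pi))) = 4 * d / (s * c * B)"
      if "v > 0" "w > 0" for v w :: real
      using that s c0 d0 B0 by (simp add: field_simps power2_eq_square)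
    from this[of "s + 1" "2 + s"] s show ?thesis unfolding B3 by (simp add: add.commute)
  qed
  finally have RR: "(R1 s / R2 s) powr (2 + s) = 4 * d / (s * c * B)" .
  have "tau s * tau (2 - s) = - (1 - s) * c / (8 * pi * d)"
  proof -
    have "1 - s \<notin> \<int>\<^sub>\<le>\<^sub>0" using s by (auto dest: nonpos_Ints_nonpos)
    then have "Gamma (2 - s) = (1 - s) * Gamma (1 - s)" using Gamma_plus1[of "1 - s"] by (simp add: algebra_simps)
    then have "Gamma s * Gamma (2 - s) = (1 - s) * (Gamma s * Gamma (1 - s))" by simp
    also have "Gamma s * Gamma (1 - s) = pi / sin (pi * s)" by (rule Gamma_reflection_real[OF s])
    also have "sin (pi * s) = 2 * d * c"
      using sin_double[of "s * pi / 2"] unfolding c_def d_def by (simp add: mult.commute)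
    finally have G: "Gamma s * Gamma (2 - s) = (1 - s) * (pi / (2 * d * c))" .
    have cc: "cos ((2 - s) * pi / 2) = - c"
    proof -
      have "(2 - s) * pi / 2 = pi - s * pi / 2" by (simp add: field_simps)
      then show ?thesis by (simp only: c_def cos_pi_minus)
    qed
    have e1: "(2 * pi) powr (- s) * (2 * pi) powr (- (2 - s)) = 1 / (4 * pi\<^sup>2)"
    proof -
      have "(2 * pi) powr (- s) * (2 * pi) powr (- (2 - s)) = (2 * pi) powr - 2"
        by (subst powr_add[symmetric]) simp
      then show ?thesis by (simp add: powr_minus_divide power_mult_distrib)
    qed
    have e2: "tau s * tau (2 - s) = ((2 * pi) powr (- s) * (2 * pi) powr (- (2 - s))) * (Gamma s * Gamma (2 - s)) * (c * - c)"
      unfolding tau_def cc c_def by simp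
    show ?thesis unfolding e2 e1 G using c0 d0 by (simp add: field_simps power2_eq_square)
  qed
  note tt = this
  have "tau s * (R1 s / R2 s) powr (2 + s) * (2 * tau (2 - s) / (s - 1)) =
      tau s * tau (2 - s) * (4 * d / (s * c * B)) * (2 / (s - 1))"
    unfolding RR by simp
  also have "\<dots> = - (1 - s) * c / (8 * pi * d) * (4 * d / (s * c * B)) * (2 / (s - 1))"
    unfolding tt ..
  also have "\<dots> = 1 / (s * pi * B)" using s c0 d0 B0 by (simp add: field_simps)
  finally show ?thesis unfolding B_def .
qed

section \<open>The angular part of the Fourier transform\<close>

lemma periodic_add_of_int:
  fixes f :: "real \<Rightarrow> 'a"
  assumes per: "\<And>x. f (x + T) = f x"
  shows "f (x + of_int n * T) = f x"
proof -
  have perN: "f (x + real k * T) = f x" for k x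
  proof (induction k)
    case (Suc k)
    have "f (x + real (Suc k) * T) = f ((x + real k * T) + T)" by (simp add: algebra_simps)
    then show ?case using per Suc by simp
  qed simp
  show ?thesis
  proof (cases "n \<ge> 0")
    case True
    then show ?thesis using perN[of x "nat n"] by simp
  next
    case False
    then show ?thesis using perN[of "x + of_int n * T" "nat (- n)"] by simp
  qed
qed

lemma has_integral_periodic:
  fixes f :: "real \<Rightarrow> real"
  assumes T: "T > 0" and per: "\<And>x. f (x + T) = f x" and int: "(f has_integral I) {0..T}"
  shows "(f has_integral I) {c..c + T}"
proof -
  define n where "n = \<lfloor>c / T\<rfloor>"
  define r where "r = c - of_int n * T"
  have "of_int n \<le> c / T" "c / T < of_int n + 1" unfolding n_def by linarith+
  then have r: "0 \<le> r" "r \<le> T" using T by (auto simp: r_def field_simps)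
  have "f integrable_on {0..T}" using int by auto
  then have "f integrable_on {0..r}" "f integrable_on {r..T}"
    using r by (auto intro: integrable_subinterval_real)
  then obtain J K where J: "(f has_integral J) {0..r}" and K: "(f has_integral K) {r..T}" by blast
  have "I = J + K" using has_integral_combine[OF r J K] int has_integral_unique by blast
  have "((\<lambda>x. f (x + - T)) has_integral J) {T..r + T}"
    using has_integral_shift_real_ivl[OF J, of "- T"] by simp
  moreover have "f (x + - T) = f x" for x using per[of "x - T"] by simp
  ultimately have "(f has_integral J) {T..r + T}" by simp
  from has_integral_combine[OF _ _ K this] r have "(f has_integral I) {r..r + T}"
    by (simp add: \<open>I = J + K\<close> add.commute)
  from has_integral_shift_real_ivl[OF this, of "- (of_int n * T)"]
  have "((\<lambda>x. f (x + - (of_int n * T))) has_integral I) {c..c + T}"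
    by (simp add: r_def algebra_simps)
  moreover have "f (x + - (of_int n * T)) = f x" for x using periodic_add_of_int[of f T, OF per, of x "- n"] by simp
  ultimately show ?thesis by simp
qed

lemma has_integral_pi_periodic:
  fixes f :: "real \<Rightarrow> real"
  assumes per: "\<And>x. f (x + pi) = f x" and int: "((\<lambda>u. f (c + u)) has_integral I) {0..pi}"
  shows "(f has_integral 2 * I) {-pi..pi}"
proof -
  let ?g = "\<lambda>u. f (c + u)"
  have per': "?g (x + pi) = ?g x" for x using per[of "c + x"] by (simp add: add.assoc)
  have 1: "(?g has_integral I) {-pi - c..- c}" "(?g has_integral I) {- c..pi - c}"
    using has_integral_periodic[OF pi_gt_zero per' int, of "- pi - c"]
      has_integral_periodic[OF pi_gt_zero per' int, of "- c"] by auto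
  then have "(?g has_integral I + I) {- pi - c..pi - c}"
    by (intro has_integral_combine[of _ "- c"]) auto
  from has_integral_shift_real_ivl[OF this, of "- c"] show ?thesis by simp
qed

lemma le_four_sin:
  fixes u :: real
  assumes "0 \<le> u" "u \<le> pi / 2"
  shows "u \<le> 4 * sin u"
proof (cases "u \<le> pi / 3")
  case True
  show ?thesis
  proof (cases "u = 0")
    case False
    then have "0 < u" using assms by simp
    from MVT2[OF this, of sin cos] obtain z where z: "0 < z" "z < u" "sin u - sin 0 = (u - 0) * cos z"
      by auto
    have "cos z \<ge> cos (pi / 3)" using z True by (intro cos_monotone_0_pi_le) auto
    then have "u * cos z \<ge> u * (1/2)" using assms by (intro mult_left_mono) (auto simp: cos_60)
    then show ?thesis using z assms by simp
  qed simp
next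
  case False
  then have "sin (pi / 6) \<le> sin u" using assms by (intro sin_monotone_2pi_le) auto
  then have "sin u \<ge> 1/2" by (simp add: sin_30)
  then show ?thesis using assms pi_less_4 by simp
qed

text \<open>The locale is instantiated with \<open>\<Omega>\<close> and with the explicit weight functions against which
\<open>Omega_tilde\<close> is integrated, so that both can be treated alike in the pairing below.\<close>

locale C1_pi_periodic =
  fixes f f' :: "real \<Rightarrow> real"
  assumes der: "\<And>x. (f has_real_derivative f' x) (at x)"
    and cont': "continuous_on UNIV f'"
    and per: "\<And>x. f (x + pi) = f x"
begin

lemma cont: "continuous_on UNIV f"
  using der by (intro DERIV_continuous_on) auto

lemma per': "f' (x + pi) = f' x"
proof -
  have "((\<lambda>x. f (x + pi)) has_real_derivative f' (x + pi)) (at x)"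
    using DERIV_shift[of f "f' (x + pi)" x pi] der by simp
  then show ?thesis unfolding per using der DERIV_unique by blast
qed

text \<open>The increment vanishes at both ends of the period, hence it is bounded by the distance to the nearer end
and so by the sine. This is what makes the integral in \<open>Omega_tilde\<close> absolutely convergent.\<close>

lemma increment_le_sin:
  obtains M where "M \<ge> 0" "\<And>u. u \<in> {0..pi} \<Longrightarrow> \<bar>f (x + u) - f x\<bar> \<le> M * sin u"
proof -
  have "bounded (f' ` {x - pi..x + pi})"
    by (intro compact_imp_bounded compact_continuous_image continuous_on_subset[OF cont']) auto
  then obtain L where "\<forall>z\<in>f' ` {x - pi..x + pi}. \<bar>z\<bar> \<le> L" unfolding bounded_real by blast
  then have L: "\<bar>f' y\<bar> \<le> L" if "y \<in> {x - pi..x + pi}" for y using that by blast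
  have L0: "L \<ge> 0" using L[of x] by auto
  have lip: "\<bar>f y - f x\<bar> \<le> L * \<bar>y - x\<bar>" if "y \<in> {x - pi..x + pi}" for y
  proof -
    have "norm (f y - f x) \<le> L * norm (y - x)"
      by (rule field_differentiable_bound[of "{x - pi..x + pi}" f f'])
         (use L that der in \<open>auto intro: has_field_derivative_at_within\<close>)
    then show ?thesis by simp
  qed
  show ?thesis
  proof
    show "4 * L \<ge> 0" using L0 by simp
    fix u assume u: "u \<in> {0..pi}"
    show "\<bar>f (x + u) - f x\<bar> \<le> 4 * L * sin u"
    proof (cases "u \<le> pi / 2")
      case True
      then have "L * u \<le> L * (4 * sin u)" using u L0 le_four_sin[of u] by (intro mult_left_mono) auto
      then show ?thesis using lip[of "x + u"] u by simp
    next
      case False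
      then have "L * (pi - u) \<le> L * (4 * sin u)"
        using u L0 le_four_sin[of "pi - u"] by (intro mult_left_mono) auto
      moreover have "f (x + u) = f (x + u - pi)" using per[of "x + u - pi"] by simp
      ultimately show ?thesis using lip[of "x + u - pi"] u by simp
    qed
  qed
qed

text \<open>Integration by parts with the primitive
\<open>(sin\<^sup>s\<^sup>-\<^sup>1 cos)' = (s - 1) sin\<^sup>s\<^sup>-\<^sup>2 - s sin\<^sup>s\<close>. The boundary terms vanish because the increment of
\<open>f\<close> is \<open>O(sin)\<close> and \<open>s > 0\<close>.\<close>

lemma hypersingular_integration_by_parts:
  fixes s x :: real
  assumes s: "0 < s" "s < 1"
  shows "(\<lambda>u. sin u powr (s - 1) * (s * sin u * f (x + u) - cos u * f' (x + u))) absolutely_integrable_on {0..pi}"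
    and "((\<lambda>u. (s - 1) * (sin u powr (s - 2) * (f (x + u) - f x)) + s * f x * sin u powr s) has_integral
      integral {0..pi} (\<lambda>u. sin u powr (s - 1) * (s * sin u * f (x + u) - cos u * f' (x + u)))) {0..pi}"
proof -
  let ?h = "\<lambda>u. sin u powr (s - 1) * (s * sin u * f (x + u) - cos u * f' (x + u))"
  have c: "continuous_on UNIV (\<lambda>u. s * sin u * f (x + u) - cos u * f' (x + u))"
    by (intro continuous_intros continuous_on_compose2[OF cont] continuous_on_compose2[OF cont']) auto
  have "(\<lambda>u. (s * sin u * f (x + u) - cos u * f' (x + u)) * sin u powr (s - 1)) absolutely_integrable_on {0..pi}"
  proof (rule absolutely_integrable_bounded_measurable_product_real)
    show "bounded ((\<lambda>u. s * sin u * f (x + u) - cos u * f' (x + u)) ` {0..pi})"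
      by (intro compact_imp_bounded compact_continuous_image continuous_on_subset[OF c]) auto
    show "(\<lambda>u. s * sin u * f (x + u) - cos u * f' (x + u)) \<in> borel_measurable (lebesgue_on {0..pi})"
      by (intro continuous_imp_measurable_on_sets_lebesgue continuous_on_subset[OF c]) auto
  qed (use s in \<open>auto intro: absolutely_integrable_sin_powr\<close>)
  then show ai: "?h absolutely_integrable_on {0..pi}" by (simp only: mult.commute)
  obtain M where M: "M \<ge> 0" "\<And>u. u \<in> {0..pi} \<Longrightarrow> \<bar>f (x + u) - f x\<bar> \<le> M * sin u"
    using increment_le_sin by blast
  define P where "P u = sin u powr (s - 1) * cos u * (f (x + u) - f x)" for u
  define P' where "P' u = ((s - 1) * sin u powr (s - 2) - s * sin u powr s) * (f (x + u) - f x)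
      + sin u powr (s - 1) * cos u * f' (x + u)" for u
  have dP: "(P has_vector_derivative P' u) (at u)" if "u \<in> {0<..<pi}" for u
  proof -
    have su: "sin u > 0" using that by (auto intro: sin_gt_zero)
    have d1: "((\<lambda>u. sin u powr (s - 1)) has_real_derivative (s - 1) * sin u powr (s - 2) * cos u) (at u)"
      using su by (auto intro!: derivative_eq_intros) 
    have d2: "((\<lambda>u. f (x + u) - f x) has_real_derivative f' (x + u)) (at u)"
      using DERIV_shift[of f "f' (x + u)" u x] der[of "u + x"]
      by (auto intro!: derivative_eq_intros simp: add.commute)
    have ps: "sin u powr s = sin u powr (s - 2) * (sin u)\<^sup>2" "sin u powr (s - 1) = sin u powr (s - 2) * sin u"
      using su by (simp_all add: powr_diff power2_eq_square)
    have cs: "(cos u)\<^sup>2 = 1 - (sin u)\<^sup>2" by (simp add: cos_squared_eq)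
    have "(P has_real_derivative ((s - 1) * sin u powr (s - 2) * cos u) * cos u * (f (x + u) - f x)
        + sin u powr (s - 1) * (- sin u) * (f (x + u) - f x) + sin u powr (s - 1) * cos u * f' (x + u)) (at u)"
      unfolding P_def[abs_def]
      by (rule DERIV_cong[OF DERIV_mult[OF DERIV_mult[OF d1 DERIV_cos] d2]]) (simp add: algebra_simps)
    also have "((s - 1) * sin u powr (s - 2) * cos u) * cos u * (f (x + u) - f x)
        + sin u powr (s - 1) * (- sin u) * (f (x + u) - f x) + sin u powr (s - 1) * cos u * f' (x + u)
        = sin u powr (s - 2) * ((s - 1) * (cos u)\<^sup>2 - (sin u)\<^sup>2) * (f (x + u) - f x) + sin u powr (s - 1) * cos u * f' (x + u)"
      unfolding ps by (simp add: algebra_simps power2_eq_square del: sin_cos_squared_add3)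
    also have "\<dots> = P' u"
      unfolding P'_def cs unfolding ps by (simp add: algebra_simps)
    finally show ?thesis by (simp add: has_real_derivative_iff_has_vector_derivative)
  qed
  have Pb: "\<bar>P u\<bar> \<le> M * sin u powr s" if "u \<in> {0..pi}" for u
  proof (cases "sin u = 0")
    case False
    then have su: "sin u > 0" using that sin_ge_zero[of u] by auto
    have "\<bar>P u\<bar> = sin u powr (s - 1) * \<bar>cos u\<bar> * \<bar>f (x + u) - f x\<bar>" by (simp add: P_def abs_mult)
    also have "\<dots> \<le> sin u powr (s - 1) * 1 * (M * sin u)"
      using M(2)[OF that] by (intro mult_mono) auto
    also have "\<dots> = M * sin u powr s" using su by (simp add: powr_diff)
    finally show ?thesis .
  qed (simp add: P_def)
  have cP: "continuous_on {0..pi} P"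
    unfolding continuous_on_eq_continuous_within
  proof
    fix u assume u: "u \<in> {0..pi}"
    show "continuous (at u within {0..pi}) P"
    proof (cases "u \<in> {0<..<pi}")
      case True
      then show ?thesis using dP[OF True]
        by (meson continuous_at_imp_continuous_at_within has_vector_derivative_continuous)
    next
      case False
      then have u0: "u = 0 \<or> u = pi" using u by auto
      then have P0: "P u = 0" "M * sin u powr s = 0" by (auto simp: P_def)
      have "continuous_on {0..pi} (\<lambda>u. M * sin u powr s)"
        by (intro continuous_intros continuous_on_powr') (use s sin_ge_zero in auto)
      then have "((\<lambda>u. M * sin u powr s) \<longlongrightarrow> 0) (at u within {0..pi})"
        using u P0 unfolding continuous_on_def by metis
      then have "(P \<longlongrightarrow> 0) (at u within {0..pi})"
        by (rule Lim_null_comparison[rotated]) (use Pb in \<open>auto simp: eventually_at_filter\<close>)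
      then show ?thesis unfolding continuous_within P0 .
    qed
  qed
  have "(P' has_integral P pi - P 0) {0..pi}"
    by (intro fundamental_theorem_of_calculus_interior cP dP) auto
  then have 1: "(P' has_integral 0) {0..pi}" by (simp add: P_def)
  have "(?h has_integral integral {0..pi} ?h) {0..pi}"
    using ai by (simp add: set_lebesgue_integral_eq_integral(1) integrable_integral)
  from has_integral_add[OF 1 this] have "((\<lambda>u. P' u + ?h u) has_integral integral {0..pi} ?h) {0<..<pi}"
    by (simp add: has_integral_Icc_iff_Ioo)
  then have "((\<lambda>u. (s - 1) * (sin u powr (s - 2) * (f (x + u) - f x)) + s * f x * sin u powr s) has_integral
      integral {0..pi} ?h) {0<..<pi}"
  proof (rule has_integral_eq[rotated])
    fix u assume "u \<in> {0<..<pi}"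
    then have su: "sin u > 0" by (auto intro: sin_gt_zero)
    then have ps: "sin u powr s = sin u powr (s - 1) * sin u" by (simp add: powr_diff)
    show "P' u + ?h u = (s - 1) * (sin u powr (s - 2) * (f (x + u) - f x)) + s * f x * sin u powr s"
      unfolding P'_def ps by (simp add: algebra_simps)
  qed
  then show "((\<lambda>u. (s - 1) * (sin u powr (s - 2) * (f (x + u) - f x)) + s * f x * sin u powr s) has_integral
      integral {0..pi} ?h) {0..pi}" by (simp add: has_integral_Icc_iff_Ioo)
qed

text \<open>After the shift \<open>\<theta> = \<phi> + \<pi>/2 + u\<close> the kernel becomes \<open>|sin u|\<^sup>s\<^sup>-\<^sup>2\<close> and the base point of the increment
becomes \<open>u = 0\<close>. The subtracted value and the term with \<open>c_const\<close> cancel.\<close>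

lemma Omega_tilde_eq:
  assumes s: "0 < s" "s < 1"
  shows "Omega_tilde s f \<phi> = 2 * tau (2 - s) / (s - 1) *
    integral {0..pi} (\<lambda>u. sin u powr (s - 1) *
      (s * sin u * f (\<phi> + pi / 2 + u) - cos u * f' (\<phi> + pi / 2 + u)))"
proof -
  define x where "x = \<phi> + pi / 2"
  define K where "K = integral {0..pi} (\<lambda>u. sin u powr (s - 1) * (s * sin u * f (x + u) - cos u * f' (x + u)))"
  define B where "B = Beta (1/2) (s / 2 + 1/2)"
  have sB: "((\<lambda>u. sin u powr s) has_integral B) {0..pi}"
    using has_integral_sin_powr[of s] s unfolding B_def by (simp add: add_divide_distrib)
  have "((\<lambda>u. (s - 1) * (sin u powr (s - 2) * (f (x + u) - f x)) + s * f x * sin u powr s - s * f x * sin u powr s)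
      has_integral K - s * f x * B) {0..pi}"
    unfolding K_def by (intro has_integral_diff hypersingular_integration_by_parts(2) s has_integral_mult_right sB)
  then have "((\<lambda>u. 1 / (s - 1) * ((s - 1) * (sin u powr (s - 2) * (f (x + u) - f x)))) has_integral
      1 / (s - 1) * (K - s * f x * B)) {0..pi}"
    by (intro has_integral_mult_right) simp
  then have S: "((\<lambda>u. sin u powr (s - 2) * (f (x + u) - f x)) has_integral (K - s * f x * B) / (s - 1)) {0..pi}"
    using s by simp
  define F where "F \<theta> = \<bar>cos (\<phi> - \<theta>)\<bar> powr (- 2 + s) * (f \<theta> - f (\<phi> + pi / 2))" for \<theta>
  have cos_eq: "\<bar>cos (\<phi> - (x + u))\<bar> = sin u" if "u \<in> {0..pi}" for u
  proof -
    have "cos (\<phi> - (x + u)) = cos (pi / 2 + u)" unfolding x_def by (simp add: cos_diff cos_add sin_add)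
    then show ?thesis using that sin_ge_zero[of u] by (simp add: cos_add)
  qed
  have cosp: "\<bar>cos (\<phi> - (y + pi))\<bar> = \<bar>cos (\<phi> - y)\<bar>" for y
    by (simp add: cos_diff)
  have "((\<lambda>u. F (x + u)) has_integral (K - s * f x * B) / (s - 1)) {0..pi}"
    by (rule has_integral_eq[OF _ S]) (simp add: F_def cos_eq flip: x_def)
  then have FI: "(F has_integral 2 * ((K - s * f x * B) / (s - 1))) {-pi..pi}"
    by (rule has_integral_pi_periodic[rotated]) (simp only: F_def cosp per)
  obtain M where M: "M \<ge> 0" "\<And>u. u \<in> {0..pi} \<Longrightarrow> \<bar>f (x + u) - f x\<bar> \<le> M * sin u"
    using increment_le_sin by blast
  define g where "g \<theta> = M * \<bar>cos (\<phi> - \<theta>)\<bar> powr (s - 1)" for \<theta>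
  have "((\<lambda>u. M * sin u powr (s - 1)) has_integral M * Beta (1/2) ((s - 1 + 1) / 2)) {0..pi}"
    using s by (intro has_integral_mult_right has_integral_sin_powr) auto
  then have "((\<lambda>u. g (x + u)) has_integral M * Beta (1/2) ((s - 1 + 1) / 2)) {0..pi}"
    by (rule has_integral_eq[rotated]) (simp add: g_def cos_eq)
  then have gI: "g integrable_on {-pi..pi}"
    using has_integral_pi_periodic[of g x] by (auto simp: g_def cosp)
  have Fg: "\<bar>F \<theta>\<bar> \<le> g \<theta>" for \<theta>
  proof -
    have 1: "\<bar>F (x + u)\<bar> \<le> g (x + u)" if u: "u \<in> {0..pi}" for u
    proof (cases "sin u = 0")
      case True
      then show ?thesis using cos_eq[OF u] M by (simp add: F_def g_def)
    next
      case False
      then have su: "sin u > 0" using u sin_ge_zero[of u] by auto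
      have "\<bar>F (x + u)\<bar> = sin u powr (s - 2) * \<bar>f (x + u) - f x\<bar>"
        using cos_eq[OF u] by (simp add: F_def abs_mult x_def)
      also have "\<dots> \<le> sin u powr (s - 2) * (M * sin u)" using M(2)[OF u] by (intro mult_left_mono) auto
      also have "\<dots> = g (x + u)" unfolding g_def cos_eq[OF u] using su by (simp add: powr_diff power2_eq_square)
      finally show ?thesis .
    qed
    define n where "n = \<lfloor>(\<theta> - x) / pi\<rfloor>"
    have "of_int n \<le> (\<theta> - x) / pi" "(\<theta> - x) / pi < of_int n + 1" unfolding n_def by linarith+
    then have u: "\<theta> - x - of_int n * pi \<in> {0..pi}" by (auto simp: field_simps)
    have "F (y + pi) = F y" "g (y + pi) = g y" for y by (simp_all only: F_def g_def cosp per)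
    then have "F (\<theta> + of_int (- n) * pi) = F \<theta>" "g (\<theta> + of_int (- n) * pi) = g \<theta>"
      by (intro periodic_add_of_int; simp)+
    then show ?thesis using 1[OF u] by (simp add: algebra_simps)
  qed
  have "F absolutely_integrable_on {-pi..pi}"
    using Fg FI by (intro absolutely_integrable_integrable_bound[OF _ _ gI]) auto
  moreover have "F \<in> borel_measurable borel"
    unfolding F_def[abs_def] using borel_measurable_continuous_onI[OF cont] by measurable
  ultimately have "(LINT \<theta>:{-pi..pi}|lborel. F \<theta>) = integral {-pi..pi} F"
    using lborel_integral_of_absolutely_integrable(2)[where f = F and S = "{-pi..pi}"] by (simp add: set_lebesgue_integral_def)
  also have "\<dots> = 2 * ((K - s * f x * B) / (s - 1))" using FI by (rule integral_unique)
  finally have "Omega_tilde s f \<phi> = tau (2 - s) * (2 * ((K - s * f x * B) / (s - 1))) + c_const s * f x"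
    unfolding Omega_tilde_def F_def x_def by simp
  also have "\<dots> = 2 * tau (2 - s) / (s - 1) * K"
  proof -
    have "tau (2 - s) * (2 * ((K - s * f x * B) / r)) + 2 * tau (2 - s) / r * s * B * f x = 2 * tau (2 - s) / r * K"
      if "r \<noteq> 0" for r using that by (simp add: field_simps)
    then show ?thesis unfolding c_const_eq_tau[OF s] B_def[symmetric] using s by simp
  qed
  finally show ?thesis unfolding K_def x_def .
qed

end

lemma integrable_mult_pair:
  fixes f g :: "real \<Rightarrow> real"
  assumes f: "integrable lborel f" and g: "integrable lborel g"
  shows "integrable (lborel \<Otimes>\<^sub>M lborel) (\<lambda>(x, y). f x * g y)"
proof (rule lborel_pair.Fubini_integrable)
  show "(\<lambda>(x, y). f x * g y) \<in> borel_measurable (lborel \<Otimes>\<^sub>M lborel)"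
    using f g by (auto dest!: borel_measurable_integrable)
  show "integrable lborel (\<lambda>x. LINT y|lborel. norm (case (x, y) of (x, y) \<Rightarrow> f x * g y))"
    using f by (simp add: abs_mult)
  show "AE x in lborel. integrable lborel (\<lambda>y. case (x, y) of (x, y) \<Rightarrow> f x * g y)"
    using g by simp
qed

text \<open>Exchange of integrations for an integrable singular weight in one variable and a continuous function of
both; the function is bounded on the rectangle that matters.\<close>

lemma Fubini_compact_weight:
  fixes w :: "real \<Rightarrow> real" and K :: "real \<Rightarrow> real \<Rightarrow> real"
  assumes w: "integrable lborel w" and w0: "\<And>u. u \<notin> {a..b} \<Longrightarrow> w u = 0"
    and K: "continuous_on UNIV (\<lambda>z. K (fst z) (snd z))"
  shows "(LINT y:{c..d}|lborel. (LINT u|lborel. w u * K u y)) = (LINT u|lborel. w u * (LINT y:{c..d}|lborel. K u y))"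
proof -
  let ?f = "\<lambda>u y. w u * (indicator {c..d} y * K u y)"
  have "bounded ((\<lambda>z. K (fst z) (snd z)) ` ({a..b} \<times> {c..d}))"
    by (intro compact_imp_bounded compact_continuous_image continuous_on_subset[OF K] compact_Times) auto
  then obtain B where "\<forall>z\<in>(\<lambda>z. K (fst z) (snd z)) ` ({a..b} \<times> {c..d}). \<bar>z\<bar> \<le> B" unfolding bounded_real by blast
  then have B: "\<bar>K u y\<bar> \<le> B" if "u \<in> {a..b}" "y \<in> {c..d}" for u y using that by fastforce
  have "integrable lborel (indicat_real {c..d})"
    by (rule integrable_real_indicator) (auto simp: emeasure_lborel_Icc_eq)
  then have i: "integrable (lborel \<Otimes>\<^sub>M lborel) (\<lambda>(u, y). w u * (B * indicator {c..d} y))"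
    using w by (intro integrable_mult_pair) auto
  have "integrable (lborel \<Otimes>\<^sub>M lborel) (case_prod ?f)"
  proof (rule Bochner_Integration.integrable_bound[OF i])
    have "(\<lambda>z. K (fst z) (snd z)) \<in> borel_measurable (lborel \<Otimes>\<^sub>M lborel)"
      using borel_measurable_continuous_onI[OF K] by (simp add: lborel_prod)
    then show "case_prod ?f \<in> borel_measurable (lborel \<Otimes>\<^sub>M lborel)"
      using borel_measurable_integrable[OF w] unfolding case_prod_beta by measurable
    have "norm (?f u y) \<le> norm (w u * (B * indicator {c..d} y))" for u y
    proof (cases "u \<in> {a..b} \<and> y \<in> {c..d}")
      case True
      then have "\<bar>K u y\<bar> \<le> \<bar>B\<bar>" using B[of u y] by simp
      then show ?thesis using True by (simp add: abs_mult mult_left_mono)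
    qed (use w0 in \<open>auto simp: indicator_def\<close>)
    then show "AE z in lborel \<Otimes>\<^sub>M lborel. norm (case_prod ?f z) \<le> norm (case z of (u, y) \<Rightarrow> w u * (B * indicator {c..d} y))"
      by (intro AE_I2) (simp add: case_prod_beta)
  qed
  from lborel_pair.Fubini_integral[OF this]
  have "(LINT y|lborel. LINT u|lborel. ?f u y) = (LINT u|lborel. LINT y|lborel. ?f u y)" .
  moreover have "(LINT u|lborel. ?f u y) = indicator {c..d} y * (LINT u|lborel. w u * K u y)" for y
    by (cases "y \<in> {c..d}") auto
  moreover have "(LINT y|lborel. ?f u y) = w u * (LINT y|lborel. indicator {c..d} y * K u y)" for u
    by simp
  ultimately show ?thesis by (simp add: set_lebesgue_integral_def)
qed

lemma integral_sin_powr_weight: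
  fixes s :: real and g :: "real \<Rightarrow> real"
  assumes s: "0 < s" and g: "continuous_on UNIV g"
  shows "integrable lborel (\<lambda>u. indicator {0..pi} u * sin u powr (s - 1))"
    and "integral {0..pi} (\<lambda>u. sin u powr (s - 1) * g u) = (LINT u|lborel. (indicator {0..pi} u * sin u powr (s - 1)) * g u)"
proof -
  have 1: "(\<lambda>u. sin u powr (s - 1)) absolutely_integrable_on {0..pi}"
    using s by (intro absolutely_integrable_sin_powr) auto
  then show "integrable lborel (\<lambda>u. indicator {0..pi} u * sin u powr (s - 1))"
    by (intro lborel_integral_of_absolutely_integrable(1)) auto
  have "(\<lambda>u. g u * sin u powr (s - 1)) absolutely_integrable_on {0..pi}"
  proof (rule absolutely_integrable_bounded_measurable_product_real[OF _ _ _ 1])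
    show "bounded (g ` {0..pi})"
      by (intro compact_imp_bounded compact_continuous_image continuous_on_subset[OF g]) auto
    show "g \<in> borel_measurable (lebesgue_on {0..pi})"
      by (intro continuous_imp_measurable_on_sets_lebesgue continuous_on_subset[OF g]) auto
  qed auto
  then have "(LINT u|lborel. indicator {0..pi} u * (g u * sin u powr (s - 1))) = integral {0..pi} (\<lambda>u. g u * sin u powr (s - 1))"
    by (intro lborel_integral_of_absolutely_integrable(2)) (use borel_measurable_continuous_onI[OF g] in auto)
  then show "integral {0..pi} (\<lambda>u. sin u powr (s - 1) * g u) = (LINT u|lborel. (indicator {0..pi} u * sin u powr (s - 1)) * g u)"
    by (simp add: ac_simps)
qed

lemma LINT_Icc_eq_integral:
  fixes f :: "real \<Rightarrow> real"
  assumes "continuous_on {a..b} f"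
  shows "(LINT x:{a..b}|lborel. f x) = integral {a..b} f"
  by (rule set_borel_integral_eq_integral(2)[OF borel_integrable_atLeastAtMost'[OF assms]])

text \<open>Symmetry of the regularised operator. For fixed \<open>u\<close> both sides are integrals over a full turn that
differ by a translation by \<open>\<pi>/2 + u\<close> and by the derivative of the periodic function
\<open>\<phi> \<mapsto> cos u h(\<phi>) f(\<phi> + \<pi>/2 + u)\<close>. The sign of \<open>cos u\<close> on the right belongs to the reflected
argument \<open>\<theta> - \<pi>/2 - u\<close>.\<close>

lemma pairing_Omega_tilde:
  fixes s :: real
  assumes f: "C1_pi_periodic f f'" and h: "C1_pi_periodic h h'" and s: "0 < s" "s < 1"
  shows "(LINT \<phi>:{-pi..pi}|lborel. h \<phi> * Omega_tilde s f \<phi>) =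
    2 * tau (2 - s) / (s - 1) * (LINT \<theta>:{-pi..pi}|lborel. f \<theta> * integral {0..pi} (\<lambda>u. sin u powr (s - 1) *
      (s * sin u * h (\<theta> - pi / 2 - u) + cos u * h' (\<theta> - pi / 2 - u))))"
proof -
  interpret f: C1_pi_periodic f f' by fact
  interpret h: C1_pi_periodic h h' by fact
  note ci = continuous_intros continuous_on_compose2[OF f.cont] continuous_on_compose2[OF f.cont']
     continuous_on_compose2[OF h.cont] continuous_on_compose2[OF h.cont']
  define k where "k = 2 * tau (2 - s) / (s - 1)"
  define w where "w u = indicator {0..pi} u * sin u powr (s - 1)" for u :: real
  define K1 where "K1 u \<phi> = h \<phi> * (s * sin u * f (\<phi> + pi / 2 + u) - cos u * f' (\<phi> + pi / 2 + u))" for u \<phi>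
  define K2 where "K2 u \<theta> = f \<theta> * (s * sin u * h (\<theta> - pi / 2 - u) + cos u * h' (\<theta> - pi / 2 - u))" for u \<theta>
  have w: "integrable lborel w" unfolding w_def[abs_def] by (rule integral_sin_powr_weight(1)[OF s(1), of "\<lambda>_. 0"]) simp
  have w0: "w u = 0" if "u \<notin> {0..pi}" for u using that by (simp add: w_def)
  have c1: "continuous_on UNIV (\<lambda>z. K1 (fst z) (snd z))" and c2: "continuous_on UNIV (\<lambda>z. K2 (fst z) (snd z))"
    unfolding K1_def K2_def by (intro ci; auto)+
  have c1': "continuous_on A (K1 u)" and c2': "continuous_on A (K2 u)" for u A
    unfolding K1_def K2_def by (intro ci; auto)+
  have inner: "integral {-pi..pi} (K1 u) = integral {-pi..pi} (K2 u)" for u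
  proof -
    define c where "c = pi / 2 + u"
    define P where "P \<phi> = cos u * (h \<phi> * f (\<phi> + c))" for \<phi>
    have dP: "(P has_real_derivative cos u * (h' \<phi> * f (\<phi> + c) + h \<phi> * f' (\<phi> + c))) (at \<phi>)" for \<phi>
    proof -
      have "((\<lambda>x. f (x + c)) has_real_derivative f' (\<phi> + c)) (at \<phi>)"
        using DERIV_shift[of f "f' (\<phi> + c)" \<phi> c] f.der by simp
      from DERIV_cmult[OF DERIV_mult[OF h.der this], of "cos u"] show ?thesis
        unfolding P_def[abs_def] by (simp add: algebra_simps)
    qed
    have per2: "f (x + 2 * pi) = f x" "h (x + 2 * pi) = h x" "h' (x + 2 * pi) = h' x" for x
    proof -
      have e: "x + 2 * pi = x + pi + pi" by simp
      show "f (x + 2 * pi) = f x" "h (x + 2 * pi) = h x" "h' (x + 2 * pi) = h' x"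
        unfolding e f.per h.per h.per' by simp_all
    qed
    have "((\<lambda>\<phi>. cos u * (h' \<phi> * f (\<phi> + c) + h \<phi> * f' (\<phi> + c))) has_integral P pi - P (- pi)) {-pi..pi}"
      by (intro fundamental_theorem_of_calculus)
         (auto simp: has_real_derivative_iff_has_vector_derivative[symmetric] intro: has_field_derivative_at_within dP)
    moreover have "P pi = P (- pi)"
      using per2(1)[of "- pi + c"] per2(2)[of "- pi"] unfolding P_def by (simp add: algebra_simps)
    ultimately have z: "((\<lambda>\<phi>. cos u * (h' \<phi> * f (\<phi> + c) + h \<phi> * f' (\<phi> + c))) has_integral 0) {-pi..pi}" by simp
    have "(K2 u has_integral integral {0..2 * pi} (K2 u)) {0..2 * pi}"
      by (intro integrable_integral integrable_continuous_real c2')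
    moreover have "K2 u (x + 2 * pi) = K2 u x" for x
    proof -
      have e: "x + 2 * pi - pi / 2 - u = (x - pi / 2 - u) + 2 * pi" by simp
      show ?thesis unfolding K2_def e per2 ..
    qed
    ultimately have p2: "(K2 u has_integral integral {0..2 * pi} (K2 u)) {x..x + 2 * pi}" for x
      by (intro has_integral_periodic) auto
    have I2: "(K2 u has_integral integral {0..2 * pi} (K2 u)) {-pi..pi}" using p2[of "- pi"] by simp
    have "((\<lambda>x. K2 u (x + c)) has_integral integral {0..2 * pi} (K2 u)) {-pi..pi}"
      using has_integral_shift_real_ivl[OF p2[of "- pi + c"], of c] by simp
    from has_integral_diff[OF this z]
    have "((\<lambda>x. K2 u (x + c) - cos u * (h' x * f (x + c) + h x * f' (x + c))) has_integral integral {0..2 * pi} (K2 u)) {-pi..pi}"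
      by simp
    moreover have "K2 u (x + c) - cos u * (h' x * f (x + c) + h x * f' (x + c)) = K1 u x" for x
      unfolding K1_def K2_def c_def by (simp add: algebra_simps)
    ultimately have "(K1 u has_integral integral {0..2 * pi} (K2 u)) {-pi..pi}" by simp
    then show ?thesis using I2 by (metis integral_unique)
  qed
  have "h \<phi> * Omega_tilde s f \<phi> = k * (LINT u|lborel. w u * K1 u \<phi>)" for \<phi>
  proof -
    have "h \<phi> * Omega_tilde s f \<phi> = k * (h \<phi> * integral {0..pi} (\<lambda>u. sin u powr (s - 1) *
      (s * sin u * f (\<phi> + pi / 2 + u) - cos u * f' (\<phi> + pi / 2 + u))))"
      unfolding k_def f.Omega_tilde_eq[OF s] by simp
    also have "h \<phi> * integral {0..pi} (\<lambda>u. sin u powr (s - 1) *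
      (s * sin u * f (\<phi> + pi / 2 + u) - cos u * f' (\<phi> + pi / 2 + u))) =
      h \<phi> * (LINT u|lborel. (indicator {0..pi} u * sin u powr (s - 1)) * (s * sin u * f (\<phi> + pi / 2 + u) - cos u * f' (\<phi> + pi / 2 + u)))"
      by (rule arg_cong[where f = "\<lambda>z. h \<phi> * z"], rule integral_sin_powr_weight(2)[OF s(1)]) (intro ci; auto)
    also have "\<dots> = (LINT u|lborel. w u * K1 u \<phi>)"
      unfolding w_def K1_def by (subst integral_mult_right_zero[symmetric]) (simp add: ac_simps)
    finally show ?thesis .
  qed
  then have "(LINT \<phi>:{-pi..pi}|lborel. h \<phi> * Omega_tilde s f \<phi>) = k * (LINT \<phi>:{-pi..pi}|lborel. (LINT u|lborel. w u * K1 u \<phi>))"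
    by (simp add: set_integral_mult_right)
  also have "(LINT \<phi>:{-pi..pi}|lborel. (LINT u|lborel. w u * K1 u \<phi>)) = (LINT u|lborel. w u * (LINT \<phi>:{-pi..pi}|lborel. K1 u \<phi>))"
    by (rule Fubini_compact_weight[OF w w0 c1])
  also have "\<dots> = (LINT u|lborel. w u * (LINT \<phi>:{-pi..pi}|lborel. K2 u \<phi>))"
    using inner by (simp add: LINT_Icc_eq_integral[OF c1'] LINT_Icc_eq_integral[OF c2'])
  also have "\<dots> = (LINT \<phi>:{-pi..pi}|lborel. (LINT u|lborel. w u * K2 u \<phi>))"
    by (rule Fubini_compact_weight[OF w w0 c2, symmetric])
  finally have 1: "(LINT \<phi>:{-pi..pi}|lborel. h \<phi> * Omega_tilde s f \<phi>) =
      k * (LINT \<phi>:{-pi..pi}|lborel. (LINT u|lborel. w u * K2 u \<phi>))" .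
  have 2: "(LINT u|lborel. w u * K2 u \<theta>) = f \<theta> * integral {0..pi} (\<lambda>u. sin u powr (s - 1) *
      (s * sin u * h (\<theta> - pi / 2 - u) + cos u * h' (\<theta> - pi / 2 - u)))" for \<theta>
  proof -
    have "f \<theta> * integral {0..pi} (\<lambda>u. sin u powr (s - 1) * (s * sin u * h (\<theta> - pi / 2 - u) + cos u * h' (\<theta> - pi / 2 - u))) =
      f \<theta> * (LINT u|lborel. (indicator {0..pi} u * sin u powr (s - 1)) * (s * sin u * h (\<theta> - pi / 2 - u) + cos u * h' (\<theta> - pi / 2 - u)))"
      by (rule arg_cong[where f = "\<lambda>z. f \<theta> * z"], rule integral_sin_powr_weight(2)[OF s(1)]) (intro ci; auto)
    also have "\<dots> = (LINT u|lborel. w u * K2 u \<theta>)"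
      unfolding w_def K2_def by (subst integral_mult_right_zero[symmetric]) (simp add: ac_simps)
    finally show ?thesis by simp
  qed
  show ?thesis unfolding 1 2 k_def ..
qed

section \<open>The coefficients of the system\<close>

text \<open>The result of applying the regularised operator to
\<open>(a\<^sup>2 cos\<^sup>2 + b\<^sup>2 sin\<^sup>2) powr (- (2 + s)/2) (P cos + Q sin)\<^sup>2\<close>, without the Beta factor and turned by
\<open>\<pi>/2\<close>. The pairs \<open>(P, Q) = (1, 0)\<close> and \<open>(0, 1)\<close> belong to the first and the second coefficient.\<close>

definition ellipse_kernel :: "real \<Rightarrow> real \<Rightarrow> real \<Rightarrow> real \<Rightarrow> real \<Rightarrow> real \<Rightarrow> real" where
  "ellipse_kernel s P Q a b \<theta> =
     ((a * b)\<^sup>2 * (P * sin \<theta> - Q * cos \<theta>)\<^sup>2 - (1 - s) * (b\<^sup>2 * P * cos \<theta> + a\<^sup>2 * Q * sin \<theta>)\<^sup>2) *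
     (a\<^sup>2 * (sin \<theta>)\<^sup>2 + b\<^sup>2 * (cos \<theta>)\<^sup>2) powr (s / 2 - 2) * (a * b) powr (- (s + 1))"

lemma sum_squares_trig_pos:
  fixes a b :: real
  assumes "a > 0" "b > 0"
  shows "a\<^sup>2 * (sin \<theta>)\<^sup>2 + b\<^sup>2 * (cos \<theta>)\<^sup>2 > 0"
proof (cases "sin \<theta> = 0")
  case True
  then have "cos \<theta> \<noteq> 0" using sin_cos_squared_add[of \<theta>] by auto
  then show ?thesis using True assms by simp
next
  case False
  then show ?thesis using assms by (intro add_pos_nonneg) auto
qed

text \<open>The weight \<open>h\<close> evaluated at \<open>\<theta> - \<pi>/2 - u\<close> is, as a function of \<open>u\<close>, a power of a quadratic form times the
square of a linear form. The matrix of the form has entries \<open>\<gamma>, \<beta>, \<delta>\<close> and determinant \<open>(a b)\<^sup>2\<close>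
for every \<open>\<theta>\<close>, since it arises from \<open>diag(a\<^sup>2, b\<^sup>2)\<close> by a change of orthonormal basis.\<close>

lemma angular_coefficient:
  fixes s a b P Q :: real
  assumes f: "C1_pi_periodic f f'" and s: "0 < s" "s < 1" and ab: "a > 0" "b > 0"
  shows "tau s * (R1 s / R2 s) powr (2 + s) *
     (LINT \<phi>:{-pi..pi}|lborel. (a\<^sup>2 * (cos \<phi>)\<^sup>2 + b\<^sup>2 * (sin \<phi>)\<^sup>2) powr (- (2 + s) / 2) * (P * cos \<phi> + Q * sin \<phi>)\<^sup>2 * Omega_tilde s f \<phi>)
     = 1 / (s * pi) * integral {-pi..pi} (\<lambda>\<theta>. f \<theta> * ellipse_kernel s P Q a b \<theta>)"
proof -
  interpret f: C1_pi_periodic f f' by fact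
  define g where "g \<phi> = a\<^sup>2 * (cos \<phi>)\<^sup>2 + b\<^sup>2 * (sin \<phi>)\<^sup>2" for \<phi>
  define m where "m = - (2 + s) / 2"
  have g0: "g \<phi> > 0" for \<phi> using sum_squares_trig_pos[OF ab(2,1), of \<phi>] by (simp add: g_def add.commute)
  define h where "h \<phi> = g \<phi> powr m * (P * cos \<phi> + Q * sin \<phi>)\<^sup>2" for \<phi>
  define h' where "h' \<phi> = m * g \<phi> powr (m - 1) * (2 * (b\<^sup>2 - a\<^sup>2) * sin \<phi> * cos \<phi>) * (P * cos \<phi> + Q * sin \<phi>)\<^sup>2
      + g \<phi> powr m * (2 * (P * cos \<phi> + Q * sin \<phi>) * (- P * sin \<phi> + Q * cos \<phi>))" for \<phi>
  have dg: "(g has_real_derivative 2 * (b\<^sup>2 - a\<^sup>2) * sin \<phi> * cos \<phi>) (at \<phi>)" for \<phi>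
    unfolding g_def[abs_def] by (auto intro!: derivative_eq_intros simp: algebra_simps)
  have dl: "((\<lambda>\<phi>. (P * cos \<phi> + Q * sin \<phi>)\<^sup>2) has_real_derivative
      2 * (P * cos \<phi> + Q * sin \<phi>) * (- P * sin \<phi> + Q * cos \<phi>)) (at \<phi>)" for \<phi>
    by (auto intro!: derivative_eq_intros simp: algebra_simps)
  have dp: "((\<lambda>\<phi>. g \<phi> powr m) has_real_derivative m * g \<phi> powr (m - 1) * (2 * (b\<^sup>2 - a\<^sup>2) * sin \<phi> * cos \<phi>)) (at \<phi>)" for \<phi>
    using DERIV_fun_powr[OF dg g0, of m \<phi>] by simp
  have dh: "(h has_real_derivative h' \<phi>) (at \<phi>)" for \<phi>
    unfolding h_def[abs_def] h'_def
    by (rule DERIV_cong[OF DERIV_mult[OF dp dl]]) (simp add: algebra_simps)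
  have cg: "continuous_on UNIV g" unfolding g_def[abs_def] by (intro continuous_intros)
  have h: "C1_pi_periodic h h'"
  proof
    show "(h has_real_derivative h' x) (at x)" for x by (rule dh)
    show "continuous_on UNIV h'" unfolding h'_def[abs_def]
      by (intro continuous_intros cg) (use g0 in \<open>auto simp: less_imp_neq[symmetric] order.strict_implies_not_eq\<close>)
    show "h (x + pi) = h x" for x
    proof -
      have "(- (P * cos x) - Q * sin x)\<^sup>2 = (P * cos x + Q * sin x)\<^sup>2" by (simp add: power2_eq_square algebra_simps)
      then show ?thesis unfolding h_def g_def by simp
    qed
  qed
  define B where "B = Beta (1/2) (s / 2 + 1/2)"
  have inner: "integral {0..pi} (\<lambda>u. sin u powr (s - 1) *
      (s * sin u * h (\<theta> - pi / 2 - u) + cos u * h' (\<theta> - pi / 2 - u))) = B * ellipse_kernel s P Q a b \<theta>" for \<theta>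
  proof -
    define \<gamma> where "\<gamma> = a\<^sup>2 * (sin \<theta>)\<^sup>2 + b\<^sup>2 * (cos \<theta>)\<^sup>2"
    define \<beta> where "\<beta> = (b\<^sup>2 - a\<^sup>2) * sin \<theta> * cos \<theta>"
    define \<delta> where "\<delta> = a\<^sup>2 * (cos \<theta>)\<^sup>2 + b\<^sup>2 * (sin \<theta>)\<^sup>2"
    define e where "e = P * sin \<theta> - Q * cos \<theta>"
    define w where "w = - P * cos \<theta> - Q * sin \<theta>"
    have g: "\<gamma> > 0" unfolding \<gamma>_def by (rule sum_squares_trig_pos[OF ab])
    have "\<gamma> * \<delta> - \<beta>\<^sup>2 = (a * b)\<^sup>2 * ((sin \<theta>)\<^sup>2 + (cos \<theta>)\<^sup>2)\<^sup>2"
      unfolding \<gamma>_def \<beta>_def \<delta>_def by algebra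
    then have D: "\<gamma> * \<delta> - \<beta>\<^sup>2 = (a * b)\<^sup>2" by simp
    then have D0: "\<gamma> * \<delta> - \<beta>\<^sup>2 > 0" using ab by simp
    define H where "H u = (\<gamma> * (cos u)\<^sup>2 + 2 * \<beta> * cos u * sin u + \<delta> * (sin u)\<^sup>2) powr (- (s / 2 + 1)) *
      (e * cos u + w * sin u)\<^sup>2" for u
    have trig: "cos (\<theta> - pi / 2 - u) = sin \<theta> * cos u - cos \<theta> * sin u"
        "sin (\<theta> - pi / 2 - u) = - (cos \<theta> * cos u + sin \<theta> * sin u)" for u
      by (simp_all add: cos_diff sin_diff)
    have gH: "g (\<theta> - pi / 2 - u) = \<gamma> * (cos u)\<^sup>2 + 2 * \<beta> * cos u * sin u + \<delta> * (sin u)\<^sup>2" for u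
      unfolding g_def trig \<gamma>_def \<beta>_def \<delta>_def by (simp add: power2_eq_square algebra_simps)
    have lH: "P * cos (\<theta> - pi / 2 - u) + Q * sin (\<theta> - pi / 2 - u) = e * cos u + w * sin u" for u
      unfolding trig e_def w_def by (simp add: algebra_simps)
    have m: "m = - (s / 2 + 1)" unfolding m_def by (simp add: field_simps)
    have Hh: "H u = h (\<theta> - pi / 2 - u)" for u unfolding h_def gH lH H_def m ..
    have "(H has_real_derivative - h' (\<theta> - pi / 2 - u)) (at u)" for u
    proof -
      have "((\<lambda>u. h (\<theta> - pi / 2 - u)) has_real_derivative h' (\<theta> - pi / 2 - u) * (- 1)) (at u)"
        by (rule DERIV_chain2[OF dh]) (auto intro!: derivative_eq_intros)
      then show ?thesis unfolding Hh[abs_def] by simp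
    qed
    from hypersingular_integral_quadratic_form[OF s(1) g D0 this[unfolded H_def[abs_def]]]
    have "((\<lambda>u. sin u powr (s - 1) * (s * sin u * H u - cos u * - h' (\<theta> - pi / 2 - u))) has_integral
     ((\<gamma> * \<delta> - \<beta>\<^sup>2) / \<gamma>\<^sup>2 * e\<^sup>2 - (1 - s) * (w - \<beta> / \<gamma> * e)\<^sup>2) *
     (\<gamma> powr (s / 2) * (\<gamma> * \<delta> - \<beta>\<^sup>2) powr (- (s / 2 + 1/2)) * B)) {0..pi}"
      unfolding H_def B_def .
    then have "integral {0..pi} (\<lambda>u. sin u powr (s - 1) * (s * sin u * h (\<theta> - pi / 2 - u) + cos u * h' (\<theta> - pi / 2 - u)))
      = ((a * b)\<^sup>2 / \<gamma>\<^sup>2 * e\<^sup>2 - (1 - s) * (w - \<beta> / \<gamma> * e)\<^sup>2) * (\<gamma> powr (s / 2) * ((a * b)\<^sup>2) powr (- (s / 2 + 1/2)) * B)"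
      unfolding Hh D by (simp add: integral_unique)
    also have "w - \<beta> / \<gamma> * e = - (b\<^sup>2 * P * cos \<theta> + a\<^sup>2 * Q * sin \<theta>) / \<gamma>"
    proof -
      have "w * \<gamma> - \<beta> * e = - (b\<^sup>2 * P * cos \<theta> + a\<^sup>2 * Q * sin \<theta>) * ((sin \<theta>)\<^sup>2 + (cos \<theta>)\<^sup>2)"
        unfolding w_def \<gamma>_def \<beta>_def e_def by (simp add: power2_eq_square algebra_simps del: sin_cos_squared_add3)
      then show ?thesis using g by (simp add: field_simps)
    qed
    also have "((a * b)\<^sup>2) powr (- (s / 2 + 1/2)) = (a * b) powr (- (s + 1))"
    proof -
      have "(a * b)\<^sup>2 = (a * b) powr 2" using ab by simp
      moreover have "2 * (- (s / 2 + 1/2)) = - (s + 1)" by simp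
      ultimately show ?thesis by (simp only: powr_powr)
    qed
    also have "((a * b)\<^sup>2 / \<gamma>\<^sup>2 * e\<^sup>2 - (1 - s) * (- (b\<^sup>2 * P * cos \<theta> + a\<^sup>2 * Q * sin \<theta>) / \<gamma>)\<^sup>2) *
       (\<gamma> powr (s / 2) * (a * b) powr (- (s + 1)) * B) = B * ellipse_kernel s P Q a b \<theta>"
    proof -
      have ps: "\<gamma> powr (s / 2 - 2) = \<gamma> powr (s / 2) / \<gamma>\<^sup>2" using g by (simp add: powr_diff)
      show ?thesis unfolding ellipse_kernel_def \<gamma>_def[symmetric] e_def[symmetric] ps power_divide power2_minus
        by (simp add: diff_divide_distrib algebra_simps)
    qed
    finally show ?thesis .
  qed
  have cE: "continuous_on UNIV (\<lambda>\<theta>. f \<theta> * (B * ellipse_kernel s P Q a b \<theta>))"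
    unfolding ellipse_kernel_def
    by (intro continuous_intros f.cont) (use sum_squares_trig_pos[OF ab] in \<open>auto simp: less_le\<close>)
  have B0: "B > 0" unfolding B_def Beta_def using s by (auto intro!: divide_pos_pos mult_pos_pos Gamma_real_pos)
  have "(LINT \<phi>:{-pi..pi}|lborel. h \<phi> * Omega_tilde s f \<phi>) =
      2 * tau (2 - s) / (s - 1) * (LINT \<theta>:{-pi..pi}|lborel. f \<theta> * (B * ellipse_kernel s P Q a b \<theta>))"
    unfolding pairing_Omega_tilde[OF f h s] inner ..
  also have "(LINT \<theta>:{-pi..pi}|lborel. f \<theta> * (B * ellipse_kernel s P Q a b \<theta>)) =
      integral {-pi..pi} (\<lambda>\<theta>. f \<theta> * (B * ellipse_kernel s P Q a b \<theta>))"
    by (intro LINT_Icc_eq_integral continuous_on_subset[OF cE]) auto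
  also have "\<dots> = B * integral {-pi..pi} (\<lambda>\<theta>. f \<theta> * ellipse_kernel s P Q a b \<theta>)"
    by (subst integral_mult_right[symmetric]) (simp add: ac_simps)
  finally have *: "(LINT \<phi>:{-pi..pi}|lborel. h \<phi> * Omega_tilde s f \<phi>) =
      2 * tau (2 - s) / (s - 1) * (B * integral {-pi..pi} (\<lambda>\<theta>. f \<theta> * ellipse_kernel s P Q a b \<theta>))" .
  have "tau s * (R1 s / R2 s) powr (2 + s) * (LINT \<phi>:{-pi..pi}|lborel. h \<phi> * Omega_tilde s f \<phi>) =
      tau s * (R1 s / R2 s) powr (2 + s) * (2 * tau (2 - s) / (s - 1)) * (B * integral {-pi..pi} (\<lambda>\<theta>. f \<theta> * ellipse_kernel s P Q a b \<theta>))"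
    unfolding * by simp
  also have "\<dots> = 1 / (s * pi) * integral {-pi..pi} (\<lambda>\<theta>. f \<theta> * ellipse_kernel s P Q a b \<theta>)"
    unfolding tau_R1_R2_constant[OF s] B_def[symmetric] using B0 by simp
  finally show ?thesis unfolding h_def g_def m_def .
qed

lemma A_coeff_eq:
  assumes "C1_pi_periodic f f'" "0 < s" "s < 1" "a > 0" "b > 0"
  shows "A_coeff s f a b = 1 / (s * pi) * integral {-pi..pi} (\<lambda>\<theta>. f \<theta> * ellipse_kernel s 1 0 a b \<theta>)"
  using angular_coefficient[OF assms, of 1 0] unfolding A_coeff_def by simp

lemma B_coeff_eq:
  assumes "C1_pi_periodic f f'" "0 < s" "s < 1" "a > 0" "b > 0"
  shows "B_coeff s f a b = 1 / (s * pi) * integral {-pi..pi} (\<lambda>\<theta>. f \<theta> * ellipse_kernel s 0 1 a b \<theta>)"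
  using angular_coefficient[OF assms, of 0 1] unfolding B_coeff_def by simp

lemma continuous_on_ellipse_integral:
  fixes a b :: "real \<Rightarrow> real"
  assumes f: "continuous_on UNIV f" and a: "continuous_on I a" and b: "continuous_on I b"
    and pos: "\<And>t. t \<in> I \<Longrightarrow> 0 < a t \<and> 0 < b t"
  shows "continuous_on I (\<lambda>t. integral {-pi..pi} (\<lambda>\<theta>. f \<theta> * ellipse_kernel s P Q (a t) (b t) \<theta>))"
proof -
  have "continuous_on (I \<times> cbox (-pi) pi) (\<lambda>(t, \<theta>). f \<theta> * ellipse_kernel s P Q (a t) (b t) \<theta>)"
    unfolding ellipse_kernel_def case_prod_beta
    by (intro continuous_intros continuous_on_compose2[OF f] continuous_on_compose2[OF a] continuous_on_compose2[OF b])
       (use pos sum_squares_trig_pos in \<open>fastforce simp: less_le\<close>)+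
  from integral_continuous_on_param[OF this] show ?thesis by simp
qed

section \<open>The gradient of the potential\<close>

text \<open>The negative factor is allowed because \<open>\<omega>\<close> has period \<open>\<pi>\<close>. The jump of the argument on the negative
real axis is thereby invisible, as \<open>angle\<close> is only used inside functions of this kind.\<close>

lemma angle_polar:
  fixes \<omega> :: "real \<Rightarrow> real"
  assumes \<omega>: "\<And>x. \<omega> (x + pi) = \<omega> x" and z: "z $ 1 = r * cos \<theta>" "z $ 2 = r * sin \<theta>" and r: "r \<noteq> 0"
  shows "\<omega> (angle z) = \<omega> \<theta>"
proof -
  have pos: "\<omega> (angle z) = \<omega> \<theta>" if z: "z $ 1 = r * cos \<theta>" "z $ 2 = r * sin \<theta>" and r: "r > 0" for r \<theta>
  proof -
    define w where "w = Complex (z $ 1) (z $ 2)"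
    have w: "w = of_real r * cis \<theta>" unfolding w_def using z by (simp add: complex_eq_iff)
    then have w0: "w \<noteq> 0" "norm w = r" using r by (auto simp: norm_mult)
    have "w = of_real (norm w) * exp (\<i> * of_real (Arg w))" using Arg_eq[OF w0(1)] by simp
    then have "of_real r * cis (Arg w) = of_real r * cis \<theta>"
      using w w0 by (simp add: cis_conv_exp)
    then have "cis (Arg w) = cis \<theta>" using r by simp
    then have "sin (Arg w) = sin \<theta> \<and> cos (Arg w) = cos \<theta>" by (simp add: complex_eq_iff)
    then obtain n :: int where n: "Arg w = \<theta> + 2 * pi * n" unfolding sin_cos_eq_iff by blast
    have "\<omega> (\<theta> + of_int (2 * n) * pi) = \<omega> \<theta>" by (rule periodic_add_of_int) (rule \<omega>)
    then show ?thesis unfolding angle_def w_def[symmetric] n by (simp add: algebra_simps)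
  qed
  show ?thesis
  proof (cases "r > 0")
    case True
    then show ?thesis using pos z by blast
  next
    case False
    then have "\<omega> (angle z) = \<omega> (\<theta> + pi)" using r z by (intro pos[of "- r"]) auto
    then show ?thesis using \<omega> by simp
  qed
qed

lemma norm_R2: "(norm (z :: real^2))\<^sup>2 = (z $ 1)\<^sup>2 + (z $ 2)\<^sup>2"
  by (simp add: norm_vec_def L2_set_def UNIV_2)

definition perp :: "real^2 \<Rightarrow> real^2" where "perp z = vector [- z $ 2, z $ 1]"

lemma inner_R2: "(x :: real^2) \<bullet> y = x $ 1 * y $ 1 + x $ 2 * y $ 2"
  by (simp add: inner_vec_def UNIV_2)

text \<open>In the half-plane around \<open>z0\<close> the angle may be replaced by a differentiable function. This gives
continuity and the gradient at every point other than the origin without treating the cut of the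
argument separately.\<close>

lemma angle_local:
  fixes z z0 :: "real^2" and \<omega> :: "real \<Rightarrow> real"
  assumes \<omega>: "\<And>x. \<omega> (x + pi) = \<omega> x" and z: "z \<bullet> z0 > 0"
  shows "\<omega> (angle z) = \<omega> (angle z0 + arctan ((z \<bullet> perp z0) / (z \<bullet> z0)))"
proof -
  have z0: "z0 \<noteq> 0" using z by auto
  define r0 where "r0 = norm z0"
  have r0: "r0 > 0" using z0 by (simp add: r0_def)
  have r02: "r0\<^sup>2 = (z0 $ 1)\<^sup>2 + (z0 $ 2)\<^sup>2" unfolding r0_def by (rule norm_R2)
  define \<theta> where "\<theta> = angle z0"
  have c0: "z0 $ 1 = r0 * cos \<theta>" "z0 $ 2 = r0 * sin \<theta>"
  proof -
    define w where "w = Complex (z0 $ 1) (z0 $ 2)"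
    have "(norm w)\<^sup>2 = r0\<^sup>2" unfolding r02 w_def by (simp add: complex_norm)
    then have w: "norm w = r0" using r0 by (simp add: power2_eq_iff_nonneg)
    then have "w \<noteq> 0" using r0 by auto
    then have "w = of_real r0 * exp (\<i> * of_real (Arg w))" using Arg_eq[of w] w by simp
    then have "w = of_real r0 * cis \<theta>" unfolding \<theta>_def angle_def w_def by (simp add: cis_conv_exp)
    then show "z0 $ 1 = r0 * cos \<theta>" "z0 $ 2 = r0 * sin \<theta>" by (simp_all add: w_def complex_eq_iff)
  qed
  define A where "A = z \<bullet> z0"
  define B where "B = z \<bullet> perp z0"
  define q where "q = B / A"
  have A: "A > 0" using z A_def by simp
  have sq: "sqrt (1 + q\<^sup>2) > 0" by (simp add: add_pos_nonneg)
  have ca: "sqrt (1 + q\<^sup>2) * cos (arctan q) = 1" "sqrt (1 + q\<^sup>2) * sin (arctan q) = q"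
    using sq by (simp_all add: cos_arctan sin_arctan)
  define r where "r = A / r0 * sqrt (1 + q\<^sup>2)"
  have rc: "r * cos (\<theta> + arctan q) = A / r0 * (cos \<theta> * (sqrt (1 + q\<^sup>2) * cos (arctan q)) - sin \<theta> * (sqrt (1 + q\<^sup>2) * sin (arctan q)))"
    unfolding r_def cos_add by (simp add: algebra_simps)
  have rs: "r * sin (\<theta> + arctan q) = A / r0 * (sin \<theta> * (sqrt (1 + q\<^sup>2) * cos (arctan q)) + cos \<theta> * (sqrt (1 + q\<^sup>2) * sin (arctan q)))"
    unfolding r_def sin_add by (simp add: algebra_simps)
  have Aq: "A * q = B" using A by (simp add: q_def)
  have AB: "A = r0 * (z $ 1 * cos \<theta> + z $ 2 * sin \<theta>)" "B = r0 * (- z $ 1 * sin \<theta> + z $ 2 * cos \<theta>)"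
    unfolding A_def B_def inner_R2 perp_def by (simp_all add: c0 algebra_simps)
  have "r * cos (\<theta> + arctan q) = (A * cos \<theta> - B * sin \<theta>) / r0"
    unfolding rc ca using Aq by (simp add: field_simps)
  also have "\<dots> = z $ 1 * ((sin \<theta>)\<^sup>2 + (cos \<theta>)\<^sup>2)"
    unfolding AB using r0 by (simp add: field_simps power2_eq_square del: sin_cos_squared_add3)
  also have "\<dots> = z $ 1" by simp
  finally have 1: "z $ 1 = r * cos (\<theta> + arctan q)" ..
  have "r * sin (\<theta> + arctan q) = (A * sin \<theta> + B * cos \<theta>) / r0"
    unfolding rs ca using Aq by (simp add: field_simps)
  also have "\<dots> = z $ 2 * ((sin \<theta>)\<^sup>2 + (cos \<theta>)\<^sup>2)"
    unfolding AB using r0 by (simp add: field_simps power2_eq_square del: sin_cos_squared_add3)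
  also have "\<dots> = z $ 2" by simp
  finally have 2: "z $ 2 = r * sin (\<theta> + arctan q)" ..
  have "r \<noteq> 0" unfolding r_def using A r0 sq by simp
  from angle_polar[where \<omega> = \<omega>, OF \<omega> 1 2 this] show ?thesis unfolding \<theta>_def q_def A_def B_def .
qed

lemma continuous_on_angle:
  fixes \<omega> :: "real \<Rightarrow> real"
  assumes \<omega>: "\<And>x. \<omega> (x + pi) = \<omega> x" and c: "continuous_on UNIV \<omega>"
  shows "continuous_on (- {0}) (\<lambda>z. \<omega> (angle z))"
proof (rule continuous_at_imp_continuous_on, rule ballI)
  fix z0 :: "real^2" assume "z0 \<in> - {0}"
  then have z0: "z0 \<bullet> z0 > 0" by simp
  have "isCont (\<lambda>z. \<omega> (angle z0 + arctan ((z \<bullet> perp z0) / (z \<bullet> z0)))) z0"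
  proof (rule isCont_o2[where g = \<omega>])
    show "isCont (\<lambda>z. angle z0 + arctan ((z \<bullet> perp z0) / (z \<bullet> z0))) z0"
      using z0 by (intro continuous_intros) auto
    show "isCont \<omega> y" for y using c by (simp add: continuous_on_eq_continuous_at)
  qed
  moreover have "\<forall>\<^sub>F z in nhds z0. z \<bullet> z0 > 0"
    using z0 by (intro eventually_nhds_in_open[of "{z. z \<bullet> z0 > 0}", simplified] open_Collect_less continuous_intros)
  then have "\<forall>\<^sub>F z in nhds z0. \<omega> (angle z) = \<omega> (angle z0 + arctan ((z \<bullet> perp z0) / (z \<bullet> z0)))"
    by eventually_elim (intro angle_local \<omega>)
  ultimately show "isCont (\<lambda>z. \<omega> (angle z)) z0" by (simp add: isCont_cong)
qed

lemma bounded_periodic: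
  assumes "\<And>x. \<omega> (x + pi) = \<omega> x" "continuous_on UNIV (\<omega> :: real \<Rightarrow> real)"
  obtains M where "\<And>x. \<bar>\<omega> x\<bar> \<le> M"
proof -
  have "bounded (\<omega> ` {0..pi})"
    by (intro compact_imp_bounded compact_continuous_image continuous_on_subset[OF assms(2)]) auto
  then obtain M where M: "\<forall>z\<in>\<omega> ` {0..pi}. \<bar>z\<bar> \<le> M" unfolding bounded_real by blast
  show ?thesis
  proof
    fix x
    define n where "n = \<lfloor>x / pi\<rfloor>"
    have "of_int n \<le> x / pi" "x / pi < of_int n + 1" unfolding n_def by linarith+
    then have "x + of_int (- n) * pi \<in> {0..pi}" by (auto simp: field_simps)
    then have "\<bar>\<omega> (x + of_int (- n) * pi)\<bar> \<le> M" using M by blast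
    then show "\<bar>\<omega> x\<bar> \<le> M" using periodic_add_of_int[of \<omega> pi x "- n"] assms(1) by simp
  qed
qed

lemma norm_perp: "norm (perp z) = norm z"
proof -
  have "(norm (perp z))\<^sup>2 = (norm z)\<^sup>2" unfolding norm_R2 by (simp add: perp_def)
  then show ?thesis by (simp add: power2_eq_iff_nonneg)
qed

context C1_pi_periodic begin

text \<open>The gradient of \<open>|z|\<^sup>-\<^sup>s f(angle z)\<close> away from the origin.\<close>

definition force :: "real \<Rightarrow> real^2 \<Rightarrow> real^2" where
  "force s z = norm z powr (- s - 2) *\<^sub>R (f' (angle z) *\<^sub>R perp z - (s * f (angle z)) *\<^sub>R z)"

lemma GDERIV_potential:
  assumes z0: "z0 \<noteq> 0"
  shows "GDERIV (potential s f) z0 :> force s z0 + 2 *\<^sub>R z0"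
proof -
  have zz: "z0 \<bullet> z0 > 0" using z0 by simp
  define n where "n = norm z0"
  have n: "n > 0" "z0 \<bullet> z0 = n\<^sup>2" using z0 by (auto simp: n_def power2_norm_eq_inner)
  define q where "q z = (z \<bullet> perp z0) * inverse (z \<bullet> z0)" for z
  have pp: "z0 \<bullet> perp z0 = 0" by (simp add: inner_R2 perp_def)
  have lin: "GDERIV (\<lambda>z. z \<bullet> w) z :> w" for w z :: "real^2"
    unfolding gderiv_def by (auto intro!: derivative_eq_intros)
  have "GDERIV q z0 :> (1 / n\<^sup>2) *\<^sub>R perp z0"
    unfolding q_def[abs_def]
    by (rule GDERIV_subst[OF GDERIV_mult[OF lin GDERIV_inverse[OF lin]]])
       (use zz n pp in \<open>auto simp: divide_inverse\<close>)
  moreover have "((\<lambda>x. f (angle z0 + arctan x)) has_real_derivative f' (angle z0)) (at (q z0))"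
  proof -
    have "q z0 = 0" by (simp add: q_def pp)
    moreover have "((\<lambda>x. angle z0 + arctan x) has_real_derivative 1) (at 0)"
      by (auto intro!: derivative_eq_intros)
    from DERIV_chain2[OF _ this, of f "f' (angle z0)"] der
    have "((\<lambda>x. f (angle z0 + arctan x)) has_real_derivative f' (angle z0)) (at 0)" by simp
    ultimately show ?thesis by simp
  qed
  ultimately have 1: "GDERIV (\<lambda>z. f (angle z0 + arctan (q z))) z0 :> f' (angle z0) *\<^sub>R ((1 / n\<^sup>2) *\<^sub>R perp z0)"
    by (rule GDERIV_DERIV_compose)
  have 2: "GDERIV (\<lambda>z. norm z powr (- s)) z0 :> (- s * n powr (- s - 1)) *\<^sub>R sgn z0"
    by (rule GDERIV_DERIV_compose[OF GDERIV_norm[OF z0]])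
       (use n in \<open>auto intro!: derivative_eq_intros simp: n_def\<close>)
  have 3: "GDERIV (\<lambda>z. (norm z)\<^sup>2) z0 :> (2 * n) *\<^sub>R sgn z0"
    by (rule GDERIV_DERIV_compose[OF GDERIV_norm[OF z0]])
       (use n in \<open>auto intro!: derivative_eq_intros simp: n_def\<close>)
  have sg: "sgn z0 = (1 / n) *\<^sub>R z0" by (simp add: sgn_div_norm n_def divide_inverse)
  have p: "n powr (- s - 2) = n powr (- s) / n\<^sup>2" "n powr (- s - 1) = n powr (- s) / n" using n by (simp_all add: powr_diff)
  have "GDERIV (\<lambda>z. norm z powr (- s) * f (angle z0 + arctan (q z)) + (norm z)\<^sup>2) z0 :> force s z0 + 2 *\<^sub>R z0"
  proof (rule GDERIV_subst[OF GDERIV_add[OF GDERIV_mult[OF 2 1] 3]])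
    show "norm z0 powr - s *\<^sub>R f' (angle z0) *\<^sub>R (1 / n\<^sup>2) *\<^sub>R perp z0 +
        f (angle z0 + arctan (q z0)) *\<^sub>R (- s * n powr (- s - 1)) *\<^sub>R sgn z0 + (2 * n) *\<^sub>R sgn z0
        = force s z0 + 2 *\<^sub>R z0"
      unfolding force_def n_def[symmetric] sg p using n
      by (simp add: q_def pp scaleR_diff_right power2_eq_square field_simps)
  qed
  then show ?thesis
    unfolding gderiv_def
  proof (rule has_derivative_transform_within_open)
    show "open {z. z \<bullet> z0 > 0}" by (intro open_Collect_less continuous_intros)
    show "z0 \<in> {z. z \<bullet> z0 > 0}" using zz by simp
    fix z assume "z \<in> {z. z \<bullet> z0 > 0}"
    then have "f (angle z) = f (angle z0 + arctan ((z \<bullet> perp z0) / (z \<bullet> z0)))"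
      by (intro angle_local per) simp
    then show "norm z powr - s * f (angle z0 + arctan (q z)) + (norm z)\<^sup>2 = potential s f z"
      by (simp add: potential_def q_def divide_inverse)
  qed
qed

lemma grad_potential:
  assumes z: "z \<noteq> 0"
  shows "grad (potential s f) z = force s z + 2 *\<^sub>R z"
  unfolding grad_def
proof (rule the_equality)
  show "GDERIV (potential s f) z :> force s z + 2 *\<^sub>R z" by (rule GDERIV_potential[OF z])
  fix D assume "GDERIV (potential s f) z :> D"
  then have "(\<lambda>h. h \<bullet> D) = (\<lambda>h. h \<bullet> (force s z + 2 *\<^sub>R z))"
    using GDERIV_potential[OF z, of s] unfolding gderiv_def by (rule has_derivative_unique)
  then have "h \<bullet> D = h \<bullet> (force s z + 2 *\<^sub>R z)" for h by (rule fun_cong)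
  then show "D = force s z + 2 *\<^sub>R z" using vector_eq_ldot by blast
qed

lemma force_measurable [measurable]: "force s \<in> borel_measurable borel"
proof (rule borel_measurable_continuous_countable_exceptions[of "{0}"])
  have "continuous_on UNIV (perp :: real^2 \<Rightarrow> real^2)"
  proof -
    have "perp z = (- z $ 2) *\<^sub>R axis 1 1 + (z $ 1) *\<^sub>R axis 2 1" for z
      by (simp add: perp_def vec_eq_iff forall_2 axis_def)
    then show ?thesis unfolding perp_def[abs_def] by (simp) (intro continuous_intros)
  qed
  then have "continuous_on (- {0}) (perp :: real^2 \<Rightarrow> real^2)" by (rule continuous_on_subset) simp
  moreover have "continuous_on (- {0}) (\<lambda>z. f (angle z))"
    by (rule continuous_on_angle[where \<omega> = f, OF per cont])
  moreover have "continuous_on (- {0}) (\<lambda>z. f' (angle z))"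
    by (rule continuous_on_angle[where \<omega> = f', OF per' cont'])
  ultimately show "continuous_on (- {0}) (force s)"
    unfolding force_def[abs_def] by (intro continuous_intros) auto
qed auto

lemma norm_force_le:
  obtains M where "M \<ge> 0" "\<And>z. norm (force s z) \<le> M * norm z powr (- s - 1)"
proof -
  obtain M1 where M1: "\<And>x. \<bar>f x\<bar> \<le> M1" using bounded_periodic[OF per cont] by blast
  obtain M2 where M2: "\<And>x. \<bar>f' x\<bar> \<le> M2" using bounded_periodic[OF per' cont'] by blast
  have "M1 \<ge> 0" "M2 \<ge> 0" using M1[of 0] M2[of 0] by auto
  show ?thesis
  proof
    show "M2 + \<bar>s\<bar> * M1 \<ge> 0" using \<open>M1 \<ge> 0\<close> \<open>M2 \<ge> 0\<close> by simp
    fix z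
    show "norm (force s z) \<le> (M2 + \<bar>s\<bar> * M1) * norm z powr (- s - 1)"
    proof (cases "z = 0")
      case False
      have "norm (f' (angle z) *\<^sub>R perp z - (s * f (angle z)) *\<^sub>R z) \<le> \<bar>f' (angle z)\<bar> * norm z + \<bar>s\<bar> * \<bar>f (angle z)\<bar> * norm z"
        by (rule order.trans[OF norm_triangle_ineq4]) (simp add: norm_perp abs_mult)
      also have "\<dots> \<le> M2 * norm z + \<bar>s\<bar> * M1 * norm z"
        by (intro add_mono mult_right_mono mult_left_mono M1 M2) auto
      also have "\<dots> = (M2 + \<bar>s\<bar> * M1) * norm z" by (simp add: algebra_simps)
      finally have "norm (force s z) \<le> norm z powr (- s - 2) * ((M2 + \<bar>s\<bar> * M1) * norm z)"
        unfolding force_def by (simp add: mult_left_mono)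
      also have "\<dots> = (M2 + \<bar>s\<bar> * M1) * norm z powr (- s - 1)"
        using False by (simp add: powr_diff power2_eq_square)
      finally show ?thesis .
    qed (simp add: force_def perp_def)
  qed
qed

end

section \<open>Integration in the plane\<close>

lemma vector2_eta: "vector [z $ 1, z $ 2] = (z :: real^2)"
  by (simp add: vec_eq_iff forall_2)

lemma continuous_on_vector2 [continuous_intros]:
  fixes f g :: "'a::topological_space \<Rightarrow> real"
  assumes "continuous_on S f" "continuous_on S g"
  shows "continuous_on S (\<lambda>x. vector [f x, g x] :: real^2)"
proof -
  have "(vector [f x, g x] :: real^2) = f x *\<^sub>R axis 1 1 + g x *\<^sub>R axis 2 1" for x
    by (simp add: vec_eq_iff forall_2 axis_def)
  then show ?thesis using assms by (simp only:) (intro continuous_intros)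
qed

lemma measurable_vector2 [measurable]:
  "(\<lambda>p. vector [fst p, snd p] :: real^2) \<in> borel_measurable (lborel \<Otimes>\<^sub>M lborel)"
proof -
  have "continuous_on UNIV (\<lambda>p :: real \<times> real. vector [fst p, snd p] :: real^2)"
    by (intro continuous_intros)
  then show ?thesis by (simp add: lborel_prod borel_measurable_continuous_onI)
qed

text \<open>Planar integrals are reduced to iterated ones through this identification of the two Lebesgue measures.\<close>

lemma lborel_R2_eq_distr:
  "(lborel :: (real^2) measure) = distr (lborel \<Otimes>\<^sub>M lborel) borel (\<lambda>p. vector [fst p, snd p])"
proof (rule lborel_eqI)
  fix l u :: "real^2" assume le: "\<And>b. b \<in> Basis \<Longrightarrow> l \<bullet> b \<le> u \<bullet> b"
  have B: "(Basis :: (real^2) set) = {axis 1 1, axis 2 1}" by (auto simp: Basis_vec_def UNIV_2)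
  have ne: "(axis 1 1 :: real^2) \<noteq> axis 2 1" by (simp add: axis_eq_axis)
  have lu: "l $ 1 \<le> u $ 1" "l $ 2 \<le> u $ 2"
    using le[of "axis 1 1"] le[of "axis 2 1"] by (auto simp: B inner_axis)
  have "(\<lambda>p. vector [fst p, snd p]) -` box l u \<inter> space (lborel \<Otimes>\<^sub>M lborel) =
      {l $ 1<..<u $ 1} \<times> {l $ 2<..<u $ 2}"
    by (auto simp: mem_box_cart forall_2 space_pair_measure)
  then have "emeasure (distr (lborel \<Otimes>\<^sub>M lborel) borel (\<lambda>p. vector [fst p, snd p])) (box l u) =
      emeasure (lborel \<Otimes>\<^sub>M lborel) ({l $ 1<..<u $ 1} \<times> {l $ 2<..<u $ 2})"
    by (subst emeasure_distr) auto
  also have "\<dots> = ennreal ((u $ 1 - l $ 1) * (u $ 2 - l $ 2))"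
    using lu by (simp add: lborel.emeasure_pair_measure_Times ennreal_mult')
  also have "(u $ 1 - l $ 1) * (u $ 2 - l $ 2) = (\<Prod>b\<in>Basis. (u - l) \<bullet> b)"
    unfolding B using ne by (simp add: inner_axis)
  finally show "emeasure (distr (lborel \<Otimes>\<^sub>M lborel) borel (\<lambda>p. vector [fst p, snd p])) (box l u) =
      (\<Prod>b\<in>Basis. (u - l) \<bullet> b)" .
qed simp

lemma
  fixes f :: "real^2 \<Rightarrow> real"
  assumes f: "f \<in> borel_measurable borel"
  shows integrable_R2_iff: "integrable lborel f \<longleftrightarrow> integrable (lborel \<Otimes>\<^sub>M lborel) (\<lambda>p. f (vector [fst p, snd p]))"
    and integral_R2_eq: "(LINT z|lborel. f z) = (LINT p|(lborel \<Otimes>\<^sub>M lborel). f (vector [fst p, snd p]))"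
  by (subst lborel_R2_eq_distr, subst integrable_distr_eq integral_distr; use f in simp)+

lemma
  fixes f :: "'a::euclidean_space \<Rightarrow> 'b::{banach, second_countable_topology}"
  assumes f: "f \<in> borel_measurable borel"
  shows integrable_reflect: "integrable lborel (\<lambda>z. f (x - z)) \<longleftrightarrow> integrable lborel f"
    and integral_reflect_translate: "(LINT z|lborel. f (x - z)) = (LINT z|lborel. f z)"
proof -
  have e: "lborel = distr lborel borel (\<lambda>z::'a. x - z)"
    using lborel_affine[of "- 1" x] by (simp add: density_1)
  show "integrable lborel (\<lambda>z. f (x - z)) \<longleftrightarrow> integrable lborel f"
    by (subst (2) e, subst integrable_distr_eq) (use f in auto)
  show "(LINT z|lborel. f (x - z)) = (LINT z|lborel. f z)"
    by (subst (2) e, subst integral_distr) (use f in auto)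
qed

lemma
  fixes f :: "real^2 \<Rightarrow> 'b::{banach, second_countable_topology}"
  assumes f: "f \<in> borel_measurable borel" and ab: "a > 0" "b > 0"
  shows integrable_R2_scale: "integrable lborel (\<lambda>z::real^2. f (vector [a * z $ 1, b * z $ 2])) \<longleftrightarrow> integrable lborel f"
    and integral_R2_scale: "(LINT z|lborel. f z) = (a * b) *\<^sub>R (LINT z::real^2|lborel. f (vector [a * z $ 1, b * z $ 2]))"
proof -
  define c where "c j = (if j = axis 1 1 then a else b)" for j :: "real^2"
  have B: "(Basis :: (real^2) set) = {axis 1 1, axis 2 1}" by (auto simp: Basis_vec_def UNIV_2)
  have ne: "(axis 1 1 :: real^2) \<noteq> axis 2 1" by (simp add: axis_eq_axis)
  have T: "(\<Sum>j\<in>Basis. (c j * (x \<bullet> j)) *\<^sub>R j) = (vector [a * x $ 1, b * x $ 2] :: real^2)" for x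
    unfolding B using ne by (simp add: c_def inner_axis vec_eq_iff forall_2) (simp add: axis_def)
  have P: "(\<Prod>j\<in>Basis. \<bar>c j\<bar>) = a * b" unfolding B using ne ab by (simp add: c_def)
  have m: "(\<lambda>x::real^2. vector [a * x $ 1, b * x $ 2] :: real^2) \<in> borel_measurable borel"
    by (intro borel_measurable_continuous_onI continuous_intros)
  have e: "lborel = density (distr lborel borel (\<lambda>x::real^2. vector [a * x $ 1, b * x $ 2] :: real^2)) (\<lambda>_. ennreal (a * b))"
    using lborel_affine_euclidean[of c 0] ab unfolding T P by (simp add: c_def)
  show "integrable lborel (\<lambda>z::real^2. f (vector [a * z $ 1, b * z $ 2])) \<longleftrightarrow> integrable lborel f"
  proof -
    have "integrable lborel f \<longleftrightarrow> integrable lborel (\<lambda>z::real^2. (a * b) *\<^sub>R f (vector [a * z $ 1, b * z $ 2]))"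
      by (subst e, subst integrable_density, use f ab in simp_all, subst integrable_distr_eq)
         (use m f ab in \<open>auto\<close>)
    moreover have "integrable lborel (\<lambda>z::real^2. f (vector [a * z $ 1, b * z $ 2]))"
      if "integrable lborel (\<lambda>z::real^2. (a * b) *\<^sub>R f (vector [a * z $ 1, b * z $ 2]))"
      using integrable_scaleR_right[OF that, of "1 / (a * b)"] ab by simp
    ultimately show ?thesis by auto
  qed
  show "(LINT z|lborel. f z) = (a * b) *\<^sub>R (LINT z::real^2|lborel. f (vector [a * z $ 1, b * z $ 2]))"
    by (subst e, subst integral_density, use f ab in simp_all, subst integral_distr)
       (use m f ab in \<open>auto\<close>)
qed

text \<open>Integration over the lines through the origin, parametrised by their slope \<open>m\<close>. It plays the role of
polar coordinates, but needs only Fubini's theorem and the affine substitution \<open>y = t m\<close> for fixed \<open>t\<close>.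
Both orientations of a line are covered by the sign of \<open>t\<close>.\<close>

lemma
  fixes f :: "real \<times> real \<Rightarrow> real"
  assumes f: "integrable (lborel \<Otimes>\<^sub>M lborel) f"
  shows integrable_shear: "integrable (lborel \<Otimes>\<^sub>M lborel) (\<lambda>p. \<bar>fst p\<bar> * f (fst p, fst p * snd p))"
    and integral_shear: "(LINT p|(lborel \<Otimes>\<^sub>M lborel). f p) = (LINT m|lborel. (LINT t|lborel. \<bar>t\<bar> * f (t, t * m)))"
proof -
  note [measurable] = borel_measurable_integrable[OF f]
  have sub: "(LINT m|lborel. \<bar>t\<bar> * h (t * m)) = (LINT y|lborel. h y)" if "t \<noteq> 0" for t :: real and h :: "real \<Rightarrow> real"
    using lborel_integral_real_affine[OF that, of h 0] by simp
  have AE0: "AE t in lborel. t \<noteq> (0::real)" by (rule AE_lborel_singleton)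
  have m: "(\<lambda>p. \<bar>fst p\<bar> * f (fst p, fst p * snd p)) \<in> borel_measurable (lborel \<Otimes>\<^sub>M lborel)" by measurable
  show i: "integrable (lborel \<Otimes>\<^sub>M lborel) (\<lambda>p. \<bar>fst p\<bar> * f (fst p, fst p * snd p))"
  proof (rule lborel_pair.Fubini_integrable[OF m])
    have "integrable lborel (\<lambda>t. LINT y|lborel. norm (f (t, y)))"
      by (rule lborel_pair.integrable_fst) (use integrable_abs[OF f] in \<open>simp add: case_prod_beta'\<close>)
    then show "integrable lborel (\<lambda>t. LINT m|lborel. norm (\<bar>fst (t, m)\<bar> * f (fst (t, m), fst (t, m) * snd (t, m))))"
    proof (rule integrable_cong_AE_imp)
      show "AE t in lborel. (LINT y|lborel. norm (f (t, y))) = (LINT m|lborel. norm (\<bar>fst (t, m)\<bar> * f (fst (t, m), fst (t, m) * snd (t, m))))"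
        using AE0
      proof eventually_elim
        case (elim t)
        then show ?case using sub[of t "\<lambda>y. norm (f (t, y))"] by (simp add: abs_mult)
      qed
    qed measurable
    have "AE t in lborel. integrable lborel (\<lambda>y. f (t, y))"
      using lborel_pair.AE_integrable_fst[of "\<lambda>t y. f (t, y)"] f by simp
    then show "AE t in lborel. integrable lborel (\<lambda>m. \<bar>fst (t, m)\<bar> * f (fst (t, m), fst (t, m) * snd (t, m)))"
      using AE0
    proof eventually_elim
      case (elim t)
      then show ?case using lborel_integrable_real_affine[of "\<lambda>y. f (t, y)" t 0] by simp
    qed
  qed
  have "(LINT p|(lborel \<Otimes>\<^sub>M lborel). f p) = (LINT t|lborel. LINT y|lborel. f (t, y))"
    using lborel_pair.integral_fst[of "\<lambda>t y. f (t, y)"] f by simp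
  also have "\<dots> = (LINT t|lborel. LINT m|lborel. \<bar>t\<bar> * f (t, t * m))"
  proof (rule integral_cong_AE)
    show "AE t in lborel. (LINT y|lborel. f (t, y)) = (LINT m|lborel. \<bar>t\<bar> * f (t, t * m))"
      using AE0
    proof eventually_elim
      case (elim t)
      then show ?case using sub[of t "\<lambda>y. f (t, y)"] by simp
    qed
  qed measurable
  also have "\<dots> = (LINT m|lborel. (LINT t|lborel. \<bar>t\<bar> * f (t, t * m)))"
  proof (rule lborel_pair.Fubini_integral[symmetric])
    show "integrable (lborel \<Otimes>\<^sub>M lborel) (\<lambda>(t, m). \<bar>t\<bar> * f (t, t * m))"
      using i by (simp add: case_prod_beta')
  qed
  finally show "(LINT p|(lborel \<Otimes>\<^sub>M lborel). f p) = (LINT m|lborel. (LINT t|lborel. \<bar>t\<bar> * f (t, t * m)))" .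
qed

section \<open>The force of an elliptic density\<close>

lemma integrable_abs_powr_Icc:
  fixes \<sigma> N :: real
  assumes "\<sigma> < 1" "N \<ge> 0"
  shows "integrable lborel (\<lambda>t. indicator {-N..N} t * \<bar>t\<bar> powr (- \<sigma>))"
proof -
  have "(\<lambda>t. t powr (- \<sigma>)) absolutely_integrable_on {0..N}"
    using assms by (intro nonnegative_absolutely_integrable_1 integrable_on_powr_from_0) auto
  then have 1: "integrable lborel (\<lambda>t. indicator {0..N} t * t powr (- \<sigma>))"
    by (intro lborel_integral_of_absolutely_integrable(1)) auto
  have 2: "integrable lborel (\<lambda>t. indicator {0..N} (- t) * (- t) powr (- \<sigma>))"
    using lborel_integrable_real_affine[OF 1, of "- 1" 0] by simp
  have "(\<lambda>t. indicator {-N..N} t * \<bar>t\<bar> powr (- \<sigma>)) =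
      (\<lambda>t. indicator {0..N} t * t powr (- \<sigma>) + indicator {0..N} (- t) * (- t) powr (- \<sigma>))"
    by (auto simp: fun_eq_iff indicator_def abs_if)
  then show ?thesis using 1 2 by simp
qed

lemma AE_component_neq_0:
  "AE z in (lborel :: (real^2) measure). z $ k \<noteq> 0"
proof -
  have "{z :: real^2. z $ k = 0} \<in> null_sets lebesgue"
    using negligible_standard_hyperplane_cart[of k] negligible_iff_null_sets by blast
  then have "AE z in lebesgue. z \<notin> {z :: real^2. z $ k = 0}" by (rule AE_not_in)
  then show ?thesis by (simp add: AE_completion_iff)
qed

text \<open>A kernel of homogeneity \<open>- s - 1 > - 2\<close> is locally integrable: because \<open>|z\<^sub>1| |z\<^sub>2| \<le> |z|\<^sup>2\<close>, it is
dominated off the axes by a product of functions \<open>|z\<^sub>i| powr (- (s + 1)/2)\<close> of one variable.\<close>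

lemma integrable_convolution_homogeneous:
  fixes \<rho> :: "real^2 \<Rightarrow> real" and G :: "real^2 \<Rightarrow> real^2"
  assumes s: "0 < s" "s < 1"
    and G [measurable]: "G \<in> borel_measurable borel" and GM: "\<And>z. norm (G z) \<le> M * norm z powr (- s - 1)"
    and \<rho> [measurable]: "\<rho> \<in> borel_measurable borel" and \<rho>C: "\<And>y. \<bar>\<rho> y\<bar> \<le> C" and \<rho>0: "\<And>y. norm y > N \<Longrightarrow> \<rho> y = 0"
  shows "integrable lborel (\<lambda>y. \<rho> y *\<^sub>R G (x - y))"
proof -
  define \<sigma> where "\<sigma> = (s + 1) / 2"
  define L where "L = norm x + \<bar>N\<bar>"
  define k where "k t = indicator {-L..L} t * \<bar>t\<bar> powr (- \<sigma>)" for t :: real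
  have "integrable lborel k"
    unfolding k_def[abs_def] using s by (intro integrable_abs_powr_Icc) (auto simp: \<sigma>_def L_def)
  then have "integrable (lborel \<Otimes>\<^sub>M lborel) (\<lambda>p. k (fst p) * k (snd p))"
    using integrable_mult_pair[of k k] by (simp add: case_prod_beta')
  moreover have mk: "(\<lambda>z :: real^2. k (z $ 1) * k (z $ 2)) \<in> borel_measurable borel"
  proof -
    have [measurable]: "k \<in> borel_measurable borel" unfolding k_def[abs_def] by measurable
    have [measurable]: "(\<lambda>z :: real^2. z $ i) \<in> borel_measurable borel" for i
      by (intro borel_measurable_continuous_onI continuous_intros)
    show ?thesis by measurable
  qed
  ultimately have "integrable lborel (\<lambda>z :: real^2. k (z $ 1) * k (z $ 2))"
    by (subst integrable_R2_iff) simp_all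
  then have i: "integrable lborel (\<lambda>z :: real^2. C * M * (k (z $ 1) * k (z $ 2)))" by simp
  have C0: "C \<ge> 0" using \<rho>C[of 0] by simp
  have M0: "M \<ge> 0"
  proof -
    have "0 \<le> M * norm (axis 1 1 :: real^2) powr (- s - 1)" using GM[of "axis 1 1"] norm_ge_zero order.trans by blast
    then show ?thesis by simp
  qed
  have "integrable lborel (\<lambda>z. \<rho> (x - z) *\<^sub>R G z)"
  proof (rule Bochner_Integration.integrable_bound[OF i])
    show "(\<lambda>z. \<rho> (x - z) *\<^sub>R G z) \<in> borel_measurable lborel" by measurable
    show "AE z in lborel. norm (\<rho> (x - z) *\<^sub>R G z) \<le> norm (C * M * (k (z $ 1) * k (z $ 2)))"
      using AE_component_neq_0[of 1] AE_component_neq_0[of 2]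
    proof eventually_elim
      case (elim z)
      show ?case
      proof (cases "norm (x - z) > N")
        case True
        then show ?thesis using \<rho>0 by simp
      next
        case False
        then have nz: "norm z \<le> L" unfolding L_def using norm_triangle_ineq2[of z x] by (simp add: norm_minus_commute)
        have c: "\<bar>z $ 1\<bar> \<le> norm z" "\<bar>z $ 2\<bar> \<le> norm z" by (rule component_le_norm_cart)+
        then have kk: "k (z $ 1) * k (z $ 2) = (\<bar>z $ 1\<bar> * \<bar>z $ 2\<bar>) powr (- \<sigma>)"
          using nz by (auto simp: k_def indicator_def powr_mult)
        have "2 * (- \<sigma>) = - s - 1" unfolding \<sigma>_def by (simp add: field_simps)
        then have "norm z powr (- s - 1) = (norm z powr 2) powr (- \<sigma>)" by (simp only: powr_powr)
        also have "\<dots> \<le> (\<bar>z $ 1\<bar> * \<bar>z $ 2\<bar>) powr (- \<sigma>)"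
        proof (rule powr_mono2')
          have "\<bar>z $ 1\<bar> * \<bar>z $ 2\<bar> \<le> norm z * norm z" using c by (intro mult_mono) auto
          then show "\<bar>z $ 1\<bar> * \<bar>z $ 2\<bar> \<le> norm z powr 2"
            by (simp add: power2_eq_square)
        qed (use elim s in \<open>auto simp: \<sigma>_def\<close>)
        finally have "norm z powr (- s - 1) \<le> k (z $ 1) * k (z $ 2)" unfolding kk .
        then have "M * norm z powr (- s - 1) \<le> M * (k (z $ 1) * k (z $ 2))" using M0 by (rule mult_left_mono)
        then have "norm (G z) \<le> M * (k (z $ 1) * k (z $ 2))" using GM[of z] by simp
        then have "\<bar>\<rho> (x - z)\<bar> * norm (G z) \<le> C * (M * (k (z $ 1) * k (z $ 2)))"
          using \<rho>C C0 by (intro mult_mono) auto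
        then show ?thesis by simp
      qed
    qed
  qed
  moreover have "(\<lambda>y. \<rho> y *\<^sub>R G (x - y)) \<in> borel_measurable borel" by measurable
  ultimately show ?thesis using integrable_reflect[of "\<lambda>y. \<rho> y *\<^sub>R G (x - y)" x] by simp
qed

lemma rho_ab_eq:
  assumes "a > 0" "b > 0"
  shows "rho_ab s a b y = C2 s / (a * b) * max 0 ((R2 s)\<^sup>2 - ((y $ 1)\<^sup>2 / a\<^sup>2 + (y $ 2)\<^sup>2 / b\<^sup>2)) powr (s / 2)"
  unfolding rho_ab_def rho2_def norm_R2 by (simp add: power_divide)

lemma continuous_on_rho2:
  assumes "s > 0"
  shows "continuous_on UNIV (rho2 s)"
  unfolding rho2_def[abs_def] using assms by (intro continuous_intros continuous_on_powr') auto

lemma C2_pos: "0 < s \<Longrightarrow> s < 1 \<Longrightarrow> 0 < C2 s"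
  unfolding C2_def by (auto intro!: divide_pos_pos mult_pos_pos sin_gt_zero simp: field_simps)

lemma rho2_bounds:
  assumes "0 < s" "s < 1"
  shows "0 \<le> rho2 s y" "rho2 s y \<le> C2 s * (R2 s)\<^sup>2 powr (s / 2)" "norm y > R2 s \<Longrightarrow> rho2 s y = 0"
proof -
  note C = C2_pos[OF assms]
  show "0 \<le> rho2 s y" unfolding rho2_def using C by simp
  show "rho2 s y \<le> C2 s * (R2 s)\<^sup>2 powr (s / 2)"
    unfolding rho2_def using C assms by (intro mult_left_mono powr_mono2) auto
  have "R2 s \<ge> 0" by (simp add: R2_def)
  then have "(R2 s)\<^sup>2 - (norm y)\<^sup>2 \<le> 0" if "norm y > R2 s" using that by (simp add: power_mono)
  then show "norm y > R2 s \<Longrightarrow> rho2 s y = 0" unfolding rho2_def by (simp add: max_absorb1)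
qed

lemma
  assumes s: "0 < s" "s < 1" and ab: "a > 0" "b > 0"
  shows continuous_on_rho_ab: "continuous_on UNIV (rho_ab s a b)"
    and rho_ab_nonneg: "0 \<le> rho_ab s a b y"
    and rho_ab_le: "\<bar>rho_ab s a b y\<bar> \<le> 1 / (a * b) * (C2 s * (R2 s)\<^sup>2 powr (s / 2))"
    and rho_ab_eq_0: "norm y > (a + b) * R2 s \<Longrightarrow> rho_ab s a b y = 0"
proof -
  show "continuous_on UNIV (rho_ab s a b)"
    unfolding rho_ab_def[abs_def] using ab
    by (intro continuous_intros continuous_on_compose2[OF continuous_on_rho2[OF s(1)]]) auto
  show n: "0 \<le> rho_ab s a b y" unfolding rho_ab_def using rho2_bounds(1)[OF s] ab by simp
  show "\<bar>rho_ab s a b y\<bar> \<le> 1 / (a * b) * (C2 s * (R2 s)\<^sup>2 powr (s / 2))"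
    unfolding abs_of_nonneg[OF n] unfolding rho_ab_def using rho2_bounds(2)[OF s] ab by (intro mult_left_mono) auto
  assume y: "norm y > (a + b) * R2 s"
  define w :: "real^2" where "w = vector [y $ 1 / a, y $ 2 / b]"
  have "norm y \<le> \<bar>y $ 1\<bar> + \<bar>y $ 2\<bar>" using norm_le_l1_cart[of y] by (simp add: UNIV_2)
  also have "\<bar>y $ 1\<bar> + \<bar>y $ 2\<bar> = a * \<bar>w $ 1\<bar> + b * \<bar>w $ 2\<bar>" using ab by (simp add: w_def abs_divide)
  also have "\<dots> \<le> a * norm w + b * norm w"
    using ab by (intro add_mono mult_left_mono component_le_norm_cart) auto
  finally have "(a + b) * R2 s < (a + b) * norm w" using y by (simp add: algebra_simps)
  then have "norm w > R2 s" using ab by simp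
  then show "rho_ab s a b y = 0" unfolding rho_ab_def w_def[symmetric] using rho2_bounds(3)[OF s] by simp
qed

context C1_pi_periodic begin

text \<open>On the line of slope \<open>m\<close> the force is an odd power of \<open>t\<close> times a function of the slope.\<close>

lemma force_line:
  fixes t m :: real and v :: "real^2"
  assumes t: "t \<noteq> 0"
  shows "force s (vector [t, t * m]) \<bullet> v = \<bar>t\<bar> powr (- s - 2) * t * ((1 + m\<^sup>2) powr (- (s + 2) / 2) *
     (f' (arctan m) * (v $ 2 - m * v $ 1) - s * f (arctan m) * (v $ 1 + m * v $ 2)))"
proof -
  define q where "q = sqrt (1 + m\<^sup>2)"
  have q: "q > 0" unfolding q_def by (simp add: add_pos_nonneg)
  define z :: "real^2" where "z = vector [t, t * m]"
  have z: "z $ 1 = (t * q) * cos (arctan m)" "z $ 2 = (t * q) * sin (arctan m)"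
    using q by (simp_all add: z_def cos_arctan sin_arctan q_def)
  have tq: "t * q \<noteq> 0" using t q by simp
  have a: "f (angle z) = f (arctan m)" "f' (angle z) = f' (arctan m)"
    using angle_polar[where \<omega> = f, OF per z tq] angle_polar[where \<omega> = f', OF per' z tq] by auto
  have "(norm z)\<^sup>2 = (\<bar>t\<bar> * q)\<^sup>2" unfolding norm_R2 z_def q_def by (simp add: power_mult_distrib algebra_simps)
  then have "norm z = \<bar>t\<bar> * q" using q by (simp add: power2_eq_iff_nonneg)
  then have "norm z powr (- s - 2) = \<bar>t\<bar> powr (- s - 2) * q powr (- s - 2)" using q by (simp add: powr_mult)
  also have "q powr (- s - 2) = (1 + m\<^sup>2) powr (- (s + 2) / 2)"
  proof -
    have e: "q = (1 + m\<^sup>2) powr (1/2)" unfolding q_def by (simp add: powr_half_sqrt)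
    have "1/2 * (- s - 2) = - (s + 2) / 2" by simp
    then show ?thesis unfolding e powr_powr by simp
  qed
  finally have n: "norm z powr (- s - 2) = \<bar>t\<bar> powr (- s - 2) * (1 + m\<^sup>2) powr (- (s + 2) / 2)" .
  show ?thesis unfolding force_def z_def[symmetric] n a inner_R2 perp_def
    by (simp add: z_def algebra_simps)
qed

text \<open>After the reflection \<open>y = x - z\<close>, the integral over each line through the origin is a Riesz integral:
with \<open>c = R2\<^sup>2 - x\<^sub>1\<^sup>2/a\<^sup>2 - x\<^sub>2\<^sup>2/b\<^sup>2\<close>, which is positive inside the ellipse, the density
along the line is the power \<open>s/2\<close> of the positive part of \<open>c + 2 \<beta> t - \<gamma> t\<^sup>2\<close>, and only the linear
coefficient \<open>\<beta>\<close> depends on \<open>x\<close> in the value of the integral.\<close>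

lemma force_integral_slopes:
  fixes a b s :: real and x v :: "real^2"
  assumes s: "0 < s" "s < 1" and ab: "a > 0" "b > 0"
    and x: "(x $ 1)\<^sup>2 / a\<^sup>2 + (x $ 2)\<^sup>2 / b\<^sup>2 < (R2 s)\<^sup>2"
  defines "F \<equiv> (\<lambda>m. (1 + m\<^sup>2) powr (- (s + 2) / 2) *
     (f' (arctan m) * (v $ 2 - m * v $ 1) - s * f (arctan m) * (v $ 1 + m * v $ 2)) *
     (x $ 1 / a\<^sup>2 + m * x $ 2 / b\<^sup>2) * (1 / a\<^sup>2 + m\<^sup>2 / b\<^sup>2) powr (s / 2 - 1))"
  defines "K \<equiv> C2 s / (a * b) * (2 * Beta (1 + s / 2) (1 - s / 2))"
  shows "integrable lborel F"
    and "(LINT y|lborel. rho_ab s a b y * (force s (x - y) \<bullet> v)) = K * (LINT m|lborel. F m)"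
proof -
  let ?\<rho> = "rho_ab s a b"
  define g where "g z = ?\<rho> (x - z) * (force s z \<bullet> v)" for z
  have [measurable]: "?\<rho> \<in> borel_measurable borel"
    by (intro borel_measurable_continuous_onI continuous_on_rho_ab s ab)
  obtain M where M: "\<And>z. norm (force s z) \<le> M * norm z powr (- s - 1)" using norm_force_le[of s] by blast
  have "integrable lborel (\<lambda>y. ?\<rho> y *\<^sub>R force s (x - y))"
    by (rule integrable_convolution_homogeneous[OF s force_measurable M _ rho_ab_le[OF s ab] rho_ab_eq_0[OF s ab]]) auto
  then have "integrable lborel (\<lambda>y. (?\<rho> y *\<^sub>R force s (x - y)) \<bullet> v)" by (rule integrable_inner_left)
  then have ig: "integrable lborel (\<lambda>y. ?\<rho> y * (force s (x - y) \<bullet> v))" by (simp only: inner_scaleR_left)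
  have mg [measurable]: "g \<in> borel_measurable borel" unfolding g_def[abs_def] by measurable
  have my: "(\<lambda>y. ?\<rho> y * (force s (x - y) \<bullet> v)) \<in> borel_measurable borel" by measurable
  have "integrable lborel g" using integrable_reflect[OF my, of x] ig unfolding g_def by simp
  then have ip: "integrable (lborel \<Otimes>\<^sub>M lborel) (\<lambda>p. g (vector [fst p, snd p]))"
    using integrable_R2_iff[OF mg] by simp
  define c where "c = (R2 s)\<^sup>2 - ((x $ 1)\<^sup>2 / a\<^sup>2 + (x $ 2)\<^sup>2 / b\<^sup>2)"
  have c: "c > 0" using x c_def by simp
  have line: "\<bar>t\<bar> * g (vector [t, t * m]) = C2 s / (a * b) * ((1 + m\<^sup>2) powr (- (s + 2) / 2) *
     (f' (arctan m) * (v $ 2 - m * v $ 1) - s * f (arctan m) * (v $ 1 + m * v $ 2))) *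
     (max 0 (c + 2 * (x $ 1 / a\<^sup>2 + m * x $ 2 / b\<^sup>2) * t - (1 / a\<^sup>2 + m\<^sup>2 / b\<^sup>2) * t\<^sup>2) powr (s / 2) *
      (\<bar>t\<bar> powr (- (2 * (s / 2))) * sgn t))" for t m
  proof (cases "t = 0")
    case False
    have "(R2 s)\<^sup>2 - (((x - vector [t, t * m]) $ 1)\<^sup>2 / a\<^sup>2 + ((x - vector [t, t * m]) $ 2)\<^sup>2 / b\<^sup>2) =
        c + 2 * (x $ 1 / a\<^sup>2 + m * x $ 2 / b\<^sup>2) * t - (1 / a\<^sup>2 + m\<^sup>2 / b\<^sup>2) * t\<^sup>2"
      unfolding c_def by (simp add: power2_eq_square algebra_simps add_divide_distrib diff_divide_distrib)
    then have r: "?\<rho> (x - vector [t, t * m]) = C2 s / (a * b) *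
       max 0 (c + 2 * (x $ 1 / a\<^sup>2 + m * x $ 2 / b\<^sup>2) * t - (1 / a\<^sup>2 + m\<^sup>2 / b\<^sup>2) * t\<^sup>2) powr (s / 2)"
      unfolding rho_ab_eq[OF ab] by simp
    have "\<bar>t\<bar> * (\<bar>t\<bar> powr (- s - 2) * t) = \<bar>t\<bar> powr (- s) * sgn t"
      using False by (simp add: powr_diff sgn_if power2_eq_square)
    then have t: "\<bar>t\<bar> * (\<bar>t\<bar> powr (- s - 2) * t) = \<bar>t\<bar> powr (- (2 * (s / 2))) * sgn t" by simp
    have ac: "\<bar>t\<bar> * (A * B * (U * t * W)) = A * W * (B * (\<bar>t\<bar> * (U * t)))" for A B U W :: real by simp
    show ?thesis unfolding g_def r force_line[OF False] ac t ..
  qed simp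
  have riesz: "(LINT t|lborel. \<bar>t\<bar> * g (vector [t, t * m])) = K * F m" for m
  proof -
    have "1 / a\<^sup>2 + m\<^sup>2 / b\<^sup>2 > 0" using ab by (intro add_pos_nonneg) auto
    from Riesz_quadratic_integral(2)[OF _ _ c this, of "s/2" "x $ 1 / a\<^sup>2 + m * x $ 2 / b\<^sup>2"] s
    show ?thesis unfolding line K_def F_def by simp
  qed
  have "integrable (lborel \<Otimes>\<^sub>M lborel) (\<lambda>p. \<bar>fst p\<bar> * g (vector [fst p, fst p * snd p]))"
    using integrable_shear[OF ip] by simp
  then have "integrable lborel (\<lambda>m. LINT t|lborel. \<bar>t\<bar> * g (vector [t, t * m]))"
    using lborel_pair.integrable_snd[of "\<lambda>t m. \<bar>t\<bar> * g (vector [t, t * m])"] by (simp add: case_prod_beta')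
  then have "integrable lborel (\<lambda>m. K * F m)" unfolding riesz .
  moreover have "K \<noteq> 0"
  proof -
    have "Beta (1 + s / 2) (1 - s / 2) > 0" unfolding Beta_def using s by (auto intro!: divide_pos_pos mult_pos_pos Gamma_real_pos)
    then show ?thesis unfolding K_def using C2_pos[OF s] ab by simp
  qed
  ultimately show "integrable lborel F" by simp
  have "(LINT y|lborel. ?\<rho> y * (force s (x - y) \<bullet> v)) = (LINT z|lborel. g z)"
    using integral_reflect_translate[OF my, of x] unfolding g_def by simp
  also have "\<dots> = (LINT p|(lborel \<Otimes>\<^sub>M lborel). g (vector [fst p, snd p]))" by (rule integral_R2_eq[OF mg])
  also have "\<dots> = (LINT m|lborel. (LINT t|lborel. \<bar>t\<bar> * g (vector [t, t * m])))"
    using integral_shear[OF ip] by simp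
  also have "\<dots> = K * (LINT m|lborel. F m)" unfolding riesz by simp
  finally show "(LINT y|lborel. ?\<rho> y * (force s (x - y) \<bullet> v)) = K * (LINT m|lborel. F m)" .
qed

text \<open>The substitution \<open>m = tan \<theta>\<close>. All powers of \<open>cos \<theta>\<close> cancel, so the integrand is continuous on the closed
interval.\<close>

lemma force_integral_angles:
  fixes a b s :: real and x v :: "real^2"
  assumes s: "0 < s" "s < 1" and ab: "a > 0" "b > 0"
    and x: "(x $ 1)\<^sup>2 / a\<^sup>2 + (x $ 2)\<^sup>2 / b\<^sup>2 < (R2 s)\<^sup>2"
  shows "(LINT y|lborel. rho_ab s a b y * (force s (x - y) \<bullet> v)) =
    C2 s / (a * b) * (2 * Beta (1 + s / 2) (1 - s / 2)) * integral {-pi/2..pi/2} (\<lambda>\<theta>.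
     (f' \<theta> * (cos \<theta> * v $ 2 - sin \<theta> * v $ 1) - s * f \<theta> * (cos \<theta> * v $ 1 + sin \<theta> * v $ 2)) *
     (cos \<theta> * x $ 1 / a\<^sup>2 + sin \<theta> * x $ 2 / b\<^sup>2) * ((cos \<theta>)\<^sup>2 / a\<^sup>2 + (sin \<theta>)\<^sup>2 / b\<^sup>2) powr (s / 2 - 1))"
proof -
  define F where "F m = (1 + m\<^sup>2) powr (- (s + 2) / 2) *
     (f' (arctan m) * (v $ 2 - m * v $ 1) - s * f (arctan m) * (v $ 1 + m * v $ 2)) *
     (x $ 1 / a\<^sup>2 + m * x $ 2 / b\<^sup>2) * (1 / a\<^sup>2 + m\<^sup>2 / b\<^sup>2) powr (s / 2 - 1)" for m
  define G where "G \<theta> = (f' \<theta> * (cos \<theta> * v $ 2 - sin \<theta> * v $ 1) - s * f \<theta> * (cos \<theta> * v $ 1 + sin \<theta> * v $ 2)) *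
     (cos \<theta> * x $ 1 / a\<^sup>2 + sin \<theta> * x $ 2 / b\<^sup>2) * ((cos \<theta>)\<^sup>2 / a\<^sup>2 + (sin \<theta>)\<^sup>2 / b\<^sup>2) powr (s / 2 - 1)" for \<theta>
  let ?S = "{-pi/2<..<pi/2}"
  have iF: "integrable lborel F"
    using force_integral_slopes(1)[OF s ab x, of v] unfolding F_def .
  have mF: "F \<in> borel_measurable lborel" using iF by (rule borel_measurable_integrable)
  have Fai: "F absolutely_integrable_on UNIV"
    unfolding set_integrable_def using integrable_completion[OF mF] iF by simp
  have FI: "integral UNIV F = (LINT m|lborel. F m)"
    using set_lebesgue_integral_eq_integral(2)[OF Fai] integral_completion[OF mF] by (simp add: set_lebesgue_integral_def)
  have cos0: "cos \<theta> > 0" if "\<theta> \<in> ?S" for \<theta> using that by (auto intro: cos_gt_zero_pi)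
  have der: "(tan has_field_derivative inverse ((cos \<theta>)\<^sup>2)) (at \<theta> within ?S)" if "\<theta> \<in> ?S" for \<theta>
    using cos0[OF that] by (auto intro!: DERIV_tan[THEN has_field_derivative_at_within])
  have inj: "inj_on tan ?S"
  proof (rule inj_onI)
    fix u w assume "u \<in> ?S" "w \<in> ?S" "tan u = tan w"
    then have "arctan (tan u) = arctan (tan w)" by simp
    then show "u = w" using \<open>u \<in> ?S\<close> \<open>w \<in> ?S\<close> by (simp add: arctan_tan)
  qed
  have img: "tan ` ?S = UNIV"
  proof safe
    fix m :: real
    show "m \<in> tan ` ?S" using arctan[of m] by (intro image_eqI[of _ _ "arctan m"]) auto
  qed auto
  have eq: "\<bar>inverse ((cos \<theta>)\<^sup>2)\<bar> * F (tan \<theta>) = G \<theta>" if "\<theta> \<in> ?S" for \<theta>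
  proof -
    define C where "C = cos \<theta>"
    have C: "C > 0" using cos0[OF that] C_def by simp
    have at: "arctan (tan \<theta>) = \<theta>" using that by (simp add: arctan_tan)
    define S where "S = sin \<theta>"
    have tn: "tan \<theta> = S / C" by (simp add: tan_def S_def C_def)
    have "1 + (S / C)\<^sup>2 = (C\<^sup>2 + S\<^sup>2) / C\<^sup>2" using C by (simp add: power_divide field_simps)
    also have "\<dots> = 1 / C powr 2" using C by (simp add: S_def C_def)
    finally have "(1 + (S / C)\<^sup>2) powr (- (s + 2) / 2) = 1 / (C powr (2 * (- (s + 2) / 2)))"
      using C by (simp only: powr_divide powr_powr) simp
    moreover have "2 * (- (s + 2) / 2) = - (s + 2)" by simp
    ultimately have e1: "(1 + (S / C)\<^sup>2) powr (- (s + 2) / 2) = C powr (s + 2)"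
      by (simp only: powr_minus_divide) simp
    define g where "g = C\<^sup>2 / a\<^sup>2 + S\<^sup>2 / b\<^sup>2"
    have g: "g > 0" unfolding g_def using ab C by (intro add_pos_nonneg) auto
    have "1 / a\<^sup>2 + (S / C)\<^sup>2 / b\<^sup>2 = g / C powr 2" unfolding g_def using C ab by (simp add: power_divide field_simps)
    then have "(1 / a\<^sup>2 + (S / C)\<^sup>2 / b\<^sup>2) powr (s / 2 - 1) = g powr (s / 2 - 1) / C powr (2 * (s / 2 - 1))"
      using C g by (simp only: powr_divide powr_powr less_imp_le powr_ge_zero)
    moreover have "2 * (s / 2 - 1) = s - 2" by simp
    ultimately have e2: "(1 / a\<^sup>2 + (S / C)\<^sup>2 / b\<^sup>2) powr (s / 2 - 1) = g powr (s / 2 - 1) / C powr (s - 2)" by simp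
    have e3: "C powr (s + 2) = C powr (s - 2) * C ^ 4"
      using C by (simp add: powr_add powr_diff power2_eq_square power4_eq_xxxx)
    have e4: "f' \<theta> * (v $ 2 - S / C * v $ 1) - s * f \<theta> * (v $ 1 + S / C * v $ 2) =
        (f' \<theta> * (C * v $ 2 - S * v $ 1) - s * f \<theta> * (C * v $ 1 + S * v $ 2)) / C"
      using C by (simp add: field_simps)
    have e5: "x $ 1 / a\<^sup>2 + S / C * x $ 2 / b\<^sup>2 = (C * x $ 1 / a\<^sup>2 + S * x $ 2 / b\<^sup>2) / C"
      using C by (simp add: add_divide_distrib)
    show ?thesis unfolding F_def at unfolding tn G_def C_def[symmetric] S_def[symmetric] g_def[symmetric] e1 e2 e4 e5
      unfolding e3 using C by (simp add: power2_eq_square power4_eq_xxxx inverse_eq_divide)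
  qed
  have "(\<lambda>\<theta>. \<bar>inverse ((cos \<theta>)\<^sup>2)\<bar> * F (tan \<theta>)) absolutely_integrable_on ?S \<and>
      integral ?S (\<lambda>\<theta>. \<bar>inverse ((cos \<theta>)\<^sup>2)\<bar> * F (tan \<theta>)) = (LINT m|lborel. F m)"
    using has_absolute_integral_change_of_variables_1'[OF _ der inj, of F "LINT m|lborel. F m"] img Fai FI by simp
  then have "integral ?S (\<lambda>\<theta>. \<bar>inverse ((cos \<theta>)\<^sup>2)\<bar> * F (tan \<theta>)) = (LINT m|lborel. F m)" by simp
  then have "integral ?S G = (LINT m|lborel. F m)"
    by (simp only: Henstock_Kurzweil_Integration.integral_cong[OF eq])
  then have "integral {-pi/2..pi/2} G = (LINT m|lborel. F m)"
    by (simp add: integral_open_interval_real)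
  then show ?thesis using force_integral_slopes(2)[OF s ab x, of v] unfolding F_def G_def by simp
qed

end

text \<open>The kernel in terms of the quadratic form \<open>\<gamma>\<close> of the ellipse; the form in its definition is
\<open>(a b)\<^sup>2 \<gamma>\<close>.\<close>

lemma ellipse_kernel_eq:
  fixes s a b \<theta> :: real
  assumes ab: "a > 0" "b > 0"
  defines "\<gamma> \<equiv> (cos \<theta>)\<^sup>2 / a\<^sup>2 + (sin \<theta>)\<^sup>2 / b\<^sup>2"
  shows "a ^ 3 * b * ellipse_kernel s 1 0 a b \<theta> = ((sin \<theta>)\<^sup>2 / b\<^sup>2 - (1 - s) * ((cos \<theta>)\<^sup>2 / a\<^sup>2)) * \<gamma> powr (s / 2 - 2)"
    and "a * b ^ 3 * ellipse_kernel s 0 1 a b \<theta> = ((cos \<theta>)\<^sup>2 / a\<^sup>2 - (1 - s) * ((sin \<theta>)\<^sup>2 / b\<^sup>2)) * \<gamma> powr (s / 2 - 2)"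
proof -
  define g where "g = a\<^sup>2 * (sin \<theta>)\<^sup>2 + b\<^sup>2 * (cos \<theta>)\<^sup>2"
  have g: "g > 0" unfolding g_def by (rule sum_squares_trig_pos[OF ab])
  have "g = \<gamma> * (a * b) powr 2" unfolding g_def \<gamma>_def using ab by (simp add: field_simps)
  moreover from this have \<gamma>: "\<gamma> > 0" using g ab by (simp add: zero_less_mult_iff)
  ultimately have "g powr (s / 2 - 2) = \<gamma> powr (s / 2 - 2) * (a * b) powr (2 * (s / 2 - 2))"
    by (simp only: powr_mult powr_powr less_imp_le powr_ge_zero)
  then have "g powr (s / 2 - 2) * (a * b) powr (- (s + 1)) = \<gamma> powr (s / 2 - 2) * ((a * b) powr (2 * (s / 2 - 2)) * (a * b) powr (- (s + 1)))"
    by simp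
  also have "(a * b) powr (2 * (s / 2 - 2)) * (a * b) powr (- (s + 1)) = (a * b) powr (- 5)"
    by (subst powr_add[symmetric]) simp
  also have "(a * b) powr (- 5) = 1 / (a * b) ^ 5" using ab by (simp add: powr_minus_divide)
  finally have e: "g powr (s / 2 - 2) * (a * b) powr (- (s + 1)) = \<gamma> powr (s / 2 - 2) / (a * b) ^ 5" by simp
  have k: "ellipse_kernel s P Q a b \<theta> = ((a * b)\<^sup>2 * (P * sin \<theta> - Q * cos \<theta>)\<^sup>2 - (1 - s) * (b\<^sup>2 * P * cos \<theta> + a\<^sup>2 * Q * sin \<theta>)\<^sup>2) *
     (\<gamma> powr (s / 2 - 2) / (a * b) ^ 5)" for P Q
    unfolding ellipse_kernel_def g_def[symmetric] e[symmetric] by simp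
  show "a ^ 3 * b * ellipse_kernel s 1 0 a b \<theta> = ((sin \<theta>)\<^sup>2 / b\<^sup>2 - (1 - s) * ((cos \<theta>)\<^sup>2 / a\<^sup>2)) * \<gamma> powr (s / 2 - 2)"
    "a * b ^ 3 * ellipse_kernel s 0 1 a b \<theta> = ((cos \<theta>)\<^sup>2 / a\<^sup>2 - (1 - s) * ((sin \<theta>)\<^sup>2 / b\<^sup>2)) * \<gamma> powr (s / 2 - 2)"
    unfolding k using ab by (simp_all add: divide_simps) (simp_all add: algebra_simps power2_eq_square power3_eq_cube eval_nat_numeral)
qed

lemma odd_integral_zero:
  fixes h :: "real \<Rightarrow> real"
  assumes "\<And>x. h (- x) = - h x"
  shows "integral {-c..c} h = 0"
proof -
  have "integral {-c..c} h = integral {-c..c} (\<lambda>x. h (- x))"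
    using Henstock_Kurzweil_Integration.integral_reflect_real[of c "- c" h] by simp
  also have "\<dots> = - integral {-c..c} h" unfolding assms by simp
  finally show ?thesis by simp
qed

context C1_pi_periodic begin

text \<open>The derivative of \<open>f\<close> is removed by adding or subtracting the derivative of
\<open>f sin cos \<gamma> powr (s/2 - 1)\<close>, which vanishes at both ends. What is left multiplies \<open>f\<close> and is the kernel
found for the coefficients.\<close>

lemma ellipse_integration_by_parts:
  fixes s a b :: real
  assumes ab: "a > 0" "b > 0"
  defines "\<gamma> \<equiv> (\<lambda>\<theta>. (cos \<theta>)\<^sup>2 / a\<^sup>2 + (sin \<theta>)\<^sup>2 / b\<^sup>2)"
  shows "integral {-pi/2..pi/2} (\<lambda>\<theta>. (- f' \<theta> * sin \<theta> - s * f \<theta> * cos \<theta>) * cos \<theta> * \<gamma> \<theta> powr (s / 2 - 1)) =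
      - (a ^ 3 * b) * integral {-pi/2..pi/2} (\<lambda>\<theta>. f \<theta> * ellipse_kernel s 1 0 a b \<theta>)"
    and "integral {-pi/2..pi/2} (\<lambda>\<theta>. (f' \<theta> * cos \<theta> - s * f \<theta> * sin \<theta>) * sin \<theta> * \<gamma> \<theta> powr (s / 2 - 1)) =
      - (a * b ^ 3) * integral {-pi/2..pi/2} (\<lambda>\<theta>. f \<theta> * ellipse_kernel s 0 1 a b \<theta>)"
proof -
  have \<gamma>0: "\<gamma> \<theta> > 0" for \<theta>
    using sum_squares_trig_pos[of "1 / b" "1 / a" \<theta>] ab unfolding \<gamma>_def by (simp add: power_divide add.commute)
  define \<gamma>' where "\<gamma>' \<theta> = 2 * sin \<theta> * cos \<theta> * (1 / b\<^sup>2 - 1 / a\<^sup>2)" for \<theta>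
  have d\<gamma>: "(\<gamma> has_real_derivative \<gamma>' \<theta>) (at \<theta>)" for \<theta>
    unfolding \<gamma>_def \<gamma>'_def divide_inverse by (auto intro!: derivative_eq_intros simp: algebra_simps)
  have dp: "((\<lambda>\<theta>. \<gamma> \<theta> powr (s / 2 - 1)) has_real_derivative (s / 2 - 1) * \<gamma> \<theta> powr (s / 2 - 2) * \<gamma>' \<theta>) (at \<theta>)" for \<theta>
    using DERIV_fun_powr[OF d\<gamma> \<gamma>0, of "s / 2 - 1" \<theta>] by simp
  define P where "P \<theta> = f \<theta> * (sin \<theta> * cos \<theta>) * \<gamma> \<theta> powr (s / 2 - 1)" for \<theta>
  define P' where "P' \<theta> = f' \<theta> * (sin \<theta> * cos \<theta>) * \<gamma> \<theta> powr (s / 2 - 1) + f \<theta> * ((cos \<theta>)\<^sup>2 - (sin \<theta>)\<^sup>2) * \<gamma> \<theta> powr (s / 2 - 1)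
      + f \<theta> * (sin \<theta> * cos \<theta>) * ((s / 2 - 1) * \<gamma> \<theta> powr (s / 2 - 2) * \<gamma>' \<theta>)" for \<theta>
  have dsc: "((\<lambda>\<theta>. sin \<theta> * cos \<theta>) has_real_derivative (cos \<theta>)\<^sup>2 - (sin \<theta>)\<^sup>2) (at \<theta>)" for \<theta> :: real
    by (auto intro!: derivative_eq_intros simp: power2_eq_square)
  have dP: "(P has_real_derivative P' \<theta>) (at \<theta>)" for \<theta>
    unfolding P_def[abs_def] P'_def
    by (rule DERIV_cong[OF DERIV_mult[OF DERIV_mult[OF der dsc] dp]]) (simp add: algebra_simps)
  have "(P' has_integral P (pi/2) - P (- pi/2)) {-pi/2..pi/2}"
    by (intro fundamental_theorem_of_calculus)
       (auto simp: has_real_derivative_iff_has_vector_derivative[symmetric] intro: has_field_derivative_at_within dP)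
  then have P0: "(P' has_integral 0) {-pi/2..pi/2}" by (simp add: P_def)
  have cg: "continuous_on A (\<lambda>\<theta>. \<gamma> \<theta> powr (s / 2 - 1))" for A
    by (intro DERIV_continuous_on[OF DERIV_subset[OF dp]]) auto
  note ci = continuous_intros cg continuous_on_subset[OF cont] continuous_on_subset[OF cont']
  have E: "\<gamma> \<theta> powr (s / 2 - 1) = \<gamma> \<theta> powr (s / 2 - 2) * \<gamma> \<theta>" for \<theta>
    using \<gamma>0[of \<theta>] by (simp add: powr_diff power2_eq_square)
  have id1: "s * C\<^sup>2 * (C\<^sup>2 * \<alpha> + S\<^sup>2 * \<beta>) - (C\<^sup>2 - S\<^sup>2) * (C\<^sup>2 * \<alpha> + S\<^sup>2 * \<beta>) - S * C * ((s / 2 - 1) * (2 * S * C * (\<beta> - \<alpha>))) =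
      S\<^sup>2 * \<beta> - (1 - s) * (C\<^sup>2 * \<alpha>)" (is "?L1 = ?R1")
   and id2: "s * S\<^sup>2 * (C\<^sup>2 * \<alpha> + S\<^sup>2 * \<beta>) + (C\<^sup>2 - S\<^sup>2) * (C\<^sup>2 * \<alpha> + S\<^sup>2 * \<beta>) + S * C * ((s / 2 - 1) * (2 * S * C * (\<beta> - \<alpha>))) =
      C\<^sup>2 * \<alpha> - (1 - s) * (S\<^sup>2 * \<beta>)" (is "?L2 = ?R2") if CS: "S\<^sup>2 + C\<^sup>2 = 1" for C S \<alpha> \<beta> :: real
  proof -
    have "?L1 = ?R1 * (S\<^sup>2 + C\<^sup>2)" "?L2 = ?R2 * (S\<^sup>2 + C\<^sup>2)" by (simp_all add: power2_eq_square algebra_simps)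
    then show "?L1 = ?R1" "?L2 = ?R2" unfolding CS by simp_all
  qed
  have \<gamma>e: "\<gamma> \<theta> = (cos \<theta>)\<^sup>2 * (1 / a\<^sup>2) + (sin \<theta>)\<^sup>2 * (1 / b\<^sup>2)" for \<theta> by (simp add: \<gamma>_def)
  {
    let ?h = "\<lambda>\<theta>. (- f' \<theta> * sin \<theta> - s * f \<theta> * cos \<theta>) * cos \<theta> * \<gamma> \<theta> powr (s / 2 - 1)"
    have h: "(?h has_integral integral {-pi/2..pi/2} ?h) {-pi/2..pi/2}"
      by (intro integrable_integral integrable_continuous_real ci) auto
    have "?h \<theta> + P' \<theta> = - (a ^ 3 * b) * (f \<theta> * ellipse_kernel s 1 0 a b \<theta>)" for \<theta>
    proof -
      have "?h \<theta> + P' \<theta> = - (f \<theta> * \<gamma> \<theta> powr (s / 2 - 2) * (s * (cos \<theta>)\<^sup>2 * \<gamma> \<theta> - ((cos \<theta>)\<^sup>2 - (sin \<theta>)\<^sup>2) * \<gamma> \<theta> -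
          sin \<theta> * cos \<theta> * ((s / 2 - 1) * \<gamma>' \<theta>)))"
        unfolding P'_def E by (simp add: power2_eq_square algebra_simps del: sin_cos_squared_add3)
      also have "s * (cos \<theta>)\<^sup>2 * \<gamma> \<theta> - ((cos \<theta>)\<^sup>2 - (sin \<theta>)\<^sup>2) * \<gamma> \<theta> - sin \<theta> * cos \<theta> * ((s / 2 - 1) * \<gamma>' \<theta>) =
          (sin \<theta>)\<^sup>2 * (1 / b\<^sup>2) - (1 - s) * ((cos \<theta>)\<^sup>2 * (1 / a\<^sup>2))"
        unfolding \<gamma>'_def \<gamma>e by (rule id1) simp
      also have "f \<theta> * \<gamma> \<theta> powr (s / 2 - 2) * ((sin \<theta>)\<^sup>2 * (1 / b\<^sup>2) - (1 - s) * ((cos \<theta>)\<^sup>2 * (1 / a\<^sup>2))) =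
          f \<theta> * (a ^ 3 * b * ellipse_kernel s 1 0 a b \<theta>)"
        unfolding ellipse_kernel_eq(1)[OF ab] \<gamma>_def by simp
      finally show ?thesis by simp
    qed
    then have "((\<lambda>\<theta>. - (a ^ 3 * b) * (f \<theta> * ellipse_kernel s 1 0 a b \<theta>)) has_integral integral {-pi/2..pi/2} ?h + 0) {-pi/2..pi/2}"
      using has_integral_add[OF h P0] by simp
    then have "integral {-pi/2..pi/2} (\<lambda>\<theta>. - (a ^ 3 * b) * (f \<theta> * ellipse_kernel s 1 0 a b \<theta>)) = integral {-pi/2..pi/2} ?h"
      by (intro integral_unique) simp
    then show "integral {-pi/2..pi/2} ?h = - (a ^ 3 * b) * integral {-pi/2..pi/2} (\<lambda>\<theta>. f \<theta> * ellipse_kernel s 1 0 a b \<theta>)"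
      by (simp only: integral_mult_right)
  }
  {
    let ?h = "\<lambda>\<theta>. (f' \<theta> * cos \<theta> - s * f \<theta> * sin \<theta>) * sin \<theta> * \<gamma> \<theta> powr (s / 2 - 1)"
    have h: "(?h has_integral integral {-pi/2..pi/2} ?h) {-pi/2..pi/2}"
      by (intro integrable_integral integrable_continuous_real ci) auto
    have "?h \<theta> - P' \<theta> = - (a * b ^ 3) * (f \<theta> * ellipse_kernel s 0 1 a b \<theta>)" for \<theta>
    proof -
      have "?h \<theta> - P' \<theta> = - (f \<theta> * \<gamma> \<theta> powr (s / 2 - 2) * (s * (sin \<theta>)\<^sup>2 * \<gamma> \<theta> + ((cos \<theta>)\<^sup>2 - (sin \<theta>)\<^sup>2) * \<gamma> \<theta> +
          sin \<theta> * cos \<theta> * ((s / 2 - 1) * \<gamma>' \<theta>)))"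
        unfolding P'_def E by (simp add: power2_eq_square algebra_simps del: sin_cos_squared_add3)
      also have "s * (sin \<theta>)\<^sup>2 * \<gamma> \<theta> + ((cos \<theta>)\<^sup>2 - (sin \<theta>)\<^sup>2) * \<gamma> \<theta> + sin \<theta> * cos \<theta> * ((s / 2 - 1) * \<gamma>' \<theta>) =
          (cos \<theta>)\<^sup>2 * (1 / a\<^sup>2) - (1 - s) * ((sin \<theta>)\<^sup>2 * (1 / b\<^sup>2))"
        unfolding \<gamma>'_def \<gamma>e by (rule id2) simp
      also have "f \<theta> * \<gamma> \<theta> powr (s / 2 - 2) * ((cos \<theta>)\<^sup>2 * (1 / a\<^sup>2) - (1 - s) * ((sin \<theta>)\<^sup>2 * (1 / b\<^sup>2))) =
          f \<theta> * (a * b ^ 3 * ellipse_kernel s 0 1 a b \<theta>)"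
        unfolding ellipse_kernel_eq(2)[OF ab] \<gamma>_def by simp
      finally show ?thesis by simp
    qed
    then have "((\<lambda>\<theta>. - (a * b ^ 3) * (f \<theta> * ellipse_kernel s 0 1 a b \<theta>)) has_integral integral {-pi/2..pi/2} ?h - 0) {-pi/2..pi/2}"
      using has_integral_diff[OF h P0] by simp
    then have "integral {-pi/2..pi/2} (\<lambda>\<theta>. - (a * b ^ 3) * (f \<theta> * ellipse_kernel s 0 1 a b \<theta>)) = integral {-pi/2..pi/2} ?h"
      by (intro integral_unique) simp
    then show "integral {-pi/2..pi/2} ?h = - (a * b ^ 3) * integral {-pi/2..pi/2} (\<lambda>\<theta>. f \<theta> * ellipse_kernel s 0 1 a b \<theta>)"
      by (simp only: integral_mult_right)
  }
qed

lemma full_turn_integral: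
  assumes ab: "a > 0" "b > 0"
  shows "integral {-pi..pi} (\<lambda>\<theta>. f \<theta> * ellipse_kernel s P Q a b \<theta>) =
    2 * integral {-pi/2..pi/2} (\<lambda>\<theta>. f \<theta> * ellipse_kernel s P Q a b \<theta>)"
proof -
  let ?h = "\<lambda>\<theta>. f \<theta> * ellipse_kernel s P Q a b \<theta>"
  have c: "continuous_on A ?h" for A
    unfolding ellipse_kernel_def
    by (intro continuous_intros continuous_on_subset[OF cont]) (use sum_squares_trig_pos[OF ab] in \<open>auto simp: less_le\<close>)
  have per_h: "?h (x + pi) = ?h x" for x
  proof -
    have "(- (P * sin x) + Q * cos x)\<^sup>2 = (P * sin x - Q * cos x)\<^sup>2"
        "(- (b\<^sup>2 * P * cos x) - a\<^sup>2 * Q * sin x)\<^sup>2 = (b\<^sup>2 * P * cos x + a\<^sup>2 * Q * sin x)\<^sup>2"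
      by (simp_all add: power2_eq_square algebra_simps)
    then show ?thesis by (simp add: ellipse_kernel_def per)
  qed
  have "(?h has_integral integral {-pi/2..pi/2} ?h) {-pi/2..pi/2}"
    by (intro integrable_integral integrable_continuous_real c)
  from has_integral_shift_real_ivl[OF this, of "- pi/2"]
  have "((\<lambda>u. ?h (- pi/2 + u)) has_integral integral {-pi/2..pi/2} ?h) {0..pi}"
    by (simp add: add.commute)
  from has_integral_pi_periodic[of ?h, OF per_h this] show ?thesis by (rule integral_unique)
qed

lemma even_imp_odd_derivative:
  assumes even: "\<And>x. f x = f (- x)"
  shows "f' (- x) = - f' x"
proof -
  have "((\<lambda>x. f (- x)) has_real_derivative - f' (- x)) (at x)"
    using DERIV_mirror[of f "f' (- x)" x] der[of "- x"] by simp
  then have "(f has_real_derivative - f' (- x)) (at x)" using even by (simp only: even[symmetric])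
  then show ?thesis using DERIV_unique[OF der] by fastforce
qed

text \<open>Since \<open>f\<close> is even and \<open>f'\<close> is odd, the terms of the directional integral that couple the two coordinates
are odd in \<open>\<theta>\<close> and integrate to zero (they are collected in \<open>h\<close>). The other two are evaluated by parts.\<close>

lemma force_integral:
  fixes a b s :: real and x v :: "real^2"
  assumes even: "\<And>x. f x = f (- x)" and s: "0 < s" "s < 1" and ab: "a > 0" "b > 0"
    and x: "(x $ 1)\<^sup>2 / a\<^sup>2 + (x $ 2)\<^sup>2 / b\<^sup>2 < (R2 s)\<^sup>2"
  shows "(LINT y|lborel. rho_ab s a b y * (force s (x - y) \<bullet> v)) =
    - 2 * (v $ 1 * A_coeff s f a b * x $ 1 + v $ 2 * B_coeff s f a b * x $ 2)"
proof -
  let ?I = "{-pi/2..pi/2}"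
  define \<gamma> where "\<gamma> \<theta> = (cos \<theta>)\<^sup>2 / a\<^sup>2 + (sin \<theta>)\<^sup>2 / b\<^sup>2" for \<theta>
  define W where "W \<theta> = \<gamma> \<theta> powr (s / 2 - 1)" for \<theta>
  have \<gamma>0: "\<gamma> \<theta> > 0" for \<theta>
    using sum_squares_trig_pos[of "1 / b" "1 / a" \<theta>] ab unfolding \<gamma>_def by (simp add: power_divide add.commute)
  have cW: "continuous_on A W" for A
  proof -
    have "continuous_on A \<gamma>" unfolding \<gamma>_def[abs_def] by (intro continuous_intros) (use ab in auto)
    then show ?thesis unfolding W_def[abs_def] by (intro continuous_intros) (use \<gamma>0 in \<open>auto simp: less_le\<close>)
  qed
  have Wm: "W (- \<theta>) = W \<theta>" for \<theta> by (simp add: W_def \<gamma>_def)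
  define p where "p \<theta> = - f' \<theta> * sin \<theta> - s * f \<theta> * cos \<theta>" for \<theta>
  define q where "q \<theta> = f' \<theta> * cos \<theta> - s * f \<theta> * sin \<theta>" for \<theta>
  have cpq: "continuous_on A p" "continuous_on A q" for A
    unfolding p_def[abs_def] q_def[abs_def]
    by (intro continuous_intros continuous_on_subset[OF cont] continuous_on_subset[OF cont']; simp)+
  have pq: "p (- \<theta>) = p \<theta>" "q (- \<theta>) = - q \<theta>" for \<theta>
    unfolding p_def q_def even_imp_odd_derivative[OF even] even[of \<theta>, symmetric] by simp_all
  define y where "y = x $ 1 / a\<^sup>2"
  define z where "z = x $ 2 / b\<^sup>2"
  define h where "h \<theta> = v $ 1 * z * (p \<theta> * sin \<theta> * W \<theta>) + v $ 2 * y * (q \<theta> * cos \<theta> * W \<theta>)" for \<theta>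
  have h0: "integral ?I h = 0"
    using odd_integral_zero[of h "pi/2"] by (simp add: h_def pq Wm)
  have split: "(f' \<theta> * (cos \<theta> * v $ 2 - sin \<theta> * v $ 1) - s * f \<theta> * (cos \<theta> * v $ 1 + sin \<theta> * v $ 2)) *
      (cos \<theta> * x $ 1 / a\<^sup>2 + sin \<theta> * x $ 2 / b\<^sup>2) * ((cos \<theta>)\<^sup>2 / a\<^sup>2 + (sin \<theta>)\<^sup>2 / b\<^sup>2) powr (s / 2 - 1) =
      (v $ 1 * y * (p \<theta> * cos \<theta> * W \<theta>) + v $ 2 * z * (q \<theta> * sin \<theta> * W \<theta>)) + h \<theta>" for \<theta>
  proof -
    have "(d * (C * v $ 2 - S * v $ 1) - s * F * (C * v $ 1 + S * v $ 2)) * (C * y + S * z) * w =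
      (v $ 1 * y * ((- d * S - s * F * C) * C * w) + v $ 2 * z * ((d * C - s * F * S) * S * w)) +
      (v $ 1 * z * ((- d * S - s * F * C) * S * w) + v $ 2 * y * ((d * C - s * F * S) * C * w))"
      for d C S F w :: real by (simp add: algebra_simps)
    then show ?thesis unfolding h_def p_def q_def W_def \<gamma>_def y_def z_def by (simp only: times_divide_eq_right)
  qed
  have ch: "continuous_on ?I h" unfolding h_def[abs_def]
    by (intro continuous_on_add continuous_on_mult continuous_on_const continuous_on_sin continuous_on_cos continuous_on_id cpq cW)
  have c1: "continuous_on ?I (\<lambda>\<theta>. v $ 1 * y * (p \<theta> * cos \<theta> * W \<theta>))"
    and c2: "continuous_on ?I (\<lambda>\<theta>. v $ 2 * z * (q \<theta> * sin \<theta> * W \<theta>))"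
    by (intro continuous_on_mult continuous_on_const continuous_on_sin continuous_on_cos continuous_on_id cpq cW)+
  have i: "integral ?I (\<lambda>\<theta>. (v $ 1 * y * (p \<theta> * cos \<theta> * W \<theta>) + v $ 2 * z * (q \<theta> * sin \<theta> * W \<theta>)) + h \<theta>) =
      v $ 1 * y * integral ?I (\<lambda>\<theta>. p \<theta> * cos \<theta> * W \<theta>) + v $ 2 * z * integral ?I (\<lambda>\<theta>. q \<theta> * sin \<theta> * W \<theta>)"
    by (simp only: Henstock_Kurzweil_Integration.integral_add[OF integrable_continuous_real[OF continuous_on_add[OF c1 c2]]
          integrable_continuous_real[OF ch]]
        Henstock_Kurzweil_Integration.integral_add[OF integrable_continuous_real[OF c1] integrable_continuous_real[OF c2]]
        integral_mult_right h0 add_0_right)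
  define E1 where "E1 = integral ?I (\<lambda>\<theta>. f \<theta> * ellipse_kernel s 1 0 a b \<theta>)"
  define E2 where "E2 = integral ?I (\<lambda>\<theta>. f \<theta> * ellipse_kernel s 0 1 a b \<theta>)"
  have parts: "integral ?I (\<lambda>\<theta>. p \<theta> * cos \<theta> * W \<theta>) = - (a ^ 3 * b) * E1"
      "integral ?I (\<lambda>\<theta>. q \<theta> * sin \<theta> * W \<theta>) = - (a * b ^ 3) * E2"
    unfolding p_def q_def W_def \<gamma>_def E1_def E2_def by (rule ellipse_integration_by_parts[OF ab])+
  have "Beta (1 + s / 2) (1 - s / 2) = pi * (s / 2) / sin (s * pi / 2)"
    using Beta_one_plus_one_minus[of "s / 2"] s by (simp add: mult.commute)
  moreover have "sin (s * pi / 2) > 0" using s by (intro sin_gt_zero) (auto simp: field_simps)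
  ultimately have CB: "C2 s * (2 * Beta (1 + s / 2) (1 - s / 2)) = 4 / (s * pi)"
    unfolding C2_def using s by (simp add: field_simps power2_eq_square)
  have "(LINT y|lborel. rho_ab s a b y * (force s (x - y) \<bullet> v)) =
      C2 s / (a * b) * (2 * Beta (1 + s / 2) (1 - s / 2)) * (v $ 1 * y * (- (a ^ 3 * b) * E1) + v $ 2 * z * (- (a * b ^ 3) * E2))"
    unfolding force_integral_angles[OF s ab x] split i parts ..
  also have "\<dots> = - (C2 s * (2 * Beta (1 + s / 2) (1 - s / 2))) * (v $ 1 * x $ 1 * E1 + v $ 2 * x $ 2 * E2)"
    unfolding y_def z_def using ab by (simp add: field_simps power2_eq_square power3_eq_cube)
  finally show ?thesis
    unfolding CB A_coeff_eq[OF C1_pi_periodic_axioms s ab] B_coeff_eq[OF C1_pi_periodic_axioms s ab] full_turn_integral[OF ab]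
      E1_def[symmetric] E2_def[symmetric] by (simp add: algebra_simps)
qed

end

section \<open>Mass and velocity\<close>

lemma integral_unit_semicircle_powr:
  fixes q :: real
  assumes q: "q > 0"
  shows "integrable lborel (\<lambda>z. max 0 (1 - z\<^sup>2) powr q)"
    and "(LINT z|lborel. max 0 (1 - z\<^sup>2) powr q) = Beta (1/2) (q + 1)"
proof -
  let ?B = "Beta (1/2) (q + 1)"
  let ?f = "\<lambda>z::real. max 0 (1 - z\<^sup>2) powr q"
  let ?S = "{0<..<pi}"
  have e: "(2 * q + 1 + 1) / 2 = q + 1" by simp
  have "((\<lambda>u. sin u powr (2 * q + 1)) has_integral ?B) ?S"
    using has_integral_sin_powr[of "2 * q + 1"] q unfolding e has_integral_Icc_iff_Ioo by simp
  then have 1: "(\<lambda>u. sin u powr (2 * q + 1)) absolutely_integrable_on ?S \<and> integral ?S (\<lambda>u. sin u powr (2 * q + 1)) = ?B"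
    by (auto intro!: nonnegative_absolutely_integrable_1 simp: has_integral_iff)
  have eq: "sin u powr (2 * q + 1) = \<bar>- sin u\<bar> * ?f (cos u)" if "u \<in> ?S" for u
  proof -
    have su: "sin u > 0" using that by (auto intro: sin_gt_zero)
    have "1 - (cos u)\<^sup>2 = sin u powr 2" using su by (simp add: sin_squared_eq)
    then have "?f (cos u) = (sin u powr 2) powr q" by simp
    also have "\<dots> = sin u powr (2 * q)" by (simp only: powr_powr)
    finally show ?thesis using su by (simp add: powr_add)
  qed
  have "(\<lambda>u. \<bar>- sin u\<bar> * ?f (cos u)) absolutely_integrable_on ?S \<and> integral ?S (\<lambda>u. \<bar>- sin u\<bar> * ?f (cos u)) = ?B"
    using 1 by (simp only: set_integrable_cong[OF refl refl eq] Henstock_Kurzweil_Integration.integral_cong[OF eq])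
  moreover have "inj_on cos ?S" by (rule inj_onI) (use cos_inj_pi in auto)
  moreover have "cos ` ?S = {-1<..<1}"
  proof safe
    fix u assume "u \<in> ?S"
    then have "cos pi < cos u" "cos u < cos 0"
      using cos_monotone_0_pi[of u pi] cos_monotone_0_pi[of 0 u] by auto
    then show "cos u \<in> {-1<..<1}" by simp
  next
    fix z :: real assume "z \<in> {-1<..<1}"
    then have z: "-1 < z" "z < 1" by auto
    show "z \<in> cos ` ?S" using arccos_lt_bounded[OF z] z by (intro image_eqI[of _ _ "arccos z"]) auto
  qed
  moreover have "(cos has_field_derivative - sin u) (at u within ?S)" for u
    by (auto intro!: derivative_eq_intros)
  ultimately have 2: "?f absolutely_integrable_on {-1<..<1}" "integral {-1<..<1} ?f = ?B"
    using has_absolute_integral_change_of_variables_1'[of ?S cos "\<lambda>u. - sin u" ?f ?B] by auto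
  have i: "(\<lambda>z. indicator {-1<..<1} z * ?f z) = ?f"
  proof
    fix z :: real
    show "indicator {-1<..<1} z * ?f z = ?f z"
    proof (cases "z \<in> {-1<..<1}")
      case False
      then have "1\<^sup>2 \<le> \<bar>z\<bar>\<^sup>2" by (intro power_mono) auto
      then show ?thesis using False by (simp add: max_absorb1)
    qed simp
  qed
  show "integrable lborel ?f" "(LINT z|lborel. ?f z) = ?B"
    using lborel_integral_of_absolutely_integrable[OF 2(1)] 2(2) unfolding i by auto
qed

text \<open>Integrating out one coordinate of \<open>(R\<^sup>2 - |x|\<^sup>2) powr q\<close> raises the exponent by one half; two applications
give the mass of \<open>rho2\<close>.\<close>

lemma integral_semicircle_powr:
  fixes q c :: real
  assumes q: "q > 0"
  shows "(LINT y|lborel. max 0 (c - y\<^sup>2) powr q) = max 0 c powr (q + 1/2) * Beta (1/2) (q + 1)"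
proof (cases "c > 0")
  case True
  define k where "k = sqrt c"
  have k: "k > 0" "k\<^sup>2 = c" using True by (auto simp: k_def)
  have "(LINT y|lborel. max 0 (c - y\<^sup>2) powr q) = k * (LINT z|lborel. max 0 (c - (k * z)\<^sup>2) powr q)"
    using lborel_integral_real_affine[of k "\<lambda>y. max 0 (c - y\<^sup>2) powr q" 0] k by simp
  also have "(\<lambda>z. max 0 (c - (k * z)\<^sup>2) powr q) = (\<lambda>z. c powr q * max 0 (1 - z\<^sup>2) powr q)"
  proof
    fix z
    have "max 0 (c - (k * z)\<^sup>2) = c * max 0 (1 - z\<^sup>2)"
      using True k by (simp add: power_mult_distrib max_mult_distrib_left algebra_simps)
    then show "max 0 (c - (k * z)\<^sup>2) powr q = c powr q * max 0 (1 - z\<^sup>2) powr q"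
      using True by (simp add: powr_mult)
  qed
  also have "k * (LINT z|lborel. c powr q * max 0 (1 - z\<^sup>2) powr q) = k * c powr q * Beta (1/2) (q + 1)"
    using integral_unit_semicircle_powr[OF q] by simp
  also have "k * c powr q = max 0 c powr (q + 1/2)"
    using True by (simp add: powr_add powr_half_sqrt k_def)
  finally show ?thesis .
next
  case False
  then have "max 0 (c - y\<^sup>2) = 0" for y :: real by (intro max_absorb1) (smt (verit) zero_le_power2)
  then show ?thesis using False by simp
qed

lemma
  assumes s: "0 < s" "s < 1"
  shows integrable_rho2: "integrable lborel (rho2 s)"
    and integral_rho2: "(LINT y|lborel. rho2 s y) = 1"
proof -
  have "integrable lborel (\<lambda>y. indicator (cball 0 (R2 s)) y *\<^sub>R rho2 s y)"
    by (intro borel_integrable_compact continuous_on_subset[OF continuous_on_rho2[OF s(1)]]) auto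
  also have "(\<lambda>y. indicator (cball 0 (R2 s)) y *\<^sub>R rho2 s y) = rho2 s"
    using rho2_bounds(3)[OF s] by (auto simp: fun_eq_iff indicator_def)
  finally show i: "integrable lborel (rho2 s)" .
  have m: "rho2 s \<in> borel_measurable borel" by (intro borel_measurable_continuous_onI continuous_on_rho2 s)
  define R where "R = R2 s"
  have "sin (s * pi / 2) > 0" using s by (intro sin_gt_zero) (auto simp: field_simps)
  moreover define d where "d = sin (s * pi / 2)"
  ultimately have d0: "d > 0" by simp
  have X: "8 * d / (s\<^sup>2 * (2 + s) * pi) > 0" using d0 s by simp
  have R0: "R > 0" unfolding R_def R2_def d_def[symmetric] powr_gt_zero using X by linarith
  have Rs: "R powr (s + 2) = s\<^sup>2 * (2 + s) * pi / (8 * d)"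
  proof -
    have "- 1 / (s + 2) * (s + 2) = - 1" using s by (simp add: field_simps)
    then have "R powr (s + 2) = (8 * d / (s\<^sup>2 * (2 + s) * pi)) powr - 1"
      unfolding R_def R2_def d_def[symmetric] powr_powr by (simp only:)
    then show ?thesis using X d0 s by (simp add: powr_minus_divide)
  qed
  have "(LINT y|lborel. rho2 s y) = (LINT p|(lborel \<Otimes>\<^sub>M lborel). rho2 s (vector [fst p, snd p]))"
    by (rule integral_R2_eq[OF m])
  also have "\<dots> = (LINT x|lborel. LINT y|lborel. rho2 s (vector [x, y]))"
    using lborel_pair.integral_fst[of "\<lambda>x y. rho2 s (vector [x, y])"] integrable_R2_iff[OF m] i
    by (simp add: case_prod_beta')
  also have "\<dots> = (LINT x|lborel. C2 s * (LINT y|lborel. max 0 ((R\<^sup>2 - x\<^sup>2) - y\<^sup>2) powr (s / 2)))"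
    unfolding rho2_def norm_R2 R_def by (simp add: diff_diff_eq)
  also have "\<dots> = C2 s * Beta (1/2) (s / 2 + 1) * (LINT x|lborel. max 0 (R\<^sup>2 - x\<^sup>2) powr (s / 2 + 1/2))"
    using s by (subst integral_semicircle_powr) (simp_all add: ac_simps)
  also have "(LINT x|lborel. max 0 (R\<^sup>2 - x\<^sup>2) powr (s / 2 + 1/2)) = (R\<^sup>2) powr (s / 2 + 1) * Beta (1/2) (s / 2 + 3/2)"
    using s by (subst integral_semicircle_powr) (simp_all add: add.assoc)
  also have "(R\<^sup>2) powr (s / 2 + 1) = s\<^sup>2 * (2 + s) * pi / (8 * d)"
  proof -
    have "(R\<^sup>2) powr (s / 2 + 1) = (R powr 2) powr (s / 2 + 1)" using R0 by simp
    also have "\<dots> = R powr (s + 2)" unfolding powr_powr by (simp add: algebra_simps)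
    finally show ?thesis unfolding Rs .
  qed
  also have "C2 s * Beta (1/2) (s / 2 + 1) * (s\<^sup>2 * (2 + s) * pi / (8 * d) * Beta (1/2) (s / 2 + 3/2)) = 1"
  proof -
    define g where "g = Gamma (s / 2 + 1)"
    define h where "h = Gamma (s / 2 + 3/2)"
    have gh: "g > 0" "h > 0" unfolding g_def h_def using s by (auto intro!: Gamma_real_pos)
    have "s / 2 + 1 \<notin> \<int>\<^sub>\<le>\<^sub>0" using s by (auto dest: nonpos_Ints_nonpos)
    then have "Gamma (s / 2 + 1 + 1) = (s / 2 + 1) * g" unfolding g_def by (rule Gamma_plus1)
    then have "Gamma (1/2 + (s / 2 + 3/2)) = (s / 2 + 1) * g" by (simp add: ac_simps)
    then have b2: "Beta (1/2) (s / 2 + 3/2) = sqrt pi * h / ((s / 2 + 1) * g)"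
      unfolding Beta_def h_def[symmetric] by (simp only: Gamma_one_half_real)
    have "1/2 + (s / 2 + 1) = s / 2 + 3/2" by simp
    then have b1: "Beta (1/2) (s / 2 + 1) = sqrt pi * g / h"
      unfolding Beta_def g_def h_def by (simp only: Gamma_one_half_real)
    have c2: "C2 s = 4 * d / (s\<^sup>2 * pi\<^sup>2)" unfolding C2_def d_def ..
    have pp: "sqrt pi * sqrt pi = pi" by simp
    have "C2 s * Beta (1/2) (s / 2 + 1) * (s\<^sup>2 * (2 + s) * pi / (8 * d) * Beta (1/2) (s / 2 + 3/2)) =
       (4 * d / (s\<^sup>2 * pi\<^sup>2)) * (s\<^sup>2 * (2 + s) * pi / (8 * d)) * ((sqrt pi * sqrt pi) / (s / 2 + 1))"
      unfolding b1 b2 c2 using gh by simp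
    also have "\<dots> = 1"
    proof -
      define w where "w = 2 + s"
      have w: "s / 2 + 1 = w / 2" "2 + s = w" "w > 0" using s by (simp_all add: w_def)
      show ?thesis unfolding pp w(1,2) using w(3) d0 s by (simp add: power2_eq_square)
    qed
    finally show ?thesis .
  qed
  finally show "(LINT y|lborel. rho2 s y) = 1" .
qed

lemma rho_ab_scaled:
  assumes "a > 0" "b > 0"
  shows "rho_ab s a b (vector [a * z $ 1, b * z $ 2]) = 1 / (a * b) * rho2 s z"
  using assms by (simp add: rho_ab_def vector2_eta)

lemma integral_against_rho_ab:
  fixes F :: "real^2 \<Rightarrow> real"
  assumes s: "0 < s" "s < 1" and ab: "a > 0" "b > 0" and F [measurable]: "F \<in> borel_measurable borel"
  shows "(LINT x|lborel. F x * rho_ab s a b x) = (LINT z|lborel. F (vector [a * z $ 1, b * z $ 2]) * rho2 s z)"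
proof -
  have [measurable]: "rho_ab s a b \<in> borel_measurable borel"
    by (intro borel_measurable_continuous_onI continuous_on_rho_ab s ab)
  have "(LINT x|lborel. F x * rho_ab s a b x) =
     (a * b) *\<^sub>R (LINT z::real^2|lborel. F (vector [a * z $ 1, b * z $ 2]) * rho_ab s a b (vector [a * z $ 1, b * z $ 2]))"
    by (rule integral_R2_scale[OF _ ab]) measurable
  then show ?thesis unfolding rho_ab_scaled[OF ab] using ab by simp
qed

lemma
  assumes s: "0 < s" "s < 1" and ab: "a > 0" "b > 0"
  shows integrable_rho_ab: "integrable lborel (rho_ab s a b)"
    and integral_rho_ab: "(LINT x|lborel. rho_ab s a b x) = 1"
    and prob_density_rho_ab: "prob_density (rho_ab s a b)"
proof -
  have m: "rho_ab s a b \<in> borel_measurable borel"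
    by (intro borel_measurable_continuous_onI continuous_on_rho_ab s ab)
  show i: "integrable lborel (rho_ab s a b)"
    using integrable_R2_scale[OF m ab] integrable_rho2[OF s] unfolding rho_ab_scaled[OF ab] by simp
  show l: "(LINT x|lborel. rho_ab s a b x) = 1"
    using integral_against_rho_ab[OF s ab, of "\<lambda>_. 1"] integral_rho2[OF s] by simp
  show "prob_density (rho_ab s a b)" unfolding prob_density_def using i l rho_ab_nonneg[OF s ab] by simp
qed

text \<open>Evenness puts the centre of mass at the origin.\<close>

lemma rho_ab_even: "rho_ab s a b (- x) = rho_ab s a b x"
  by (simp add: rho_ab_def rho2_def norm_R2)

lemma
  fixes x :: "real^2"
  assumes s: "0 < s" "s < 1" and ab: "a > 0" "b > 0"
  shows integrable_rho_ab_displacement: "integrable lborel (\<lambda>y. rho_ab s a b y *\<^sub>R (2 *\<^sub>R (x - y)))"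
    and integral_rho_ab_displacement: "(LINT y|lborel. rho_ab s a b y *\<^sub>R (2 *\<^sub>R (x - y))) = 2 *\<^sub>R x"
proof -
  let ?\<rho> = "rho_ab s a b"
  have [measurable]: "?\<rho> \<in> borel_measurable borel"
    by (intro borel_measurable_continuous_onI continuous_on_rho_ab s ab)
  define N where "N = (a + b) * R2 s"
  have "integrable lborel (\<lambda>y. indicator (cball 0 N) y *\<^sub>R (?\<rho> y *\<^sub>R y))"
    by (intro borel_integrable_compact continuous_intros continuous_on_subset[OF continuous_on_rho_ab[OF s ab]]) auto
  also have "(\<lambda>y. indicator (cball 0 N) y *\<^sub>R (?\<rho> y *\<^sub>R y)) = (\<lambda>y. ?\<rho> y *\<^sub>R y)"
  proof
    fix y
    show "indicator (cball 0 N) y *\<^sub>R (?\<rho> y *\<^sub>R y) = ?\<rho> y *\<^sub>R y"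
      using rho_ab_eq_0[OF s ab, of y] by (cases "norm y \<le> N") (auto simp: N_def)
  qed
  finally have i: "integrable lborel (\<lambda>y. ?\<rho> y *\<^sub>R y)" .
  have "(LINT y|lborel. ?\<rho> (0 - y) *\<^sub>R (0 - y)) = (LINT y|lborel. ?\<rho> y *\<^sub>R y)"
    by (rule integral_reflect_translate) measurable
  then have "- (LINT y|lborel. ?\<rho> y *\<^sub>R y) = (LINT y|lborel. ?\<rho> y *\<^sub>R y)"
    by (simp add: rho_ab_even)
  then have z: "(LINT y|lborel. ?\<rho> y *\<^sub>R y) = 0" by (simp add: eq_neg_iff_add_eq_0 neg_eq_iff_add_eq_0 flip: scaleR_2)
  have e: "?\<rho> y *\<^sub>R (2 *\<^sub>R (x - y)) = ?\<rho> y *\<^sub>R (2 *\<^sub>R x) - 2 *\<^sub>R (?\<rho> y *\<^sub>R y)" for y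
    by (simp add: algebra_simps)
  have i1: "integrable lborel (\<lambda>y. ?\<rho> y *\<^sub>R (2 *\<^sub>R x))"
    using integrable_rho_ab[OF s ab] by (intro integrable_scaleR_left)
  have i2: "integrable lborel (\<lambda>y. 2 *\<^sub>R (?\<rho> y *\<^sub>R y))" using i by (intro integrable_scaleR_right)
  show "integrable lborel (\<lambda>y. ?\<rho> y *\<^sub>R (2 *\<^sub>R (x - y)))"
    unfolding e by (rule Bochner_Integration.integrable_diff[OF i1 i2])
  show "(LINT y|lborel. ?\<rho> y *\<^sub>R (2 *\<^sub>R (x - y))) = 2 *\<^sub>R x"
    unfolding e Bochner_Integration.integral_diff[OF i1 i2]
    by (simp only: integral_scaleR_left[OF integrable_rho_ab[OF s ab]] integral_rho_ab[OF s ab] integral_scaleR_right z) simp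
qed

context C1_pi_periodic begin

text \<open>The gradient of the potential at the origin is an unspecified value, which does not matter since it is
met for a single \<open>y\<close> only.\<close>

lemma
  fixes x :: "real^2"
  assumes s: "0 < s" "s < 1" and ab: "a > 0" "b > 0"
  shows integrable_rho_ab_force: "integrable lborel (\<lambda>y. rho_ab s a b y *\<^sub>R force s (x - y))"
    and integrable_rho_ab_grad: "integrable lborel (\<lambda>y. rho_ab s a b y *\<^sub>R grad (potential s f) (x - y))"
    and velocity_rho_ab: "velocity (potential s f) (rho_ab s a b) x =
      - (LINT y|lborel. rho_ab s a b y *\<^sub>R force s (x - y)) - 2 *\<^sub>R x"
proof -
  let ?\<rho> = "rho_ab s a b"
  obtain M where M: "\<And>z. norm (force s z) \<le> M * norm z powr (- s - 1)" using norm_force_le[of s] by blast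
  have [measurable]: "?\<rho> \<in> borel_measurable borel"
    by (intro borel_measurable_continuous_onI continuous_on_rho_ab s ab)
  show i1: "integrable lborel (\<lambda>y. ?\<rho> y *\<^sub>R force s (x - y))"
    by (rule integrable_convolution_homogeneous[OF s force_measurable M _ rho_ab_le[OF s ab] rho_ab_eq_0[OF s ab]]) auto
  note i2 = integrable_rho_ab_displacement[OF s ab, of x]
  have e: "?\<rho> y *\<^sub>R grad (potential s f) (x - y) = ?\<rho> y *\<^sub>R force s (x - y) + ?\<rho> y *\<^sub>R (2 *\<^sub>R (x - y))"
    if "y \<notin> {x}" for y
    using that by (subst grad_potential) (auto simp: algebra_simps)
  have "integrable lborel (\<lambda>y. ?\<rho> y *\<^sub>R grad (potential s f) (x - y)) \<longleftrightarrow>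
      integrable lborel (\<lambda>y. ?\<rho> y *\<^sub>R force s (x - y) + ?\<rho> y *\<^sub>R (2 *\<^sub>R (x - y)))"
    by (rule integrable_discrete_difference[of "{x}"]) (use e in auto)
  then show "integrable lborel (\<lambda>y. ?\<rho> y *\<^sub>R grad (potential s f) (x - y))"
    using i1 i2 by simp
  have "(LINT y|lborel. ?\<rho> y *\<^sub>R grad (potential s f) (x - y)) =
      (LINT y|lborel. ?\<rho> y *\<^sub>R force s (x - y) + ?\<rho> y *\<^sub>R (2 *\<^sub>R (x - y)))"
    by (rule integral_discrete_difference[of "{x}"]) (use e in auto)
  also have "\<dots> = (LINT y|lborel. ?\<rho> y *\<^sub>R force s (x - y)) + 2 *\<^sub>R x"
    using i1 i2 integral_rho_ab_displacement[OF s ab, of x] by (simp only: Bochner_Integration.integral_add)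
  finally show "velocity (potential s f) ?\<rho> x = - (LINT y|lborel. ?\<rho> y *\<^sub>R force s (x - y)) - 2 *\<^sub>R x"
    unfolding velocity_def convol_def by simp
qed

text \<open>The factor \<open>rho_ab\<close> on both sides restricts the assertion to the ellipse. Outside of it the linear formula
fails in general, but the equation only involves the flux.\<close>

lemma velocity_linear:
  fixes x :: "real^2"
  assumes even: "\<And>x. f x = f (- x)" and s: "0 < s" "s < 1" and ab: "a > 0" "b > 0"
  shows "rho_ab s a b x *\<^sub>R velocity (potential s f) (rho_ab s a b) x =
    rho_ab s a b x *\<^sub>R vector [2 * (A_coeff s f a b - 1) * x $ 1, 2 * (B_coeff s f a b - 1) * x $ 2]"
proof (cases "rho_ab s a b x = 0")
  case False
  then have "(R2 s)\<^sup>2 - ((x $ 1)\<^sup>2 / a\<^sup>2 + (x $ 2)\<^sup>2 / b\<^sup>2) > 0"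
    unfolding rho_ab_eq[OF ab] by (auto simp: max_def split: if_splits)
  then have x: "(x $ 1)\<^sup>2 / a\<^sup>2 + (x $ 2)\<^sup>2 / b\<^sup>2 < (R2 s)\<^sup>2" by simp
  have c: "(LINT y|lborel. rho_ab s a b y *\<^sub>R force s (x - y)) $ i = (LINT y|lborel. rho_ab s a b y * force s (x - y) $ i)" for i
    using integral_bounded_linear[OF bounded_linear_vec_nth integrable_rho_ab_force[OF s ab, of x], of i] by simp
  have a: "force s (x - y) $ i = force s (x - y) \<bullet> axis i 1" for y i by (simp add: inner_axis)
  have "velocity (potential s f) (rho_ab s a b) x = vector [2 * (A_coeff s f a b - 1) * x $ 1, 2 * (B_coeff s f a b - 1) * x $ 2]"
    unfolding velocity_rho_ab[OF s ab] vec_eq_iff forall_2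
    by (simp add: c a force_integral[OF even s ab x]) (simp add: axis_def algebra_simps)
  then show ?thesis by simp
qed simp

end

section \<open>The weak formulation\<close>

lemma smooth_has_derivative:
  assumes "smooth \<phi>"
  shows "(\<phi> has_derivative frechet_derivative \<phi> (at z)) (at z)"
    and "continuous_on UNIV (\<lambda>z. frechet_derivative \<phi> (at z) v)"
proof -
  have d: "iter_deriv \<phi> vs differentiable (at z)" for vs z using assms unfolding smooth_def by blast
  show "(\<phi> has_derivative frechet_derivative \<phi> (at z)) (at z)"
    using d[of "[]" z] by (simp add: frechet_derivative_works)
  have "isCont (iter_deriv \<phi> [v]) z" for z by (rule differentiable_imp_continuous_within[OF d])
  then show "continuous_on UNIV (\<lambda>z. frechet_derivative \<phi> (at z) v)"
    by (simp add: continuous_at_imp_continuous_on)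
qed

lemma smooth_imp_C1_pi_periodic:
  fixes f :: "real \<Rightarrow> real"
  assumes "smooth f" and per: "\<And>x. f (x + pi) = f x"
  shows "C1_pi_periodic f (\<lambda>x. frechet_derivative f (at x) 1)"
proof
  fix x
  have D: "(f has_derivative frechet_derivative f (at x)) (at x)" by (rule smooth_has_derivative(1)[OF assms(1)])
  have "frechet_derivative f (at x) = (*) (frechet_derivative f (at x) 1)"
  proof
    fix h :: real
    have "frechet_derivative f (at x) (h *\<^sub>R 1) = h *\<^sub>R frechet_derivative f (at x) 1"
      by (rule linear_scale[OF has_derivative_linear[OF D]])
    then show "frechet_derivative f (at x) h = frechet_derivative f (at x) 1 * h" by simp
  qed
  then show "(f has_real_derivative frechet_derivative f (at x) 1) (at x)"
    using D unfolding has_field_derivative_def by simp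
qed (use smooth_has_derivative(2)[OF assms(1)] per in auto)

lemma integrable_of_compact_support:
  fixes g :: "'a::euclidean_space \<Rightarrow> 'b::{banach, second_countable_topology}"
  assumes "compact K" "continuous_on K g" "\<And>z. z \<notin> K \<Longrightarrow> g z = 0"
  shows "integrable lborel g"
proof -
  have "integrable lborel (\<lambda>z. indicator K z *\<^sub>R g z)" by (rule borel_integrable_compact[OF assms(1,2)])
  also have "(\<lambda>z. indicator K z *\<^sub>R g z) = g" using assms(3) by (auto simp: fun_eq_iff indicator_def)
  finally show ?thesis .
qed

text \<open>All densities are images of the fixed density \<open>rho2\<close>, so integrals against them are integrals against
\<open>rho2\<close> of functions that depend continuously on \<open>t\<close>, and dominated convergence applies.\<close>

lemma narrowly_continuous_rho_ab:
  fixes a b :: "real \<Rightarrow> real"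
  assumes s: "0 < s" "s < 1" and a: "continuous_on I a" and b: "continuous_on I b"
    and pos: "\<And>t. t \<in> I \<Longrightarrow> 0 < a t \<and> 0 < b t"
  shows "narrowly_continuous_on I (\<lambda>t. rho_ab s (a t) (b t))"
  unfolding narrowly_continuous_on_def
proof (intro allI impI)
  fix f :: "real^2 \<Rightarrow> real" assume "continuous_on UNIV f \<and> bounded (range f)"
  then have cf: "continuous_on UNIV f" and "bounded (range f)" by auto
  then obtain M where M: "\<And>x. \<bar>f x\<bar> \<le> M" unfolding bounded_real by auto
  have mf [measurable]: "f \<in> borel_measurable borel" by (rule borel_measurable_continuous_onI[OF cf])
  have mr [measurable]: "rho2 s \<in> borel_measurable borel" by (intro borel_measurable_continuous_onI continuous_on_rho2 s)
  have scale_meas [measurable]: "(\<lambda>z::real^2. vector [p * z $ 1, q * z $ 2] :: real^2) \<in> borel_measurable borel" for p q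
    by (intro borel_measurable_continuous_onI continuous_intros)
  have "continuous_on I (\<lambda>t. LINT z|lborel. f (vector [a t * z $ 1, b t * z $ 2]) * rho2 s z)"
    unfolding continuous_on_sequentially comp_def
  proof (intro allI ballI impI)
    fix x :: "nat \<Rightarrow> real" and t assume t: "t \<in> I" and x: "(\<forall>n. x n \<in> I) \<and> x \<longlonglongrightarrow> t"
    have ca: "(\<lambda>n. a (x n)) \<longlonglongrightarrow> a t" "(\<lambda>n. b (x n)) \<longlonglongrightarrow> b t"
      using a b x t unfolding continuous_on_sequentially comp_def by auto
    show "(\<lambda>n. LINT z|lborel. f (vector [a (x n) * z $ 1, b (x n) * z $ 2]) * rho2 s z) \<longlonglongrightarrow>
        (LINT z|lborel. f (vector [a t * z $ 1, b t * z $ 2]) * rho2 s z)"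
    proof (rule integral_dominated_convergence[where w = "\<lambda>z. M * rho2 s z"])
      show "integrable lborel (\<lambda>z. M * rho2 s z)" using integrable_rho2[OF s] by simp
      show "AE z in lborel. (\<lambda>n. f (vector [a (x n) * z $ 1, b (x n) * z $ 2]) * rho2 s z) \<longlonglongrightarrow>
          f (vector [a t * z $ 1, b t * z $ 2]) * rho2 s z"
      proof (intro AE_I2 tendsto_mult tendsto_const)
        fix z :: "real^2"
        have c: "continuous_on UNIV (\<lambda>p::real \<times> real. f (vector [fst p * z $ 1, snd p * z $ 2]))"
          by (intro continuous_on_compose2[OF cf] continuous_intros) auto
        have "(\<lambda>n. (a (x n), b (x n))) \<longlonglongrightarrow> (a t, b t)" using ca by (rule tendsto_Pair)
        from continuous_on_tendsto_compose[OF c this]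
        show "(\<lambda>n. f (vector [a (x n) * z $ 1, b (x n) * z $ 2])) \<longlonglongrightarrow> f (vector [a t * z $ 1, b t * z $ 2])"
          by simp
      qed
      show "AE z in lborel. norm (f (vector [a (x n) * z $ 1, b (x n) * z $ 2]) * rho2 s z) \<le> M * rho2 s z" for n
        using M rho2_bounds(1)[OF s] by (intro AE_I2) (auto simp: abs_mult intro!: mult_right_mono)
    qed measurable
  qed
  then show "continuous_on I (\<lambda>t. LINT x|lborel. f x * rho_ab s (a t) (b t) x)"
    by (rule continuous_on_eq) (use pos in \<open>simp add: integral_against_rho_ab[OF s _ _ mf]\<close>)
qed

lemma continuous_on_rho_ab_joint:
  fixes a b :: "real \<Rightarrow> real"
  assumes s: "0 < s" and a: "continuous_on I a" and b: "continuous_on I b"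
    and pos: "\<And>t. t \<in> I \<Longrightarrow> 0 < a t \<and> 0 < b t"
  shows "continuous_on (I \<times> UNIV) (\<lambda>z. rho_ab s (a (fst z)) (b (fst z)) (snd z))"
  unfolding rho_ab_def
  by (intro continuous_intros continuous_on_compose2[OF continuous_on_rho2[OF s]]
        continuous_on_compose2[OF a] continuous_on_compose2[OF b]) (use pos in \<open>fastforce+\<close>)

text \<open>A density that is carried along by the linear maps \<open>diag(a, b)\<close> solves the continuity equation for every
field \<open>u\<close> that agrees with the generator \<open>(\<alpha> x\<^sub>1, \<beta> x\<^sub>2)\<close> where the density does not vanish. In the
coordinates \<open>y\<close> with \<open>x = (a y\<^sub>1, b y\<^sub>2)\<close> the integrand is
\<open>rho2(y) d/dt \<phi>(t, a(t) y\<^sub>1, b(t) y\<^sub>2)\<close>. Its time integral vanishes because the test function does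
at the ends of a time interval that contains the projection of its support.\<close>

lemma transport_weak_formulation:
  fixes a b \<alpha> \<beta> :: "real \<Rightarrow> real" and J :: "real set" and \<phi> :: "real \<times> (real^2) \<Rightarrow> real"
    and u :: "real \<Rightarrow> real^2 \<Rightarrow> real^2"
  assumes s: "0 < s" "s < 1" and J: "open J" "is_interval J"
    and pos: "\<And>t. t \<in> J \<Longrightarrow> 0 < a t \<and> 0 < b t"
    and da: "\<And>t. t \<in> J \<Longrightarrow> (a has_real_derivative \<alpha> t * a t) (at t)"
    and db: "\<And>t. t \<in> J \<Longrightarrow> (b has_real_derivative \<beta> t * b t) (at t)"
    and c\<alpha>: "continuous_on J \<alpha>" and c\<beta>: "continuous_on J \<beta>"
    and u: "\<And>t x. t \<in> J \<Longrightarrow> rho_ab s (a t) (b t) x *\<^sub>R u t x = rho_ab s (a t) (b t) x *\<^sub>R vector [\<alpha> t * x $ 1, \<beta> t * x $ 2]"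
    and \<phi>: "test_function_on (J \<times> UNIV) \<phi>"
  shows "(LINT (t, x)|lborel. rho_ab s (a t) (b t) x *
     (deriv (\<lambda>\<tau>. \<phi> (\<tau>, x)) t + u t x \<bullet> grad (\<lambda>y. \<phi> (t, y)) x)) = 0" (is "?lhs = 0")
proof -
  define K where "K = closure {z. \<phi> z \<noteq> 0}"
  have sm: "smooth \<phi>" and K: "compact K" "K \<subseteq> J \<times> UNIV"
    using \<phi> unfolding test_function_on_def K_def by auto
  \<comment> \<open>The total derivative of the test function; it vanishes off the support \<open>K\<close>, in particular at all times outside \<open>J\<close>.\<close>
  define D where "D z v = frechet_derivative \<phi> (at z) v" for z v
  have hD: "(\<phi> has_derivative D z) (at z)" for z
    using smooth_has_derivative(1)[OF sm, of z] unfolding D_def[abs_def] .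
  have cD: "continuous_on A (\<lambda>z. D z v)" for v A
    unfolding D_def by (rule continuous_on_subset[OF smooth_has_derivative(2)[OF sm] subset_UNIV])
  have linD: "linear (D z)" for z by (rule has_derivative_linear[OF hD])
  have \<phi>0: "\<phi> z = 0" if "z \<notin> K" for z
    using that closure_subset[of "{z. \<phi> z \<noteq> 0}"] unfolding K_def by auto
  have D0: "D z v = 0" if "z \<notin> K" for z v
  proof -
    have "open (- K)" "z \<in> - K" using that by (auto simp: K_def)
    have "((\<lambda>_. 0) has_derivative (\<lambda>_. 0)) (at z)" by simp
    then have "(\<phi> has_derivative (\<lambda>_. 0)) (at z)"
      by (rule has_derivative_transform_within_open[OF _ \<open>open (- K)\<close> \<open>z \<in> - K\<close>]) (use \<phi>0 in auto)
    then have "D z = (\<lambda>_. 0)" using has_derivative_unique[OF hD] by blast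
    then show ?thesis by simp
  qed
  have dt: "deriv (\<lambda>\<tau>. \<phi> (\<tau>, x)) t = D (t, x) (1, 0)" for t x
  proof -
    have "((\<lambda>\<tau>. \<phi> (\<tau>, x)) has_derivative (\<lambda>h. D (t, x) (h, 0))) (at t)"
      by (rule has_derivative_compose[OF _ hD]) (auto intro!: derivative_eq_intros)
    moreover have "(\<lambda>h. D (t, x) (h, 0)) = (*) (D (t, x) (1, 0))"
    proof
      fix h
      have "D (t, x) (h *\<^sub>R (1, 0)) = h *\<^sub>R D (t, x) (1, 0)" by (rule linear_scale[OF linD])
      then show "D (t, x) (h, 0) = D (t, x) (1, 0) * h" by simp
    qed
    ultimately show ?thesis by (intro DERIV_imp_deriv) (simp add: has_field_derivative_def)
  qed
  have dx: "v \<bullet> grad (\<lambda>y. \<phi> (t, y)) x = D (t, x) (0, v)" for t x v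
  proof -
    have h: "((\<lambda>y. \<phi> (t, y)) has_derivative (\<lambda>h. D (t, x) (0, h))) (at x)"
      by (rule has_derivative_compose[OF _ hD]) (auto intro!: derivative_eq_intros)
    define w where "w = (\<Sum>i\<in>Basis. D (t, x) (0, i) *\<^sub>R i)"
    have w: "D (t, x) (0, v) = v \<bullet> w" for v
    proof -
      have lin: "linear (\<lambda>h. D (t, x) (0, h))" by (rule has_derivative_linear[OF h])
      have "D (t, x) (0, v) = D (t, x) (0, \<Sum>i\<in>Basis. (v \<bullet> i) *\<^sub>R i)" by (simp add: euclidean_representation)
      also have "\<dots> = (\<Sum>i\<in>Basis. (v \<bullet> i) *\<^sub>R D (t, x) (0, i))"
        by (simp add: linear_sum[OF lin] linear_scale[OF lin])
      also have "\<dots> = v \<bullet> w" unfolding w_def by (simp add: inner_sum_right mult.commute)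
      finally show ?thesis .
    qed
    have "grad (\<lambda>y. \<phi> (t, y)) x = w"
      unfolding grad_def
    proof (rule the_equality)
      show "GDERIV (\<lambda>y. \<phi> (t, y)) x :> w" using h unfolding gderiv_def w .
      fix E assume "GDERIV (\<lambda>y. \<phi> (t, y)) x :> E"
      then have "(\<lambda>h. h \<bullet> E) = (\<lambda>h. h \<bullet> w)" using h unfolding gderiv_def w by (rule has_derivative_unique)
      then have "h \<bullet> E = h \<bullet> w" for h by (rule fun_cong)
      then show "E = w" using vector_eq_ldot by blast
    qed
    then show ?thesis using w by simp
  qed
  define e1 :: "real^2" where "e1 = axis 1 1"
  define e2 :: "real^2" where "e2 = axis 2 1"
  have expand: "D z (1, vector [p, q]) = D z (1, 0) + p * D z (0, e1) + q * D z (0, e2)" for z p q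
  proof -
    have v: "(1, vector [p, q]) = (1, 0) + (p *\<^sub>R (0, e1) + q *\<^sub>R (0, e2))"
      by (simp add: e1_def e2_def vec_eq_iff forall_2 axis_def)
    show ?thesis unfolding v linear_add[OF linD] linear_scale[OF linD] by simp
  qed
  define g where "g t x = rho_ab s (a t) (b t) x * D (t, x) (1, vector [\<alpha> t * x $ 1, \<beta> t * x $ 2])" for t x
  have integrand: "rho_ab s (a t) (b t) x * (deriv (\<lambda>\<tau>. \<phi> (\<tau>, x)) t + u t x \<bullet> grad (\<lambda>y. \<phi> (t, y)) x) = g t x" for t x
  proof (cases "(t, x) \<in> K")
    case True
    then have "t \<in> J" using K by auto
    have add: "D (t, x) (1, v) = D (t, x) (1, 0) + D (t, x) (0, v)" for v
      using linear_add[OF linD, of "(t, x)" "(1, 0)" "(0, v)"] by simp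
    have lin0: "r * D (t, x) (0, v) = D (t, x) (0, r *\<^sub>R v)" for r v
      using linear_scale[OF linD, of "(t, x)" r "(0, v)"] by simp
    show ?thesis unfolding g_def dt dx add[of "vector [\<alpha> t * x $ 1, \<beta> t * x $ 2]"] distrib_left lin0 u[OF \<open>t \<in> J\<close>] ..
  next
    case False
    then show ?thesis unfolding g_def dt dx by (simp add: D0)
  qed
  have ca: "continuous_on J a" and cb: "continuous_on J b"
    using da db by (auto intro!: DERIV_continuous_on intro: has_field_derivative_at_within)
  have lift: "continuous_on (J \<times> UNIV) (\<lambda>z :: real \<times> (real^2). \<eta> (fst z))" if "continuous_on J \<eta>" for \<eta> :: "real \<Rightarrow> real"
    by (rule continuous_on_compose2[OF that]) (auto intro!: continuous_intros)
  have cr: "continuous_on (J \<times> UNIV) (\<lambda>z. rho_ab s (a (fst z)) (b (fst z)) (snd z))"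
    by (rule continuous_on_rho_ab_joint[OF s(1) ca cb pos])
  have cD': "continuous_on A (\<lambda>z. D (fst z, snd z) v)" for v A
    using cD by simp
  have cg: "continuous_on (J \<times> UNIV) (\<lambda>z. g (fst z) (snd z))"
    unfolding g_def expand by (intro continuous_intros cr cD' lift c\<alpha> c\<beta>)
  have ig: "integrable lborel (\<lambda>z. g (fst z) (snd z))"
    by (rule integrable_of_compact_support[OF K(1) continuous_on_subset[OF cg K(2)]]) (simp add: g_def D0)
  have "?lhs =
      (LINT z|lborel. g (fst z) (snd z))"
    unfolding integrand by (simp add: case_prod_beta')
  also have "\<dots> = (LINT t|lborel. LINT x|lborel. g t x)"
    using lborel_pair.integral_fst[of g] ig by (simp add: lborel_prod case_prod_beta')
  finally have step1: "?lhs =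
      (LINT t|lborel. LINT x|lborel. g t x)" .
  show ?thesis
  proof (cases "K = {}")
    case True
    then have "g = (\<lambda>_ _. 0)" by (intro ext) (simp add: g_def D0)
    then show ?thesis unfolding step1 by simp
  next
    case False
    define T where "T = fst ` K"
    have T: "compact T" "T \<subseteq> J" "T \<noteq> {}"
      unfolding T_def using K False by (auto intro!: compact_continuous_image continuous_intros)
    obtain l where l: "l \<in> T" "\<And>t. t \<in> T \<Longrightarrow> l \<le> t" using compact_attains_inf[OF T(1,3)] by blast
    obtain r where r: "r \<in> T" "\<And>t. t \<in> T \<Longrightarrow> t \<le> r" using compact_attains_sup[OF T(1,3)] by blast
    obtain \<epsilon>1 where \<epsilon>1: "\<epsilon>1 > 0" "cball l \<epsilon>1 \<subseteq> J" using J(1) l(1) T(2) open_contains_cball by blast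
    obtain \<epsilon>2 where \<epsilon>2: "\<epsilon>2 > 0" "cball r \<epsilon>2 \<subseteq> J" using J(1) r(1) T(2) open_contains_cball by blast
    \<comment> \<open>Strictly outside the projection of the support, so that the test function vanishes there at every point.\<close>
    define t0 where "t0 = l - \<epsilon>1"
    define t1 where "t1 = r + \<epsilon>2"
    have tJ: "t0 \<in> J" "t1 \<in> J" using \<epsilon>1 \<epsilon>2 by (auto simp: t0_def t1_def dist_real_def)
    have tT: "t0 \<notin> T" "t1 \<notin> T" using l(2)[of t0] r(2)[of t1] \<epsilon>1 \<epsilon>2 by (auto simp: t0_def t1_def)
    have TI: "T \<subseteq> {t0..t1}" 
    proof
      fix t assume "t \<in> T"
      then have "l \<le> t" "t \<le> r" by (rule l(2), rule r(2))
      then show "t \<in> {t0..t1}" using \<epsilon>1(1) \<epsilon>2(1) by (simp add: t0_def t1_def)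
    qed
    have IJ: "{t0..t1} \<subseteq> J" 
    proof
      fix t assume "t \<in> {t0..t1}"
      then show "t \<in> J" using mem_is_interval_1_I[OF J(2) tJ] by simp
    qed
    have t01: "t0 \<le> t1" using TI l(1) by fastforce
    define L where "L t y = (vector [a t * y $ 1, b t * y $ 2] :: real^2)" for t and y :: "real^2"
    define h where "h t y = D (t, L t y) (1, vector [\<alpha> t * (a t * y $ 1), \<beta> t * (b t * y $ 2)])" for t y
    have h0: "h t y = 0" if "t \<notin> T" for t y
      unfolding h_def using that D0[of "(t, L t y)"] by (force simp: T_def)
    have inner: "(LINT x|lborel. g t x) = (LINT y|lborel. indicator {t0..t1} t * h t y * rho2 s y)" for t
    proof (cases "t \<in> T")
      case True
      then have tj: "t \<in> J" "t \<in> {t0..t1}" using T TI by auto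
      have ab: "a t > 0" "b t > 0" using pos[OF tj(1)] by auto
      have "continuous_on UNIV (\<lambda>x. D (t, x) (1, vector [\<alpha> t * x $ 1, \<beta> t * x $ 2]))"
        unfolding expand by (intro continuous_intros continuous_on_compose2[OF cD[of UNIV]]) auto
      then have m: "(\<lambda>x. D (t, x) (1, vector [\<alpha> t * x $ 1, \<beta> t * x $ 2])) \<in> borel_measurable borel"
        by (rule borel_measurable_continuous_onI)
      have "(LINT x|lborel. g t x) = (LINT x|lborel. D (t, x) (1, vector [\<alpha> t * x $ 1, \<beta> t * x $ 2]) * rho_ab s (a t) (b t) x)"
        unfolding g_def by (simp add: mult.commute)
      also have "\<dots> = (LINT y|lborel. h t y * rho2 s y)"
        unfolding integral_against_rho_ab[OF s ab m] h_def L_def by simp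
      finally show ?thesis using tj by simp
    next
      case False
      then have "(t, x) \<notin> K" for x by (force simp: T_def)
      then have "g t x = 0" for x by (simp add: g_def D0)
      then show ?thesis using h0[OF False] by simp
    qed
    have cL: "continuous_on (J \<times> UNIV) (\<lambda>z. L (fst z) (snd z))"
      unfolding L_def by (intro continuous_intros lift ca cb)
    have "continuous_on (J \<times> UNIV) (\<lambda>z. D (fst z, L (fst z) (snd z)) v)" for v
      by (rule continuous_on_compose2[OF cD[of UNIV v]]) (auto intro!: continuous_intros cL)
    then have ch: "continuous_on (J \<times> UNIV) (\<lambda>z. h (fst z) (snd z))"
      unfolding h_def expand by (intro continuous_intros lift c\<alpha> c\<beta> ca cb)
    have "integrable lborel (\<lambda>z. indicator {t0..t1} (fst z) * h (fst z) (snd z) * rho2 s (snd z))"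
    proof (rule integrable_of_compact_support[of "{t0..t1} \<times> cball 0 (R2 s)"])
      show "compact ({t0..t1} \<times> cball (0::real^2) (R2 s))" by (intro compact_Times) auto
      have "continuous_on ({t0..t1} \<times> cball 0 (R2 s)) (\<lambda>z. h (fst z) (snd z) * rho2 s (snd z))"
        by (intro continuous_intros continuous_on_subset[OF ch] continuous_on_compose2[OF continuous_on_rho2[OF s(1)]])
           (use IJ in auto)
      then show "continuous_on ({t0..t1} \<times> cball 0 (R2 s)) (\<lambda>z. indicator {t0..t1} (fst z) * h (fst z) (snd z) * rho2 s (snd z))"
        by (rule continuous_on_eq) auto
      fix z :: "real \<times> (real^2)" assume "z \<notin> {t0..t1} \<times> cball 0 (R2 s)"
      then have "fst z \<notin> {t0..t1} \<or> norm (snd z) > R2 s" by (cases z) auto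
      then show "indicator {t0..t1} (fst z) * h (fst z) (snd z) * rho2 s (snd z) = 0"
        using rho2_bounds(3)[OF s] by auto
    qed
    then have "integrable (lborel \<Otimes>\<^sub>M lborel) (\<lambda>(t, y). indicator {t0..t1} t * h t y * rho2 s y)"
      by (simp add: lborel_prod case_prod_beta')
    from lborel_pair.Fubini_integral[OF this]
    have step2: "(LINT t|lborel. LINT x|lborel. g t x) = (LINT y|lborel. LINT t|lborel. indicator {t0..t1} t * h t y * rho2 s y)"
      unfolding inner by simp
    have step3: "(LINT t|lborel. indicator {t0..t1} t * h t y * rho2 s y) = 0" for y
    proof -
      have "continuous_on {t0..t1} (\<lambda>t. h (fst (t, y)) (snd (t, y)))"
        by (rule continuous_on_compose2[OF ch, where f = "\<lambda>t. (t, y)"]) (use IJ in \<open>auto intro!: continuous_intros\<close>)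
      then have chy: "continuous_on {t0..t1} (\<lambda>t. h t y)" by simp
      have "((\<lambda>t. \<phi> (t, L t y)) has_vector_derivative h t y) (at t within {t0..t1})" if "t \<in> {t0..t1}" for t
      proof -
        have tj: "t \<in> J" using that IJ by auto
        have "((\<lambda>t. (t, L t y)) has_vector_derivative (1, vector [\<alpha> t * (a t * y $ 1), \<beta> t * (b t * y $ 2)])) (at t)"
        proof (rule has_vector_derivative_Pair)
          have v: "vector [p, q] = p *\<^sub>R e1 + q *\<^sub>R e2" for p q :: real
            by (simp add: e1_def e2_def vec_eq_iff forall_2 axis_def)
          show "((\<lambda>t. L t y) has_vector_derivative vector [\<alpha> t * (a t * y $ 1), \<beta> t * (b t * y $ 2)]) (at t)"
            unfolding L_def v
            by (intro has_vector_derivative_add has_vector_derivative_scaleR[THEN has_vector_derivative_eq_rhs] has_vector_derivative_const)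
               (auto intro!: derivative_eq_intros da[OF tj] db[OF tj])
        qed simp
        from has_derivative_compose[OF this[unfolded has_vector_derivative_def] hD]
        have "((\<lambda>t. \<phi> (t, L t y)) has_derivative (\<lambda>k. D (t, L t y) (k *\<^sub>R (1, vector [\<alpha> t * (a t * y $ 1), \<beta> t * (b t * y $ 2)])))) (at t)"
          by simp
        then have "((\<lambda>t. \<phi> (t, L t y)) has_vector_derivative h t y) (at t)"
          unfolding linear_scale[OF linD] has_vector_derivative_def h_def .
        then show ?thesis by (rule has_vector_derivative_at_within)
      qed
      from fundamental_theorem_of_calculus[OF t01 this]
      have "((\<lambda>t. h t y) has_integral \<phi> (t1, L t1 y) - \<phi> (t0, L t0 y)) {t0..t1}" .
      moreover have "\<phi> (t1, L t1 y) = 0" "\<phi> (t0, L t0 y) = 0"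
        using tT by (auto intro!: \<phi>0 simp: T_def image_iff)
      ultimately have "integral {t0..t1} (\<lambda>t. h t y) = 0" by (simp add: integral_unique)
      then have "(LINT t:{t0..t1}|lborel. h t y) = 0" using LINT_Icc_eq_integral[OF chy] by simp
      then show ?thesis by (simp add: set_lebesgue_integral_def)
    qed
    show ?thesis unfolding step1 step2 step3 by simp
  qed
qed

theorem theorem4p1:
  fixes s :: real and \<Omega> a b :: "real \<Rightarrow> real" and I :: "real set"
  assumes "0 < s" and "s < 1"
    and "smooth \<Omega>"
    and "\<forall>\<theta>. 0 < \<Omega> \<theta>"
    and "\<forall>\<theta>. \<Omega> (\<theta> + pi) = \<Omega> \<theta>"
    and "\<forall>\<theta>. \<Omega> \<theta> = \<Omega> (- \<theta>)"
    and "is_interval I"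
    and "\<forall>t\<in>I. 0 < a t \<and> 0 < b t"
    and "\<forall>t\<in>I. (a has_real_derivative 2 * (A_coeff s \<Omega> (a t) (b t) - 1) * a t) (at t within I)"
    and "\<forall>t\<in>I. (b has_real_derivative 2 * (B_coeff s \<Omega> (a t) (b t) - 1) * b t) (at t within I)"
  shows "W2_gradient_flow (potential s \<Omega>) I (\<lambda>t. rho_ab s (a t) (b t))"
proof -
  note s = assms(1,2)
  have sm: "C1_pi_periodic \<Omega> (\<lambda>x. frechet_derivative \<Omega> (at x) 1)"
    using assms by (intro smooth_imp_C1_pi_periodic) auto
  interpret C1_pi_periodic \<Omega> "\<lambda>x. frechet_derivative \<Omega> (at x) 1" by (rule sm)
  have even: "\<Omega> x = \<Omega> (- x)" for x using assms by blast
  have pos: "0 < a t \<and> 0 < b t" if "t \<in> I" for t using assms that by blast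
  have ca: "continuous_on I a" and cb: "continuous_on I b"
    using assms(9,10) by (auto intro!: DERIV_continuous_on)
  define \<alpha> where "\<alpha> t = 2 * (A_coeff s \<Omega> (a t) (b t) - 1)" for t
  define \<beta> where "\<beta> t = 2 * (B_coeff s \<Omega> (a t) (b t) - 1)" for t
  have c\<alpha>: "continuous_on I \<alpha>"
  proof -
    have "continuous_on I (\<lambda>t. 2 * (1 / (s * pi) * integral {-pi..pi} (\<lambda>\<theta>. \<Omega> \<theta> * ellipse_kernel s 1 0 (a t) (b t) \<theta>) - 1))"
      by (intro continuous_intros continuous_on_ellipse_integral cont ca cb pos)
    then show ?thesis
      by (rule continuous_on_eq) (use pos in \<open>simp add: \<alpha>_def A_coeff_eq[OF sm s]\<close>)
  qed
  have c\<beta>: "continuous_on I \<beta>"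
  proof -
    have "continuous_on I (\<lambda>t. 2 * (1 / (s * pi) * integral {-pi..pi} (\<lambda>\<theta>. \<Omega> \<theta> * ellipse_kernel s 0 1 (a t) (b t) \<theta>) - 1))"
      by (intro continuous_intros continuous_on_ellipse_integral cont ca cb pos)
    then show ?thesis
      by (rule continuous_on_eq) (use pos in \<open>simp add: \<beta>_def B_coeff_eq[OF sm s]\<close>)
  qed
  let ?J = "interior I"
  have JI: "t \<in> I" if "t \<in> ?J" for t using that interior_subset by blast
  have vel: "rho_ab s (a t) (b t) x *\<^sub>R velocity (potential s \<Omega>) (rho_ab s (a t) (b t)) x =
      rho_ab s (a t) (b t) x *\<^sub>R vector [\<alpha> t * x $ 1, \<beta> t * x $ 2]" if "t \<in> I" for t x
    unfolding \<alpha>_def \<beta>_def using pos[OF that] by (intro velocity_linear even s) auto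
  have cr: "continuous_on (I \<times> UNIV) (\<lambda>z. rho_ab s (a (fst z)) (b (fst z)) (snd z))"
    by (rule continuous_on_rho_ab_joint[OF s(1) ca cb pos])
  show ?thesis
    unfolding W2_gradient_flow_def
  proof (intro conjI ballI allI impI)
    fix t assume "t \<in> I"
    then show "prob_density (rho_ab s (a t) (b t))" using pos by (intro prob_density_rho_ab s) auto
  next
    show "narrowly_continuous_on I (\<lambda>t. rho_ab s (a t) (b t))"
      by (rule narrowly_continuous_rho_ab[OF s ca cb pos])
  next
    fix t and x :: "real^2" assume "t \<in> I"
    then show "integrable lborel (\<lambda>y. rho_ab s (a t) (b t) y *\<^sub>R grad (potential s \<Omega>) (x - y))"
      using pos by (intro integrable_rho_ab_grad s) auto
  next
    fix K :: "(real \<times> (real^2)) set" assume K: "compact K \<and> K \<subseteq> ?J \<times> UNIV"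
    then have KI: "K \<subseteq> I \<times> UNIV" using JI by auto
    show "set_integrable lborel K (\<lambda>(t, x). rho_ab s (a t) (b t) x)"
      unfolding set_integrable_def case_prod_beta'
      using K by (intro borel_integrable_compact continuous_on_subset[OF cr KI]) auto
    have "continuous_on K (\<lambda>z. rho_ab s (a (fst z)) (b (fst z)) (snd z) *\<^sub>R
        (vector [\<alpha> (fst z) * snd z $ 1, \<beta> (fst z) * snd z $ 2] :: real^2))"
      using KI by (intro continuous_intros continuous_on_subset[OF cr KI] continuous_on_compose2[OF c\<alpha>] continuous_on_compose2[OF c\<beta>]) auto
    then have "continuous_on K (\<lambda>(t, x). rho_ab s (a t) (b t) x *\<^sub>R velocity (potential s \<Omega>) (rho_ab s (a t) (b t)) x)"
      by (rule continuous_on_eq) (use vel KI in force)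
    then show "set_integrable lborel K (\<lambda>(t, x). rho_ab s (a t) (b t) x *\<^sub>R velocity (potential s \<Omega>) (rho_ab s (a t) (b t)) x)"
      unfolding set_integrable_def using K by (intro borel_integrable_compact) auto
  next
    fix \<phi> :: "real \<times> (real^2) \<Rightarrow> real" assume \<phi>: "test_function_on (?J \<times> UNIV) \<phi>"
    have da: "(a has_real_derivative \<alpha> t * a t) (at t)" "(b has_real_derivative \<beta> t * b t) (at t)" if "t \<in> ?J" for t
      using assms(9,10) JI[OF that] at_within_interior[OF that] unfolding \<alpha>_def \<beta>_def by metis+
    have "is_interval ?J" using assms(7) by (simp add: is_interval_convex_1 convex_interior)
    then show "(LINT (t, x)|lborel. rho_ab s (a t) (b t) x *
        (deriv (\<lambda>\<tau>. \<phi> (\<tau>, x)) t + velocity (potential s \<Omega>) (rho_ab s (a t) (b t)) x \<bullet> grad (\<lambda>y. \<phi> (t, y)) x)) = 0"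
      using pos JI vel da
      by (intro transport_weak_formulation[OF s open_interior _ _ _ _ continuous_on_subset[OF c\<alpha> interior_subset]
            continuous_on_subset[OF c\<beta> interior_subset] _ \<phi>]) auto
  qed
qed

end
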